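(* Let $\mathcal C$ be a closed resource category with a chosen object $o$, and let $[\![-]\!]$ be the interpretation of the resource calculus in $\mathcal C$ described in the context. If $S$ is a finite formal sum of terms of $\mathsf{Tm}(\Gamma;A)$ and $S\leadsto S'$, then $[\![S]\!]=[\![S']\!]$.
   Context: Resource calculus. Resource terms and bags: $s::=x\mid\lambda x.s\mid s\,b$, $b::=[s_1,\dots,s_n]$ (finite multiset, $n\ge0$), up to $\alpha$-conversion; $*$ is multiset union. Constructs extend to finite formal sums by (multi)linearity ($\lambda x.\sum s_i=\sum\lambda x.s_i$, $(\sum_i s_i)(\sum_j b_j)=\sum_{i,j}s_ib_j$, $[\sum_i s_i]*\sum_j b_j=\sum_{i,j}[s_i]*b_j$). For a bag $b$ enumerated $(a_1,\dots,a_n)$, $\sum_{b\lhd b_1*\cdots*b_k}f(b_1,\dots,b_k)$ sums over all $p:\{1..n\}\to\{1..k\}$ with $b_i=[a_j\mid p(j)=i]$. Resource substitution: $y\langle b/x\rangle=t$ if $y=x$, $b=[t]$; $=y$ if $y\ne x$, $b=[]$; $=0$ otherwise; $(\lambda z.s)\langle b/x\rangle=\lambda z.(s\langle b/x\rangle)$ ($z$ fresh); $(s\,c)\langle b/x\rangle=\sum_{b\lhd b_1*b_2}(s\langle b_1/x\rangle)(c\langle b_2/x\rangle)$; $[s_1,\dots,s_n]\langle b/x\rangle=\sum_{b\lhd b_1*\cdots*b_n}[s_1\langle b_1/x\rangle,\dots,s_n\langle b_n/x\rangle]$. Reduction: $(\lambda x.s)b\leadsto s\langle b/x\rangle$; if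 $s\leadsto S'$ then $\lambda x.s\leadsto\lambda x.S'$, $s\,b\leadsto S'\,b$, $[s]*b\leadsto[S']*b$; if $b\leadsto B'$ then $s\,b\leadsto s\,B'$; on sums, $t+T\leadsto T'+T$ whenever $t\leadsto T'$. Types $A::=o\mid A\to B$, $\vec A\to B=A_1\to(\cdots\to(A_n\to B))$; each variable has a fixed type. Sequences $\vec b=\langle b_1,\dots,b_k\rangle$, $s\,\vec b=(\cdots(s\,b_1)\cdots)b_k$. Typing rules: (abs) $\Gamma,x:A\vdash_{\mathsf{Tm}}s:B\Rightarrow\Gamma\vdash_{\mathsf{Tm}}\lambda x.s:A\to B$; (app) $\Gamma\vdash_{\mathsf{Tm}}s:A\to B$, $\Gamma\vdash_{\mathsf{Bg}}b:A\Rightarrow\Gamma\vdash_{\mathsf{Tm}}s\,b:B$; (var) $\Gamma,x:\vec A\to o\vdash_{\mathsf{Sq}}\vec b:\vec A\Rightarrow\Gamma,x:\vec A\to o\vdash_{\mathsf{Tm}}x\,\vec b:o$; (bag) $\Gamma\vdash_{\mathsf{Tm}}s_i:A$ for all $i\Rightarrow\Gamma\vdash_{\mathsf{Bg}}[s_1,\dots,s_n]:A$; (seq) $\Gamma\vdash_{\mathsf{Bg}}b_i:A_i$ for all $i\Rightarrow\Gamma\vdash_{\mathsf{Sq}}\langle b_1,\dots,b_n\rangle:\langle A_1,\dots,A_n\rangle$. $\mathsf{Tm}(\Gamma;A)$, $\mathsf{Bg}(\Gamma;A)$, $\mathsf{Sq}(\Gamma;\vec A)$ denote the typable expressions. Resource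 categories. An additive symmetric monoidal category is a symmetric monoidal category $(\otimes,I,\alpha,\lambda,\rho,\gamma)$ whose hom-sets are commutative monoids $(+,0)$, with composition and $\otimes$ preserving sums and $0$ in each argument. A bialgebra on $A$ consists of $\delta_A:A\to A\otimes A$, $\epsilon_A:A\to I$, $\mu_A:A\otimes A\to A$, $\eta_A:I\to A$ with $(A,\mu_A,\eta_A)$ a commutative monoid, $(A,\delta_A,\epsilon_A)$ a commutative comonoid, and (up to the structural isomorphisms) $\delta_A\circ\mu_A=(\mu_A\otimes\mu_A)\circ(A\otimes\gamma_{A,A}\otimes A)\circ(\delta_A\otimes\delta_A)$, $\delta_A\circ\eta_A=\eta_A\otimes\eta_A$, $\epsilon_A\circ\mu_A=\epsilon_A\otimes\epsilon_A$, $\epsilon_A\circ\eta_A=\mathrm{id}_I$. A pointed identity on $A$ is an idempotent $\mathrm{id}^\bullet_A:A\to A$ with (up to unitors) $\delta_A\circ\mathrm{id}^\bullet_A=\mathrm{id}^\bullet_A\otimes\eta_A+\eta_A\otimes\mathrm{id}^\bullet_A$, $\mathrm{id}^\bullet_A\circ\mu_A=\mathrm{id}^\bullet_A\otimes\epsilon_A+\epsilon_A\otimes\mathrm{id}^\bullet_A$, $\epsilon_A\circ\mathrm{id}^\bullet_A=0$, $\mathrm{id}^\bullet_A\circ\eta_A=0$. A resource category is an additive symmetric monoidal category in which every object has a bialgebra structure and a pointed identity, such that (up to associativity isomorphisms) $\delta_{A\otimes B}=(A\otimes\gamma_{A,B}\otimes B)\circ(\delta_A\otimes\delta_B)$, $\epsilon_{A\otimes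 B}=\lambda_I\circ(\epsilon_A\otimes\epsilon_B)$, $\epsilon_I=\mathrm{id}_I$, and dually $\mu_{A\otimes B}=(\mu_A\otimes\mu_B)\circ(A\otimes\gamma_{B,A}\otimes B)$, $\eta_{A\otimes B}=(\eta_A\otimes\eta_B)\circ\lambda_I^{-1}$, $\eta_I=\mathrm{id}_I$. It is closed if each $-\otimes A$ has a right adjoint $A\Rightarrow-$, with currying bijection $\Lambda_{\Gamma,A,B}:\mathcal C(\Gamma\otimes A,B)\cong\mathcal C(\Gamma,A\Rightarrow B)$; $\mathrm{ev}_{A,B}=\Lambda^{-1}(\mathrm{id}_{A\Rightarrow B})$. Derived notions: $1=\eta_B\circ\epsilon_A\in\mathcal C(A,B)$; $f*g=\mu_B\circ(f\otimes g)\circ\delta_A$; for a bag $\mathbf f=[f_1,\dots,f_n]$ of morphisms, $\Pi\mathbf f=f_1*\cdots*f_n$ ($=1$ if empty); $f$ is pointed if $\mathrm{id}^\bullet_B\circ f=f$; $\mathcal C_\bullet(A,B)$ is the set of pointed morphisms. Interpretation. Pairing $\langle f,g\rangle=(f\otimes g)\circ\delta_\Gamma$ (iterated for tuples); projections are built from $\epsilon$ and unitors. $[\![o]\!]=o$, $[\![A\to B]\!]=[\![A]\!]\Rightarrow[\![B]\!]$, $[\![\langle A_1,\dots,A_n\rangle]\!]=[\![A_1]\!]\otimes\cdots\otimes[\![A_n]\!]$, $[\![\Gamma]\!]=\bigotimes_{(x:A)\in\Gamma}[\![A]\!]$. For $A=\vec B\to o$, $\zeta_A:[\![A]\!]\cong[\![\vec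 B]\!]\Rightarrow o$ is the canonical isomorphism induced by currying and associativity; for $(x:A)\in\Gamma$, $\mathrm{var}^\Gamma_x=\zeta_A\circ\pi_x$ with $\pi_x:[\![\Gamma]\!]\to[\![A]\!]$ the projection; $\mathrm{merge}_{\Gamma,\Delta}:[\![\Gamma]\!]\otimes[\![\Delta]\!]\cong[\![\Gamma,\Delta]\!]$ the canonical iso. Terms are interpreted as pointed morphisms, bags as bags of morphisms and sequences as tuples of bags of morphisms; $\mathrm{pack}\langle\mathbf f_1,\dots,\mathbf f_n\rangle=\langle\Pi\mathbf f_1,\dots,\Pi\mathbf f_n\rangle$. Clauses: $[\![\lambda x.s]\!]=\Lambda_{[\![\Gamma]\!],[\![A]\!],[\![B]\!]}([\![s]\!]\circ\mathrm{merge}_{[\![\Gamma]\!],[\![x:A]\!]})$; $[\![x\,\vec b]\!]=\mathrm{ev}_{[\![\vec A]\!],o}\circ\langle\mathrm{id}^\bullet_{[\![\vec A]\!]\Rightarrow o}\circ\mathrm{var}^\Gamma_x,\mathrm{pack}([\![\vec b]\!])\rangle$; $[\![s\,b]\!]=\mathrm{ev}_{[\![A]\!],[\![B]\!]}\circ\langle[\![s]\!],\Pi[\![b]\!]\rangle$; $[\![[s_1,\dots,s_n]]\!]=[[\![s_1]\!],\dots,[\![s_n]\!]]$; $[\![\langle b_1,\dots,b_n\rangle]\!]=\langle[\![b_1]\!],\dots,[\![b_n]\!]\rangle$; $[\![\sum_i s_i]\!]=\sum_i[\![s_i]\!]$.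
   Formalization: The formal theorem additionally assumes that currying commutes with pointed identities, Λ(id•_B ∘ f) = id•_{A⇒B} ∘ Λ(f); without it terms need not be interpreted as pointed morphisms and the claim fails (e.g. in relations between finite multisets with A⇒B = A+B). *)

theory Defs
  imports "HOL-Library.Multiset"
begin

section \<open>Enumerations of multisets\<close>

text \<open>
  The constructions below that go through an enumeration are invariant under permutation of
  the list, so the choice made here is immaterial.
\<close>

definition enum :: "'a multiset \<Rightarrow> 'a list" where
  "enum M = (SOME xs. mset xs = M)"

lemma mset_enum [simp]: "mset (enum M) = M"
  unfolding enum_def by (rule someI_ex) (rule ex_mset)

lemma set_enum [simp]: "set (enum M) = set_mset M"
  by (metis mset_enum set_mset_mset)

lemma enum_empty [simp]: "enum {#} = []"
  by (metis mset_zero_iff mset_enum)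

text \<open>
  The index family of the sums over \<open>b \<lhd> b\<^sub>1 * \<dots> * b\<^sub>k\<close>, counted with multiplicity.  For
  \<open>b = [a\<^sub>1, \<dots>, a\<^sub>n]\<close>, a map \<open>p\<close> from \<open>n\<close> to \<open>k\<close> is given by its list of values, and it yields
  the list of bags whose entry \<open>i\<close> collects the \<open>a\<^sub>j\<close> with \<open>p j = i\<close>.
\<close>

definition splits :: "nat \<Rightarrow> 'a multiset \<Rightarrow> 'a multiset list multiset" where
  "splits k b =
     mset (map (\<lambda>p. map (\<lambda>i. mset [a. (a, j) \<leftarrow> zip (enum b) p, j = i]) [0..<k])
               (List.n_lists (size b) [0..<k]))"

section \<open>Resource terms\<close>

text \<open>
  Terms up to \<open>\<alpha>\<close>-conversion are represented with de Bruijn indices.  As every variable has a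
  fixed type, a bound variable is recorded by its type.  Bags are finite multisets of terms.
  Finite formal sums of terms (bags) are finite multisets of terms (bags): sum is multiset union
  and \<open>0\<close> is the empty multiset.
\<close>

datatype ty = Base | Arr ty ty

definition arrs :: "ty list \<Rightarrow> ty \<Rightarrow> ty" where
  "arrs As B = foldr Arr As B"

datatype tm = Var nat | Lam ty tm | App tm "tm multiset"

type_synonym bag = "tm multiset"
type_synonym tm_sum = "tm multiset"
type_synonym bag_sum = "bag multiset"

lemma size_mem_bag: "s \<in># b \<Longrightarrow> size s < size_multiset size b"
  by (induction b) auto

definition apps :: "tm \<Rightarrow> bag list \<Rightarrow> tm" where
  "apps s bs = foldl App s bs"

text \<open>Multilinear extensions of application and of bag formation to sums.\<close>

definition App_sum :: "tm_sum \<Rightarrow> bag_sum \<Rightarrow> tm_sum" where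
  "App_sum S B = (\<Sum>s\<in>#S. {#App s b. b \<in># B#})"

definition cons_sum :: "tm_sum \<Rightarrow> bag_sum \<Rightarrow> bag_sum" where
  "cons_sum S B = (\<Sum>s\<in>#S. {#add_mset s b. b \<in># B#})"

definition bag_of_sums :: "tm_sum list \<Rightarrow> bag_sum" where
  "bag_of_sums Ss = foldr cons_sum Ss {#{#}#}"

text \<open>
  \<open>lift k s\<close> renames \<open>s\<close> so as to make room for a fresh variable with index \<open>k\<close>.
\<close>

function lift :: "nat \<Rightarrow> tm \<Rightarrow> tm" where
  "lift k (Var i) = Var (if i < k then i else Suc i)"
| "lift k (Lam A s) = Lam A (lift (Suc k) s)"
| "lift k (App s b) = App (lift k s) {#lift k t. t \<in># b#}"
  by pat_completeness auto
termination
  by (relation "measure (\<lambda>(k, s). size s)") (auto dest: size_mem_bag)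

text \<open>
  Resource substitution of the bag \<open>b\<close> for the variable with index \<open>k\<close>; this variable disappears
  from the context, so that larger indices are decremented.  In the first case for \<open>Var\<close>, a bag
  \<open>b = [t]\<close> is returned as the one-term sum \<open>t\<close>, which is the same multiset.
\<close>

function subst :: "tm \<Rightarrow> nat \<Rightarrow> bag \<Rightarrow> tm_sum"
  and subst_bag :: "bag \<Rightarrow> nat \<Rightarrow> bag \<Rightarrow> bag_sum" where
  "subst (Var i) k b =
     (if i = k then (if size b = 1 then b else {#})
      else if b = {#} then {#Var (if i < k then i else i - 1)#} else {#})"
| "subst (Lam A s) k b = {#Lam A s'. s' \<in># subst s (Suc k) {#lift 0 t. t \<in># b#}#}"
| "subst (App s c) k b =
     (\<Sum>bs\<in>#splits 2 b. App_sum (subst s k (bs ! 0)) (subst_bag c k (bs ! 1)))"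
| "subst_bag c k b =
     (\<Sum>bs\<in>#splits (size c) b. bag_of_sums (map (\<lambda>(s, d). subst s k d) (zip (enum c) bs)))"
  by pat_completeness auto
termination
  by (relation "measure (\<lambda>x. case x of Inl (s, k, b) \<Rightarrow> size s
                                   | Inr (c, k, b) \<Rightarrow> size_multiset size c)")
     (auto dest!: set_zip_leftD dest: size_mem_bag)

inductive red :: "tm \<Rightarrow> tm_sum \<Rightarrow> bool" and red_bag :: "bag \<Rightarrow> bag_sum \<Rightarrow> bool" where
  red_beta: "red (App (Lam A s) b) (subst s 0 b)"
| red_lam: "red s S' \<Longrightarrow> red (Lam A s) {#Lam A s'. s' \<in># S'#}"
| red_app_left: "red s S' \<Longrightarrow> red (App s b) (App_sum S' {#b#})"
| red_app_right: "red_bag b B' \<Longrightarrow> red (App s b) (App_sum {#s#} B')"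
| red_bag_elem: "red s S' \<Longrightarrow> red_bag ({#s#} + b) (cons_sum S' {#b#})"

inductive red_sum :: "tm_sum \<Rightarrow> tm_sum \<Rightarrow> bool" where
  "red t T' \<Longrightarrow> red_sum ({#t#} + T) (T' + T)"

text \<open>
  A context is the list of the types of its variables, index \<open>0\<close> being the most recent one, so
  that the extension of \<open>\<Gamma>\<close> by \<open>x : A\<close> is \<open>A # \<Gamma>\<close>.
\<close>

inductive Tm :: "ty list \<Rightarrow> tm \<Rightarrow> ty \<Rightarrow> bool"
  and Bg :: "ty list \<Rightarrow> bag \<Rightarrow> ty \<Rightarrow> bool"
  and Sq :: "ty list \<Rightarrow> bag list \<Rightarrow> ty list \<Rightarrow> bool" where
  Tm_abs: "Tm (A # \<Gamma>) s B \<Longrightarrow> Tm \<Gamma> (Lam A s) (Arr A B)"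
| Tm_app: "\<lbrakk>Tm \<Gamma> s (Arr A B); Bg \<Gamma> b A\<rbrakk> \<Longrightarrow> Tm \<Gamma> (App s b) B"
| Tm_var: "\<lbrakk>x < length \<Gamma>; \<Gamma> ! x = arrs As Base; Sq \<Gamma> bs As\<rbrakk> \<Longrightarrow> Tm \<Gamma> (apps (Var x) bs) Base"
| Bg_bag: "(\<And>s. s \<in># b \<Longrightarrow> Tm \<Gamma> s A) \<Longrightarrow> Bg \<Gamma> b A"
| Sq_seq: "list_all2 (\<lambda>b A. Bg \<Gamma> b A) bs As \<Longrightarrow> Sq \<Gamma> bs As"

text \<open>
  The type of a typable term is determined by the term and the context, and can be computed.
  (A partial application \<open>x b\<^sub>1 \<dots> b\<^sub>k\<close>, which is not typable, also gets a value.)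
\<close>

fun src :: "ty \<Rightarrow> ty" where
  "src (Arr A B) = A"
| "src Base = Base"

fun tgt :: "ty \<Rightarrow> ty" where
  "tgt (Arr A B) = B"
| "tgt Base = Base"

primrec type_of :: "ty list \<Rightarrow> tm \<Rightarrow> ty" where
  "type_of \<Gamma> (Var x) = \<Gamma> ! x"
| "type_of \<Gamma> (Lam A s) = Arr A (type_of (A # \<Gamma>) s)"
| "type_of \<Gamma> (App s b) = tgt (type_of \<Gamma> s)"

text \<open>\<open>args A\<close> is the sequence \<open>B\<^sub>1, \<dots>, B\<^sub>n\<close> such that \<open>A\<close> is \<open>B\<^sub>1 \<rightarrow> \<dots> \<rightarrow> B\<^sub>n \<rightarrow> o\<close>.\<close>

fun args :: "ty \<Rightarrow> ty list" where
  "args Base = []"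
| "args (Arr A B) = A # args B"

lemma arrs_args [simp]: "arrs (args A) Base = A"
  by (induction A) (auto simp: arrs_def)

lemma args_arrs [simp]: "args (arrs As Base) = As"
  by (induction As) (auto simp: arrs_def)

lemma type_of_apps:
  "type_of \<Gamma> s = arrs As B \<Longrightarrow> length bs = length As \<Longrightarrow> type_of \<Gamma> (apps s bs) = B"
proof (induction bs arbitrary: s As)
  case Nil
  then show ?case by (simp add: apps_def arrs_def)
next
  case (Cons b bs)
  then obtain A As' where As: "As = A # As'" by (cases As) auto
  with Cons.prems have "type_of \<Gamma> (App s b) = arrs As' B" "length bs = length As'"
    by (simp_all add: arrs_def)
  then show ?case using Cons.IH by (simp add: apps_def)
qed

lemma Tm_type_of: "Tm \<Gamma> s A \<Longrightarrow> type_of \<Gamma> s = A"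
  and "Bg \<Gamma> b A \<Longrightarrow> True"
  and "Sq \<Gamma> bs As \<Longrightarrow> length bs = length As"
  by (induction rule: Tm_Bg_Sq.inducts)
     (auto intro: type_of_apps dest: list_all2_lengthD)

section \<open>Resource categories\<close>

text \<open>
  All elements of \<open>'o\<close> are objects; morphisms are the elements of the hom-sets.  The structural
  isomorphisms \<open>assoc\<close>, \<open>lunit\<close>, \<open>runit\<close> are given together with their inverses.
  The last two fields are only constrained in closed resource categories.
\<close>

record ('o, 'm) resource_structure =
  hom :: "'o \<Rightarrow> 'o \<Rightarrow> 'm set" ("hom\<index>")
  ident :: "'o \<Rightarrow> 'm" ("id\<index>")
  cmp :: "'m \<Rightarrow> 'm \<Rightarrow> 'm" (infixr "\<cdot>\<index>" 55)
  add :: "'o \<Rightarrow> 'o \<Rightarrow> 'm \<Rightarrow> 'm \<Rightarrow> 'm" ("add\<index>")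
  zero :: "'o \<Rightarrow> 'o \<Rightarrow> 'm" ("zero\<index>")
  tensor :: "'o \<Rightarrow> 'o \<Rightarrow> 'o" (infixl "\<otimes>\<index>" 70)
  tensor_mor :: "'m \<Rightarrow> 'm \<Rightarrow> 'm" (infixl "\<boxtimes>\<index>" 70)
  unit :: 'o ("I\<index>")
  assoc :: "'o \<Rightarrow> 'o \<Rightarrow> 'o \<Rightarrow> 'm" ("\<alpha>\<index>")
  assoc_inv :: "'o \<Rightarrow> 'o \<Rightarrow> 'o \<Rightarrow> 'm" ("\<alpha>\<^sup>-\<index>")
  lunit :: "'o \<Rightarrow> 'm" ("\<l>\<index>")
  lunit_inv :: "'o \<Rightarrow> 'm" ("\<l>\<^sup>-\<index>")
  runit :: "'o \<Rightarrow> 'm" ("\<r>\<index>")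
  runit_inv :: "'o \<Rightarrow> 'm" ("\<r>\<^sup>-\<index>")
  symm :: "'o \<Rightarrow> 'o \<Rightarrow> 'm" ("\<gamma>\<index>")
  comult :: "'o \<Rightarrow> 'm" ("\<delta>\<index>")
  counit :: "'o \<Rightarrow> 'm" ("\<epsilon>\<index>")
  mult :: "'o \<Rightarrow> 'm" ("\<mu>\<index>")
  mult_unit :: "'o \<Rightarrow> 'm" ("\<eta>\<index>")
  pid :: "'o \<Rightarrow> 'm" ("pid\<index>")
  exponential :: "'o \<Rightarrow> 'o \<Rightarrow> 'o" (infixr "\<Rrightarrow>\<index>" 60)
  curry_mor :: "'o \<Rightarrow> 'o \<Rightarrow> 'o \<Rightarrow> 'm \<Rightarrow> 'm" ("\<Lambda>\<index>")

locale additive_symmetric_monoidal_category =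
  fixes C :: "('o, 'm) resource_structure" (structure)
  \<comment> \<open>category\<close>
  assumes id_hom [intro, simp]: "id A \<in> hom A A"
    and cmp_hom [intro]: "\<lbrakk>f \<in> hom A B; g \<in> hom B D\<rbrakk> \<Longrightarrow> g \<cdot> f \<in> hom A D"
    and id_left: "f \<in> hom A B \<Longrightarrow> id B \<cdot> f = f"
    and id_right: "f \<in> hom A B \<Longrightarrow> f \<cdot> id A = f"
    and cmp_assoc:
      "\<lbrakk>f \<in> hom A B; g \<in> hom B D; h \<in> hom D E\<rbrakk> \<Longrightarrow> (h \<cdot> g) \<cdot> f = h \<cdot> (g \<cdot> f)"
  \<comment> \<open>hom-sets are commutative monoids\<close>
    and zero_hom [intro, simp]: "zero A B \<in> hom A B"
    and add_hom [intro]: "\<lbrakk>f \<in> hom A B; g \<in> hom A B\<rbrakk> \<Longrightarrow> add A B f g \<in> hom A B"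
    and add_zero: "f \<in> hom A B \<Longrightarrow> add A B (zero A B) f = f"
    and add_commute: "\<lbrakk>f \<in> hom A B; g \<in> hom A B\<rbrakk> \<Longrightarrow> add A B f g = add A B g f"
    and add_assoc: "\<lbrakk>f \<in> hom A B; g \<in> hom A B; h \<in> hom A B\<rbrakk>
      \<Longrightarrow> add A B (add A B f g) h = add A B f (add A B g h)"
    and cmp_add_left: "\<lbrakk>f \<in> hom A B; g \<in> hom B D; g' \<in> hom B D\<rbrakk>
      \<Longrightarrow> add B D g g' \<cdot> f = add A D (g \<cdot> f) (g' \<cdot> f)"
    and cmp_add_right: "\<lbrakk>f \<in> hom A B; f' \<in> hom A B; g \<in> hom B D\<rbrakk>
      \<Longrightarrow> g \<cdot> add A B f f' = add A D (g \<cdot> f) (g \<cdot> f')"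
    and cmp_zero_left: "f \<in> hom A B \<Longrightarrow> zero B D \<cdot> f = zero A D"
    and cmp_zero_right: "g \<in> hom B D \<Longrightarrow> g \<cdot> zero A B = zero A D"
  \<comment> \<open>tensor bifunctor\<close>
    and tensor_hom [intro]:
      "\<lbrakk>f \<in> hom A A'; g \<in> hom B B'\<rbrakk> \<Longrightarrow> f \<boxtimes> g \<in> hom (A \<otimes> B) (A' \<otimes> B')"
    and tensor_id: "id A \<boxtimes> id B = id (A \<otimes> B)"
    and tensor_cmp: "\<lbrakk>f \<in> hom A A'; f' \<in> hom A' A''; g \<in> hom B B'; g' \<in> hom B' B''\<rbrakk>
      \<Longrightarrow> (f' \<cdot> f) \<boxtimes> (g' \<cdot> g) = (f' \<boxtimes> g') \<cdot> (f \<boxtimes> g)"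
    and tensor_add_left: "\<lbrakk>f \<in> hom A A'; f' \<in> hom A A'; g \<in> hom B B'\<rbrakk>
      \<Longrightarrow> add A A' f f' \<boxtimes> g = add (A \<otimes> B) (A' \<otimes> B') (f \<boxtimes> g) (f' \<boxtimes> g)"
    and tensor_add_right: "\<lbrakk>f \<in> hom A A'; g \<in> hom B B'; g' \<in> hom B B'\<rbrakk>
      \<Longrightarrow> f \<boxtimes> add B B' g g' = add (A \<otimes> B) (A' \<otimes> B') (f \<boxtimes> g) (f \<boxtimes> g')"
    and tensor_zero_left: "g \<in> hom B B' \<Longrightarrow> zero A A' \<boxtimes> g = zero (A \<otimes> B) (A' \<otimes> B')"
    and tensor_zero_right: "f \<in> hom A A' \<Longrightarrow> f \<boxtimes> zero B B' = zero (A \<otimes> B) (A' \<otimes> B')"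
  \<comment> \<open>structural isomorphisms\<close>
    and assoc_hom [intro, simp]: "\<alpha> A B D \<in> hom ((A \<otimes> B) \<otimes> D) (A \<otimes> (B \<otimes> D))"
    and assoc_inv_hom [intro, simp]: "\<alpha>\<^sup>- A B D \<in> hom (A \<otimes> (B \<otimes> D)) ((A \<otimes> B) \<otimes> D)"
    and assoc_inverse: "\<alpha>\<^sup>- A B D \<cdot> \<alpha> A B D = id ((A \<otimes> B) \<otimes> D)"
      "\<alpha> A B D \<cdot> \<alpha>\<^sup>- A B D = id (A \<otimes> (B \<otimes> D))"
    and lunit_hom [intro, simp]: "\<l> A \<in> hom (I \<otimes> A) A"
    and lunit_inv_hom [intro, simp]: "\<l>\<^sup>- A \<in> hom A (I \<otimes> A)"
    and lunit_inverse: "\<l>\<^sup>- A \<cdot> \<l> A = id (I \<otimes> A)" "\<l> A \<cdot> \<l>\<^sup>- A = id A"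
    and runit_hom [intro, simp]: "\<r> A \<in> hom (A \<otimes> I) A"
    and runit_inv_hom [intro, simp]: "\<r>\<^sup>- A \<in> hom A (A \<otimes> I)"
    and runit_inverse: "\<r>\<^sup>- A \<cdot> \<r> A = id (A \<otimes> I)" "\<r> A \<cdot> \<r>\<^sup>- A = id A"
    and symm_hom [intro, simp]: "\<gamma> A B \<in> hom (A \<otimes> B) (B \<otimes> A)"
    and symm_inverse: "\<gamma> B A \<cdot> \<gamma> A B = id (A \<otimes> B)"
    and assoc_natural: "\<lbrakk>f \<in> hom A A'; g \<in> hom B B'; h \<in> hom D D'\<rbrakk>
      \<Longrightarrow> \<alpha> A' B' D' \<cdot> ((f \<boxtimes> g) \<boxtimes> h) = (f \<boxtimes> (g \<boxtimes> h)) \<cdot> \<alpha> A B D"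
    and lunit_natural: "f \<in> hom A A' \<Longrightarrow> \<l> A' \<cdot> (id I \<boxtimes> f) = f \<cdot> \<l> A"
    and runit_natural: "f \<in> hom A A' \<Longrightarrow> \<r> A' \<cdot> (f \<boxtimes> id I) = f \<cdot> \<r> A"
    and symm_natural: "\<lbrakk>f \<in> hom A A'; g \<in> hom B B'\<rbrakk>
      \<Longrightarrow> \<gamma> A' B' \<cdot> (f \<boxtimes> g) = (g \<boxtimes> f) \<cdot> \<gamma> A B"
    and pentagon: "\<alpha> A B (D \<otimes> E) \<cdot> \<alpha> (A \<otimes> B) D E
      = (id A \<boxtimes> \<alpha> B D E) \<cdot> \<alpha> A (B \<otimes> D) E \<cdot> (\<alpha> A B D \<boxtimes> id E)"
    and triangle: "(id A \<boxtimes> \<l> B) \<cdot> \<alpha> A I B = \<r> A \<boxtimes> id B"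
    and hexagon: "\<alpha> B D A \<cdot> \<gamma> A (B \<otimes> D) \<cdot> \<alpha> A B D
      = (id B \<boxtimes> \<gamma> A D) \<cdot> \<alpha> B A D \<cdot> (\<gamma> A B \<boxtimes> id D)"

text \<open>
  The middle exchange \<open>A \<otimes> \<gamma>\<^sub>B\<^sub>,\<^sub>D \<otimes> E\<close>, with explicit associators:
  \<open>(A \<otimes> B) \<otimes> (D \<otimes> E) \<rightarrow> (A \<otimes> D) \<otimes> (B \<otimes> E)\<close>.
\<close>

definition mid :: "('o, 'm) resource_structure \<Rightarrow> 'o \<Rightarrow> 'o \<Rightarrow> 'o \<Rightarrow> 'o \<Rightarrow> 'm" ("mid\<index>") where
  "mid\<^bsub>C\<^esub> A B D E =
     \<alpha>\<^sup>-\<^bsub>C\<^esub> A D (B \<otimes>\<^bsub>C\<^esub> E)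
     \<cdot>\<^bsub>C\<^esub> (id\<^bsub>C\<^esub> A \<boxtimes>\<^bsub>C\<^esub> (\<alpha>\<^bsub>C\<^esub> D B E \<cdot>\<^bsub>C\<^esub> (\<gamma>\<^bsub>C\<^esub> B D \<boxtimes>\<^bsub>C\<^esub> id\<^bsub>C\<^esub> E) \<cdot>\<^bsub>C\<^esub> \<alpha>\<^sup>-\<^bsub>C\<^esub> B D E))
     \<cdot>\<^bsub>C\<^esub> \<alpha>\<^bsub>C\<^esub> A B (D \<otimes>\<^bsub>C\<^esub> E)"

locale resource_category = additive_symmetric_monoidal_category C
  for C :: "('o, 'm) resource_structure" (structure) +
  \<comment> \<open>bialgebra structure on every object\<close>
  assumes mult_hom [intro, simp]: "\<mu> A \<in> hom (A \<otimes> A) A"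
    and mult_unit_hom [intro, simp]: "\<eta> A \<in> hom I A"
    and comult_hom [intro, simp]: "\<delta> A \<in> hom A (A \<otimes> A)"
    and counit_hom [intro, simp]: "\<epsilon> A \<in> hom A I"
    and mult_assoc: "\<mu> A \<cdot> (\<mu> A \<boxtimes> id A) = \<mu> A \<cdot> (id A \<boxtimes> \<mu> A) \<cdot> \<alpha> A A A"
    and mult_unit_left: "\<mu> A \<cdot> (\<eta> A \<boxtimes> id A) = \<l> A"
    and mult_unit_right: "\<mu> A \<cdot> (id A \<boxtimes> \<eta> A) = \<r> A"
    and mult_commute: "\<mu> A \<cdot> \<gamma> A A = \<mu> A"
    and comult_assoc: "\<alpha> A A A \<cdot> (\<delta> A \<boxtimes> id A) \<cdot> \<delta> A = (id A \<boxtimes> \<delta> A) \<cdot> \<delta> A"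
    and counit_left: "(\<epsilon> A \<boxtimes> id A) \<cdot> \<delta> A = \<l>\<^sup>- A"
    and counit_right: "(id A \<boxtimes> \<epsilon> A) \<cdot> \<delta> A = \<r>\<^sup>- A"
    and comult_commute: "\<gamma> A A \<cdot> \<delta> A = \<delta> A"
    and comult_mult: "\<delta> A \<cdot> \<mu> A = (\<mu> A \<boxtimes> \<mu> A) \<cdot> mid A A A A \<cdot> (\<delta> A \<boxtimes> \<delta> A)"
    and comult_unit: "\<delta> A \<cdot> \<eta> A = (\<eta> A \<boxtimes> \<eta> A) \<cdot> \<l>\<^sup>- I"
    and counit_mult: "\<epsilon> A \<cdot> \<mu> A = \<l> I \<cdot> (\<epsilon> A \<boxtimes> \<epsilon> A)"
    and counit_unit: "\<epsilon> A \<cdot> \<eta> A = id I"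
  \<comment> \<open>pointed identity on every object\<close>
    and pid_hom [intro, simp]: "pid A \<in> hom A A"
    and pid_idem: "pid A \<cdot> pid A = pid A"
    and comult_pid: "\<delta> A \<cdot> pid A
      = add A (A \<otimes> A) ((pid A \<boxtimes> \<eta> A) \<cdot> \<r>\<^sup>- A) ((\<eta> A \<boxtimes> pid A) \<cdot> \<l>\<^sup>- A)"
    and pid_mult: "pid A \<cdot> \<mu> A
      = add (A \<otimes> A) A (\<r> A \<cdot> (pid A \<boxtimes> \<epsilon> A)) (\<l> A \<cdot> (\<epsilon> A \<boxtimes> pid A))"
    and counit_pid: "\<epsilon> A \<cdot> pid A = zero A I"
    and pid_unit: "pid A \<cdot> \<eta> A = zero I A"
  \<comment> \<open>compatibility with the monoidal structure\<close>
    and comult_tensor: "\<delta> (A \<otimes> B) = mid A A B B \<cdot> (\<delta> A \<boxtimes> \<delta> B)"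
    and counit_tensor: "\<epsilon> (A \<otimes> B) = \<l> I \<cdot> (\<epsilon> A \<boxtimes> \<epsilon> B)"
    and counit_I: "\<epsilon> I = id I"
    and mult_tensor: "\<mu> (A \<otimes> B) = (\<mu> A \<boxtimes> \<mu> B) \<cdot> mid A B A B"
    and mult_unit_tensor: "\<eta> (A \<otimes> B) = (\<eta> A \<boxtimes> \<eta> B) \<cdot> \<l>\<^sup>- I"
    and mult_unit_I: "\<eta> I = id I"

text \<open>
  The right adjoint of \<open>- \<otimes> A\<close> is given by representing objects: bijections natural in \<open>\<Gamma>\<close>.  Its
  action on morphisms is then determined, \<open>A \<Rrightarrow> g\<close> being the currying of \<open>g \<cdot> ev\<close>.
\<close>

locale closed_resource_category = resource_category C
  for C :: "('o, 'm) resource_structure" (structure) +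
  assumes curry_bij: "bij_betw (\<Lambda> G A B) (hom (G \<otimes> A) B) (hom G (A \<Rrightarrow> B))"
    and curry_natural: "\<lbrakk>g \<in> hom G' G; f \<in> hom (G \<otimes> A) B\<rbrakk>
      \<Longrightarrow> \<Lambda> G' A B (f \<cdot> (g \<boxtimes> id A)) = \<Lambda> G A B f \<cdot> g"

definition uncurry_mor ::
  "('o, 'm) resource_structure \<Rightarrow> 'o \<Rightarrow> 'o \<Rightarrow> 'o \<Rightarrow> 'm \<Rightarrow> 'm" ("\<Lambda>\<^sup>-\<index>") where
  "\<Lambda>\<^sup>-\<^bsub>C\<^esub> G A B = inv_into (hom\<^bsub>C\<^esub> (G \<otimes>\<^bsub>C\<^esub> A) B) (\<Lambda>\<^bsub>C\<^esub> G A B)"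

definition ev :: "('o, 'm) resource_structure \<Rightarrow> 'o \<Rightarrow> 'o \<Rightarrow> 'm" ("ev\<index>") where
  "ev\<^bsub>C\<^esub> A B = \<Lambda>\<^sup>-\<^bsub>C\<^esub> (A \<Rrightarrow>\<^bsub>C\<^esub> B) A B (id\<^bsub>C\<^esub> (A \<Rrightarrow>\<^bsub>C\<^esub> B))"

definition one :: "('o, 'm) resource_structure \<Rightarrow> 'o \<Rightarrow> 'o \<Rightarrow> 'm" ("one\<index>") where
  "one\<^bsub>C\<^esub> A B = \<eta>\<^bsub>C\<^esub> B \<cdot>\<^bsub>C\<^esub> \<epsilon>\<^bsub>C\<^esub> A"

definition conv :: "('o, 'm) resource_structure \<Rightarrow> 'o \<Rightarrow> 'o \<Rightarrow> 'm \<Rightarrow> 'm \<Rightarrow> 'm" ("conv\<index>") where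
  "conv\<^bsub>C\<^esub> A B f g = \<mu>\<^bsub>C\<^esub> B \<cdot>\<^bsub>C\<^esub> (f \<boxtimes>\<^bsub>C\<^esub> g) \<cdot>\<^bsub>C\<^esub> \<delta>\<^bsub>C\<^esub> A"

text \<open>\<open>f\<^sub>1 * (\<dots> * (f\<^sub>n * 1))\<close>\<close>

definition bag_prod ::
  "('o, 'm) resource_structure \<Rightarrow> 'o \<Rightarrow> 'o \<Rightarrow> 'm multiset \<Rightarrow> 'm" ("\<Pi>\<index>") where
  "\<Pi>\<^bsub>C\<^esub> A B F = foldr (conv\<^bsub>C\<^esub> A B) (enum F) (one\<^bsub>C\<^esub> A B)"

definition mor_sum ::
  "('o, 'm) resource_structure \<Rightarrow> 'o \<Rightarrow> 'o \<Rightarrow> 'm multiset \<Rightarrow> 'm" where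
  "mor_sum C A B F = foldr (add\<^bsub>C\<^esub> A B) (enum F) (zero\<^bsub>C\<^esub> A B)"

definition pair :: "('o, 'm) resource_structure \<Rightarrow> 'o \<Rightarrow> 'm \<Rightarrow> 'm \<Rightarrow> 'm" ("pair\<index>") where
  "pair\<^bsub>C\<^esub> G f g = (f \<boxtimes>\<^bsub>C\<^esub> g) \<cdot>\<^bsub>C\<^esub> \<delta>\<^bsub>C\<^esub> G"

definition tuple :: "('o, 'm) resource_structure \<Rightarrow> 'o \<Rightarrow> 'm list \<Rightarrow> 'm" where
  "tuple C G fs = foldr (pair\<^bsub>C\<^esub> G) fs (\<epsilon>\<^bsub>C\<^esub> G)"

definition pointed :: "('o, 'm) resource_structure \<Rightarrow> 'o \<Rightarrow> 'm \<Rightarrow> bool" where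
  "pointed C B f \<longleftrightarrow> pid\<^bsub>C\<^esub> B \<cdot>\<^bsub>C\<^esub> f = f"

text \<open>
  Terms are to be interpreted as pointed morphisms, so currying has to respect pointedness.  The
  axioms of closed resource categories say nothing about the pointed identity of \<open>A \<Rrightarrow> B\<close> in
  relation to that of \<open>B\<close>, so soundness is stated under the explicit hypothesis
  that currying commutes with post-composition by the pointed identities or, equivalently,
  that \<open>pid (A \<Rrightarrow> B) = \<Lambda> (pid B \<cdot> ev)\<close>.
\<close>

lemma (in closed_resource_category) pointed_curry:
  assumes "\<And>G A B f. f \<in> hom (G \<otimes> A) B \<Longrightarrow> \<Lambda> G A B (pid B \<cdot> f) = pid (A \<Rrightarrow> B) \<cdot> \<Lambda> G A B f"
    and "f \<in> hom (G \<otimes> A) B"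
  shows "pointed C (A \<Rrightarrow> B) (\<Lambda> G A B f) \<longleftrightarrow> pointed C B f"
proof -
  have "pid B \<cdot> f \<in> hom (G \<otimes> A) B" using assms(2) by blast
  then have "\<Lambda> G A B (pid B \<cdot> f) = \<Lambda> G A B f \<longleftrightarrow> pid B \<cdot> f = f"
    using curry_bij[of G A B] assms(2) by (auto simp: bij_betw_def inj_on_eq_iff)
  with assms show ?thesis by (simp add: pointed_def)
qed

section \<open>Interpretation\<close>

text \<open>
  Throughout, \<open>ob\<close> is the object interpreting the base type.  Iterated tensor products are
  bracketed towards, and end with, the unit: to the right for sequences of types, to the left for
  contexts.  So the interpretation of \<open>A # \<Gamma>\<close> is that of \<open>\<Gamma>\<close> tensored with that of \<open>A\<close>, and the
  canonical isomorphism that merges \<open>\<Gamma>\<close> and \<open>x : A\<close> is an identity.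
\<close>

primrec ty_obj :: "('o, 'm) resource_structure \<Rightarrow> 'o \<Rightarrow> ty \<Rightarrow> 'o" where
  "ty_obj C ob Base = ob"
| "ty_obj C ob (Arr A B) = ty_obj C ob A \<Rrightarrow>\<^bsub>C\<^esub> ty_obj C ob B"

primrec seq_obj :: "('o, 'm) resource_structure \<Rightarrow> 'o \<Rightarrow> ty list \<Rightarrow> 'o" where
  "seq_obj C ob [] = I\<^bsub>C\<^esub>"
| "seq_obj C ob (A # As) = ty_obj C ob A \<otimes>\<^bsub>C\<^esub> seq_obj C ob As"

primrec ctx_obj :: "('o, 'm) resource_structure \<Rightarrow> 'o \<Rightarrow> ty list \<Rightarrow> 'o" where
  "ctx_obj C ob [] = I\<^bsub>C\<^esub>"
| "ctx_obj C ob (A # \<Gamma>) = ctx_obj C ob \<Gamma> \<otimes>\<^bsub>C\<^esub> ty_obj C ob A"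

text \<open>
  \<open>zeta C ob A\<close> is the canonical isomorphism from the interpretation of \<open>A\<close> to
  \<open>seq_obj C ob (args A) \<Rrightarrow> ob\<close>; for an arrow type it is the composite
  \<open>A \<Rrightarrow> B \<cong> A \<Rrightarrow> (D \<Rrightarrow> ob) \<cong> (A \<otimes> D) \<Rrightarrow> ob\<close>.
\<close>

primrec zeta :: "('o, 'm) resource_structure \<Rightarrow> 'o \<Rightarrow> ty \<Rightarrow> 'm" where
  "zeta C ob Base = \<Lambda>\<^bsub>C\<^esub> ob I\<^bsub>C\<^esub> ob (\<r>\<^bsub>C\<^esub> ob)"
| "zeta C ob (Arr A B) =
     (let a = ty_obj C ob A; b = ty_obj C ob B; d = seq_obj C ob (args B)
      in \<Lambda>\<^bsub>C\<^esub> (a \<Rrightarrow>\<^bsub>C\<^esub> b) (a \<otimes>\<^bsub>C\<^esub> d) ob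
           (ev\<^bsub>C\<^esub> d ob \<cdot>\<^bsub>C\<^esub> ((zeta C ob B \<cdot>\<^bsub>C\<^esub> ev\<^bsub>C\<^esub> a b) \<boxtimes>\<^bsub>C\<^esub> id\<^bsub>C\<^esub> d) \<cdot>\<^bsub>C\<^esub> \<alpha>\<^sup>-\<^bsub>C\<^esub> (a \<Rrightarrow>\<^bsub>C\<^esub> b) a d))"

fun proj :: "('o, 'm) resource_structure \<Rightarrow> 'o \<Rightarrow> ty list \<Rightarrow> nat \<Rightarrow> 'm" where
  "proj C ob (A # \<Gamma>) 0 =
     \<l>\<^bsub>C\<^esub> (ty_obj C ob A) \<cdot>\<^bsub>C\<^esub> (\<epsilon>\<^bsub>C\<^esub> (ctx_obj C ob \<Gamma>) \<boxtimes>\<^bsub>C\<^esub> id\<^bsub>C\<^esub> (ty_obj C ob A))"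
| "proj C ob (A # \<Gamma>) (Suc x) =
     proj C ob \<Gamma> x \<cdot>\<^bsub>C\<^esub> \<r>\<^bsub>C\<^esub> (ctx_obj C ob \<Gamma>)
       \<cdot>\<^bsub>C\<^esub> (id\<^bsub>C\<^esub> (ctx_obj C ob \<Gamma>) \<boxtimes>\<^bsub>C\<^esub> \<epsilon>\<^bsub>C\<^esub> (ty_obj C ob A))"
| "proj C ob [] x = undefined"

definition var_mor :: "('o, 'm) resource_structure \<Rightarrow> 'o \<Rightarrow> ty list \<Rightarrow> nat \<Rightarrow> 'm" where
  "var_mor C ob \<Gamma> x = zeta C ob (\<Gamma> ! x) \<cdot>\<^bsub>C\<^esub> proj C ob \<Gamma> x"

definition pack ::
  "('o, 'm) resource_structure \<Rightarrow> 'o \<Rightarrow> ty list \<Rightarrow> ty list \<Rightarrow> 'm multiset list \<Rightarrow> 'm" where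
  "pack C ob \<Gamma> As Fs =
     tuple C (ctx_obj C ob \<Gamma>)
       (map (\<lambda>(A, F). \<Pi>\<^bsub>C\<^esub> (ctx_obj C ob \<Gamma>) (ty_obj C ob A) F) (zip As Fs))"

text \<open>
  The typing rule for \<open>x b\<^sub>1 \<dots> b\<^sub>k\<close> gives no meaning to its proper prefixes, so the
  clause for a term with a variable in head position takes all the arguments at once.
\<close>

fun var_headed :: "tm \<Rightarrow> bool" where
  "var_headed (Var x) = True"
| "var_headed (Lam A s) = False"
| "var_headed (App s b) = var_headed s"

lemma apps_snoc: "apps s (bs @ [b]) = App (apps s bs) b"
  by (simp add: apps_def)

lemma apps_Nil [simp]: "apps s [] = s"
  by (simp add: apps_def)

lemma var_headed_apps [simp]: "var_headed (apps s bs) = var_headed s"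
  by (induction bs rule: rev_induct) (auto simp: apps_snoc)

lemma var_headed_ex: "var_headed s \<Longrightarrow> \<exists>x bs. s = apps (Var x) bs"
  by (induction s) (metis apps_Nil apps_snoc var_headed.simps(2,3))+

lemma apps_Var_inject [simp]: "apps (Var x) bs = apps (Var y) cs \<longleftrightarrow> x = y \<and> bs = cs"
proof (induction bs arbitrary: cs rule: rev_induct)
  case Nil
  then show ?case by (cases cs rule: rev_cases) (auto simp: apps_snoc)
next
  case (snoc b bs)
  then show ?case by (cases cs rule: rev_cases) (auto simp: apps_snoc)
qed

lemma size_apps: "b \<in> set bs \<Longrightarrow> t \<in># b \<Longrightarrow> size t < size (apps s bs)"
proof (induction bs rule: rev_induct)
  case (snoc c bs)
  then show ?case by (auto simp: apps_snoc dest: size_mem_bag)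
qed simp

function sem :: "('o, 'm) resource_structure \<Rightarrow> 'o \<Rightarrow> ty list \<Rightarrow> tm \<Rightarrow> 'm" where
  "sem C ob \<Gamma> (Lam A s) =
     \<Lambda>\<^bsub>C\<^esub> (ctx_obj C ob \<Gamma>) (ty_obj C ob A) (ty_obj C ob (type_of (A # \<Gamma>) s)) (sem C ob (A # \<Gamma>) s)"
| "sem C ob \<Gamma> (apps (Var x) bs) =
     (let As = args (\<Gamma> ! x); d = seq_obj C ob As
      in ev\<^bsub>C\<^esub> d ob \<cdot>\<^bsub>C\<^esub> pair\<^bsub>C\<^esub> (ctx_obj C ob \<Gamma>)
           (pid\<^bsub>C\<^esub> (d \<Rrightarrow>\<^bsub>C\<^esub> ob) \<cdot>\<^bsub>C\<^esub> var_mor C ob \<Gamma> x)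
           (pack C ob \<Gamma> As (map (\<lambda>b. {#sem C ob \<Gamma> t. t \<in># b#}) bs)))"
| "\<not> var_headed s \<Longrightarrow> sem C ob \<Gamma> (App s b) =
     (let a = ty_obj C ob (src (type_of \<Gamma> s)); c = ty_obj C ob (tgt (type_of \<Gamma> s))
      in ev\<^bsub>C\<^esub> a c \<cdot>\<^bsub>C\<^esub> pair\<^bsub>C\<^esub> (ctx_obj C ob \<Gamma>)
           (sem C ob \<Gamma> s)
           (\<Pi>\<^bsub>C\<^esub> (ctx_obj C ob \<Gamma>) a {#sem C ob \<Gamma> t. t \<in># b#}))"
proof goal_cases
  case (1 P x)
  obtain C ob \<Gamma> t where x: "x = (C, ob, \<Gamma>, t)" by (cases x)
  show ?case
  proof (cases "var_headed t")
    case True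
    with var_headed_ex[of t] 1(2) x show ?thesis by blast
  next
    case False
    with 1(1,3) x show ?thesis by (cases t) auto
  qed
qed (auto dest: arg_cong[where f = var_headed])
termination
  by (relation "measure (\<lambda>(C, ob, \<Gamma>, s). size s)") (auto intro: size_apps dest: size_mem_bag)

definition sem_sum :: "('o, 'm) resource_structure \<Rightarrow> 'o \<Rightarrow> ty list \<Rightarrow> ty \<Rightarrow> tm_sum \<Rightarrow> 'm" where
  "sem_sum C ob \<Gamma> A S = mor_sum C (ctx_obj C ob \<Gamma>) (ty_obj C ob A) {#sem C ob \<Gamma> s. s \<in># S#}"

end

theory Submission
  imports Defs
begin

text \<open>
  Soundness of a beta step is the substitution lemma: the denotation of \<open>s\<langle>b/x\<rangle>\<close> is that of \<open>s\<close>
  composed with \<open>\<sigma> b\<close>, the pairing of the identity with the product \<open>\<Pi> b\<close>.  In general \<open>\<sigma> b\<close> is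
  not a morphism of comonoids, but the elements of \<open>b\<close> are pointed, and this gives
  \<open>\<delta> \<cdot> \<sigma> b = (\<Sum>b \<lhd> b\<^sub>1 * b\<^sub>2. (\<sigma> b\<^sub>1 \<otimes> \<sigma> b\<^sub>2) \<cdot> \<delta>)\<close>, \<open>\<epsilon> \<cdot> \<sigma> b = 0\<close> unless \<open>b\<close> is empty, and a description
  of \<open>pid \<cdot> \<pi>\<^sub>y \<cdot> \<sigma> b\<close> for every variable \<open>y\<close>.  These are exactly the clauses of resource substitution
  for applications and bags, for the empty bag, and for variables; and the three properties are
  inherited by \<open>\<sigma> b \<otimes> id\<close>, which is the clause for abstractions.

  The induction needs a meaning for the partial applications \<open>x b\<^sub>1 \<dots> b\<^sub>k\<close>.  Interpreting \<open>x\<close> by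
  \<open>pid \<cdot> \<pi>\<^sub>x\<close> and every application by evaluation agrees with the given interpretation on typable
  terms, because \<open>\<zeta>\<close> commutes with the pointed identities, which are those of an exponential
  by hypothesis.
\<close>

section \<open>Distributing a bag\<close>

text \<open>Pointed arrows behave like primitive elements of a bialgebra, and \<open>Pid\<close>
  like the projection onto the part of degree one. The coproduct of a product of n primitive
  elements expands into 2^n terms, one for each way of sending every factor left or right. This is
  the origin of the sums over splittings, and binary ones suffice, since splittings into k parts are
  iterated binary ones. It also explains \<open>Pid\<close> at a variable: for a bag of two terms
  the bare projection would return their product, where the calculus gives 0. An enumeration is
  chosen in \<open>splits\<close>, \<open>\<Pi>\<close> and \<open>mor_sum\<close>. Each is
  rewritten as a fold over a multiset, and the folded operation must commute without side
  conditions; for the last two this is a second use of \<open>Null\<close>. Typing has to follow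
  reduction through function positions, where a term may be a proper prefix of
  \<open>x b1 ... bk\<close>. Hence the invariant is \<open>wt\<close>, with the condition on heads
  imposed only under abstractions and inside bags.\<close>

lemma sum_mset_sum_mset:
  "(\<Sum>x\<in>#(\<Sum>y\<in>#M. f y). g x) = (\<Sum>y\<in>#M. \<Sum>x\<in>#f y. g x)"
  for g :: "'b \<Rightarrow> 'c :: comm_monoid_add"
  by (induction M) auto

lemma image_mset_sum_mset:
  "image_mset g (\<Sum>y\<in>#M. f y) = (\<Sum>y\<in>#M. image_mset g (f y))"
  by (induction M) auto

definition distribute :: "nat \<Rightarrow> 'a \<Rightarrow> 'a multiset list multiset \<Rightarrow> 'a multiset list multiset" where
  "distribute k a M = (\<Sum>bs\<in>#M. \<Sum>i\<in>#mset_set {0..<k}. {#bs[i := add_mset a (bs ! i)]#})"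

text \<open>Two elements choose their positions independently, so the two sums can be exchanged.
  This is what allows \<open>distribute\<close> to be folded over a multiset.\<close>

lemma distribute_commute: "distribute k a (distribute k a' M) = distribute k a' (distribute k a M)"
proof -
  \<comment> \<open>Entries of \<open>M\<close> may have any length: a position beyond the end
    leaves a list unchanged, and for \<open>i = j\<close> the order of insertion is
    immaterial.\<close>
  have *: "(bs[i := add_mset a (bs ! i)])[j := add_mset a' (bs[i := add_mset a (bs ! i)] ! j)]
      = (bs[j := add_mset a' (bs ! j)])[i := add_mset a (bs[j := add_mset a' (bs ! j)] ! i)]"
    for bs :: "'a multiset list" and i j
    by (cases "i = j"; cases "i < length bs")
      (auto simp: list_update_swap nth_list_update add_mset_commute not_less list_update_beyond)
  have "distribute k a (distribute k a' M) = (\<Sum>bs\<in>#M. \<Sum>i\<in>#mset_set {0..<k}. \<Sum>j\<in>#mset_set {0..<k}.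
      {#(bs[i := add_mset a' (bs ! i)])[j := add_mset a (bs[i := add_mset a' (bs ! i)] ! j)]#})"
    (is "_ = ?sum a a'") for a a'
    by (simp add: distribute_def sum_mset_sum_mset del: sum_mset_singleton_mset)
  moreover have "?sum a a' = ?sum a' a"
    by (subst *) (subst sum_mset.swap, rule refl)
  ultimately show ?thesis by metis
qed

interpretation distribute: comp_fun_commute "distribute k"
  by standard (simp add: fun_eq_iff distribute_commute)

text \<open>The fold does not mention \<open>enum\<close>, so the index family is independent of the
  enumeration and can be computed by induction on the bag. In \<open>List.n_lists\<close> the first
  value is chosen independently of the others, which is one step of
  \<open>distribute\<close>.\<close>

lemma splits_altdef: "splits k b = fold_mset (distribute k) {#replicate k {#}#} b"
proof -
  have "mset (map (\<lambda>p. map (\<lambda>i. mset [a. (a, j) \<leftarrow> zip xs p, j = i]) [0..<k])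
      (List.n_lists (length xs) [0..<k])) = fold_mset (distribute k) {#replicate k {#}#} (mset xs)"
    for xs :: "'a list"
  proof (induction xs)
    case Nil
    then show ?case by (simp add: map_replicate_const)
  next
    case (Cons a xs)
    let ?f = "\<lambda>p. map (\<lambda>i. mset [a. (a, j) \<leftarrow> zip xs p, j = i]) [0..<k]"
    have "mset (map (\<lambda>p. map (\<lambda>i. mset [a. (a, j) \<leftarrow> zip (a # xs) p, j = i]) [0..<k])
        (List.n_lists (length (a # xs)) [0..<k]))
      = mset (concat (map (\<lambda>p. map (\<lambda>i. (?f p)[i := add_mset a (?f p ! i)]) [0..<k])
        (List.n_lists (length xs) [0..<k])))"
      by (auto simp: map_concat comp_def intro!: arg_cong[where f = mset] arg_cong[where f = concat]
          nth_equalityI simp: nth_list_update simp del: mset_map mset_concat mset_upt)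
    also have "\<dots> = distribute k a (mset (map ?f (List.n_lists (length xs) [0..<k])))"
      by (simp add: distribute_def mset_concat comp_def multiset.map_comp flip: sum_mset_sum_list)
    finally show ?case using Cons by simp
  qed
  from this[of "enum b"] show ?thesis
    by (simp add: splits_def flip: size_mset)
qed

lemma splits_empty [simp]: "splits k {#} = {#replicate k {#}#}"
  by (simp add: splits_altdef)

lemma splits_add_mset: "splits k (add_mset a b) = distribute k a (splits k b)"
  by (simp add: splits_altdef)

lemma splits_length: "bs \<in># splits k b \<Longrightarrow> length bs = k"
  by (induction b arbitrary: bs) (auto simp: splits_add_mset distribute_def)

lemma splits_subset: "bs \<in># splits k b \<Longrightarrow> c \<in> set bs \<Longrightarrow> set_mset c \<subseteq> set_mset b"
proof (induction b arbitrary: bs c)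
  case (add a b)
  then obtain ds i where ds: "ds \<in># splits k b" "i < k" "bs = ds[i := add_mset a (ds ! i)]"
    by (auto simp: splits_add_mset distribute_def)
  from add.prems(2) ds(3) have "c \<in> set ds \<or> c = add_mset a (ds ! i)"
    using set_update_subset_insert by fastforce
  moreover have "ds ! i \<in> set ds" using ds splits_length[of ds] by simp
  ultimately show ?case using add.IH[OF ds(1)] by fastforce
qed auto

text \<open>This is the index family both of substitution in an application and of the coproduct of
  a product of pointed arrows.\<close>

definition split2 :: "'a multiset \<Rightarrow> ('a multiset \<times> 'a multiset) multiset" where
  "split2 b = {#(bs ! 0, bs ! 1). bs \<in># splits 2 b#}"

lemma split2_empty [simp]: "split2 {#} = {#({#}, {#})#}"
  by (simp add: split2_def numeral_2_eq_2)

text \<open>A new element goes left or right; the two summands correspond to those of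
  \<open>Comult_pointed\<close>, and this recursion drives \<open>Comult_Bag_prod\<close>.\<close>

lemma split2_add_mset:
  "split2 (add_mset a b) =
    {#(add_mset a x, y). (x, y) \<in># split2 b#} + {#(x, add_mset a y). (x, y) \<in># split2 b#}"
proof -
  have "(\<Sum>bs\<in>#M. {#(add_mset a (bs ! 0), bs ! 1), (bs ! 0, add_mset a (bs ! 1))#})
    = {#(add_mset a (bs ! 0), bs ! 1). bs \<in># M#} + {#(bs ! 0, add_mset a (bs ! 1)). bs \<in># M#}"
    for M :: "'a multiset list multiset"
    by (induction M) auto
  \<comment> \<open>Both updates take effect because the entries of \<open>splits 2 b\<close> have
    length 2.\<close>
  moreover have "image_mset (\<lambda>bs. (bs ! 0, bs ! 1))
      (\<Sum>i\<in>#mset_set {0..<2}. {#bs[i := add_mset a (bs ! i)]#})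
     = {#(add_mset a (bs ! 0), bs ! 1), (bs ! 0, add_mset a (bs ! 1))#}"
    if "bs \<in># splits 2 b" for bs
    using splits_length[OF that] by (simp add: numeral_2_eq_2 atLeast0_lessThan_Suc)
  ultimately show ?thesis
    unfolding split2_def splits_add_mset distribute_def image_mset_sum_mset
    by (simp add: multiset.map_comp comp_def cong: image_mset_cong del: sum_mset_singleton_mset
        image_mset_is_empty_iff One_nat_def)
qed

text \<open>Splitting only concerns occurrences of elements, not their values. It is needed because
  \<open>substitution\<close> splits bags of labels, while \<open>subst\<close> splits the
  corresponding bags of terms.\<close>

lemma split2_image_mset:
  "split2 (image_mset f b) = {#(image_mset f x, image_mset f y). (x, y) \<in># split2 b#}"
  by (induction b) (auto simp: split2_add_mset multiset.map_comp comp_def case_prod_unfold)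

lemma split2_union: "(x, y) \<in># split2 b \<Longrightarrow> x + y = b"
  by (induction b arbitrary: x y) (auto simp: split2_add_mset)

text \<open>An element of the first part goes left; any other goes right and then chooses among the
  remaining \<open>n\<close> parts. This matches a product over a bag with one factor taken
  out.\<close>

lemma splits_Suc:
  "splits (Suc n) b = (\<Sum>(x, y)\<in>#split2 b. {#x # cs. cs \<in># splits n y#})"
proof (induction b)
  case (add a b)
  \<comment> \<open>Position 0 enlarges the head \<open>x\<close>; the positions
    \<open>Suc i\<close> act on the tail.\<close>
  have d: "distribute (Suc n) a {#x # cs. cs \<in># M#}
      = {#add_mset a x # cs. cs \<in># M#} + {#x # cs. cs \<in># distribute n a M#}" for x M
  proof (induction M)
    case (add bs M)
    have "mset_set {0..<Suc n} = add_mset 0 {#Suc i. i \<in># mset_set {0..<n}#}"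
      by (simp add: atLeast0_lessThan_Suc_eq_insert_0 image_mset_mset_set)
    with add show ?case
      by (simp add: distribute_def multiset.map_comp comp_def del: upt_Suc)
  qed (simp add: distribute_def)
  have l: "distribute k a (\<Sum>p\<in>#M. f p) = (\<Sum>p\<in>#M. distribute k a (f p))" for k M and f :: "'b \<Rightarrow> _"
    by (simp add: distribute_def sum_mset_sum_mset)
  show ?case
    by (simp add: splits_add_mset[of "Suc n"] add l d split2_add_mset case_prod_unfold
        sum_mset.distrib
      multiset.map_comp comp_def splits_add_mset)
qed (auto simp: case_prod_unfold)

lemma splits_0: "splits 0 b = (if b = {#} then {#[]#} else {#})"
  by (cases b) (auto simp: splits_add_mset distribute_def)

section \<open>Typing of partial applications\<close>

text \<open>
  Unlike \<open>Tm\<close>, the judgement \<open>wt\<close> types the proper prefixes of \<open>x b\<^sub>1 \<dots> b\<^sub>k\<close>; the terms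
  typable in the sense of \<open>Tm\<close> correspond to \<open>eta_long\<close>.
\<close>

inductive wt :: "ty list \<Rightarrow> tm \<Rightarrow> ty \<Rightarrow> bool" where
  wt_Var: "x < length \<Gamma> \<Longrightarrow> wt \<Gamma> (Var x) (\<Gamma> ! x)"
| wt_Lam: "wt (A # \<Gamma>) s B \<Longrightarrow> var_headed s \<longrightarrow> B = Base \<Longrightarrow> wt \<Gamma> (Lam A s) (Arr A B)"
| wt_App: "wt \<Gamma> s (Arr A B) \<Longrightarrow> \<forall>t\<in>#b. wt \<Gamma> t A \<and> (var_headed t \<longrightarrow> A = Base) \<Longrightarrow> wt \<Gamma> (App s b) B"

inductive_cases wt_VarE: "wt \<Gamma> (Var x) A"
inductive_cases wt_LamE: "wt \<Gamma> (Lam A s) B"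
inductive_cases wt_AppE: "wt \<Gamma> (App s b) B"

abbreviation eta_long :: "ty list \<Rightarrow> tm \<Rightarrow> ty \<Rightarrow> bool" where
  "eta_long \<Gamma> s A \<equiv> wt \<Gamma> s A \<and> (var_headed s \<longrightarrow> A = Base)"

lemma wt_type_of: "wt \<Gamma> s A \<Longrightarrow> type_of \<Gamma> s = A"
  by (induction rule: wt.induct) auto

lemma wt_apps:
  "wt \<Gamma> s (arrs As B) \<Longrightarrow> list_all2 (\<lambda>b A. \<forall>t\<in>#b. eta_long \<Gamma> t A) bs As \<Longrightarrow> wt \<Gamma> (apps s bs) B"
proof (induction bs arbitrary: s As)
  case (Cons b bs)
  then obtain A As' where As: "As = A # As'" by (cases As) auto
  with Cons.prems have "wt \<Gamma> (App s b) (arrs As' B)"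
    by (auto simp: arrs_def intro: wt_App)
  with Cons As show ?case by (simp add: apps_def)
qed (simp add: arrs_def)

lemma Tm_eta_long: "Tm \<Gamma> s A \<Longrightarrow> eta_long \<Gamma> s A"
  and "Bg \<Gamma> b A \<Longrightarrow> \<forall>t\<in>#b. eta_long \<Gamma> t A"
  and "Sq \<Gamma> bs As \<Longrightarrow> list_all2 (\<lambda>b A. \<forall>t\<in>#b. eta_long \<Gamma> t A) bs As"
proof (induction rule: Tm_Bg_Sq.inducts)
  case (Tm_var x \<Gamma> As bs)
  then show ?case using wt_apps[of \<Gamma> "Var x" As Base bs] wt_Var[of x \<Gamma>] by simp
next
  case (Sq_seq \<Gamma> bs As)
  then show ?case by (auto elim: list_all2_mono)
qed (auto intro: wt_App wt_Lam)

lemma var_headed_lift [simp]: "var_headed (lift k s) = var_headed s"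
  by (induction s) auto

lemma wt_lift: "wt (\<Delta> @ \<Gamma>) s A \<Longrightarrow> wt (\<Delta> @ B # \<Gamma>) (lift (length \<Delta>) s) A"
proof (induction "\<Delta> @ \<Gamma>" s A arbitrary: \<Delta> rule: wt.induct)
  case (wt_Var x)
  then show ?case
    using wt.wt_Var[of "if x < length \<Delta> then x else Suc x" "\<Delta> @ B # \<Gamma>"]
    by (auto simp: nth_append Suc_diff_le)
next
  case (wt_Lam A s B')
  from wt_Lam(2)[of "A # \<Delta>"] wt_Lam(3) show ?case by (auto intro: wt.wt_Lam)
qed (auto intro!: wt.wt_App)

text \<open>A substituted term can supply the head of the result only if the substituted variable
  was the head of \<open>s\<close>; otherwise the head of \<open>s\<close> keeps its kind. So
  substitution creates no new violation of the condition on heads.\<close>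

lemma var_headed_subst: "s' \<in># subst s k b \<Longrightarrow> var_headed s' \<Longrightarrow> var_headed s"
  by (induction s arbitrary: s' b k) (auto simp: App_sum_def split: if_splits)

lemma in_bag_of_sums:
  "c \<in># bag_of_sums Ss \<Longrightarrow> t \<in># c \<Longrightarrow> \<exists>S\<in>set Ss. t \<in># S"
  by (induction Ss arbitrary: c) (fastforce simp: bag_of_sums_def cons_sum_def)+

lemma in_subst_bag:
  assumes "c' \<in># subst_bag c k b" "t' \<in># c'"
  shows "\<exists>t\<in>#c. \<exists>d. set_mset d \<subseteq> set_mset b \<and> t' \<in># subst t k d"
proof -
  from assms obtain bs where bs: "bs \<in># splits (size c) b"
    "c' \<in># bag_of_sums (map (\<lambda>(s, d). subst s k d) (zip (enum c) bs))"
    by auto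
  from in_bag_of_sums[OF bs(2) assms(2)] obtain t d
      where "(t, d) \<in> set (zip (enum c) bs)" "t' \<in># subst t k d"
    by auto
  then show ?thesis using splits_subset[OF bs(1)]
    by (metis set_enum set_zip_leftD set_zip_rightD)
qed

lemma subst_App: "subst (App s c) k b
    = (\<Sum>(x, y)\<in>#split2 b. App_sum (subst s k x) (subst_bag c k y))"
  by (simp add: split2_def multiset.map_comp comp_def)

text \<open>The claim is \<open>wt\<close> and not \<open>eta_long\<close>, since a prefix of
  \<open>x b1 ... bk\<close> may have an arrow type. Under abstractions and inside bags the
  condition on heads is recovered from \<open>var_headed_subst\<close>.\<close>

lemma wt_subst:
  "wt (\<Delta> @ A # \<Gamma>) s B \<Longrightarrow> \<forall>t\<in>#b. eta_long (\<Delta> @ \<Gamma>) t A \<Longrightarrow> s' \<in># subst s (length \<Delta>) b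
    \<Longrightarrow> wt (\<Delta> @ \<Gamma>) s' B"
proof (induction "\<Delta> @ A # \<Gamma>" s B arbitrary: \<Delta> b s' rule: wt.induct)
  case (wt_Var x)
  have "wt (\<Delta> @ \<Gamma>) (Var (if x < length \<Delta> then x else x - 1)) ((\<Delta> @ A # \<Gamma>) ! x)" if "x \<noteq> length \<Delta>"
  proof (cases "x < length \<Delta>")
    case True
    with wt.wt_Var[of x "\<Delta> @ \<Gamma>"] show ?thesis by (simp add: nth_append)
  next
    case False
    \<comment> \<open>An index beyond the removed variable drops by one; in this form the lookups in
      the two contexts agree.\<close>
    with that obtain y where "x = length \<Delta> + Suc y"
        by (metis add_Suc_right less_imp_Suc_add nat_neq_iff)
    with wt_Var(1) wt.wt_Var[of "length \<Delta> + y" "\<Delta> @ \<Gamma>"] show ?thesis by (simp add: nth_append)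
  qed
  with wt_Var show ?case
    by (auto split: if_splits)
next
  case (wt_Lam C s B)
  then obtain s1 where s1: "s' = Lam C s1" "s1 \<in># subst s (Suc (length \<Delta>)) (image_mset (lift 0) b)"
    by auto
  with wt_Lam.prems wt_Lam(2)[of "C # \<Delta>" "image_mset (lift 0) b" s1] wt_lift[of "[]" "\<Delta> @ \<Gamma>" _ A C]
  have "wt ((C # \<Delta>) @ \<Gamma>) s1 B" by auto
  with s1 wt_Lam(3) var_headed_subst[of s1] show ?case by (auto intro!: wt.wt_Lam)
next
  case (wt_App s C B c)
  from wt_App.prems(2) obtain x y s1 c1 where xy: "(x, y) \<in># split2 b" and s': "s' = App s1 c1"
    and s1: "s1 \<in># subst s (length \<Delta>) x" and c1: "c1 \<in># subst_bag c (length \<Delta>) y"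
    unfolding subst_App by (auto simp: App_sum_def simp del: subst_bag.simps)
  from split2_union[OF xy] wt_App.prems(1) have
    x: "\<forall>t\<in>#x. eta_long (\<Delta> @ \<Gamma>) t A" and y: "\<forall>t\<in>#y. eta_long (\<Delta> @ \<Gamma>) t A" by auto
  have "eta_long (\<Delta> @ \<Gamma>) t C" if t: "t \<in># c1" for t
  proof -
    from in_subst_bag[OF c1 t] obtain u d
        where u: "u \<in># c" "set_mset d \<subseteq> set_mset y" "t \<in># subst u (length \<Delta>) d"
      by auto
    with wt_App(3) y show ?thesis by (blast dest: var_headed_subst)
  qed
  with wt_App.hyps(2)[OF x s1] show ?case unfolding s' by (auto intro!: wt.wt_App)
qed

text \<open>The alternative \<open>var_headed s\<close> is for function positions, where a prefix of
  arrow type may reduce to another such prefix. If \<open>s\<close> is eta-long, either alternative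
  yields \<open>A = Base\<close>. For a beta step this equation comes from the body of the
  abstraction being eta-long.\<close>

lemma red_eta_long:
  "red s S' \<Longrightarrow> s' \<in># S' \<Longrightarrow> wt \<Gamma> s A \<Longrightarrow> wt \<Gamma> s' A \<and> (var_headed s' \<longrightarrow> var_headed s \<or> A = Base)"
  "red_bag b B' \<Longrightarrow> b' \<in># B' \<Longrightarrow> \<forall>t\<in>#b. eta_long \<Gamma> t A \<Longrightarrow> \<forall>t\<in>#b'. eta_long \<Gamma> t A"
proof (induction arbitrary: s' \<Gamma> A and b' \<Gamma> A rule: red_red_bag.inducts)
  case (red_beta C s b)
  then have "wt ([] @ C # \<Gamma>) s A" "\<forall>t\<in>#b. eta_long ([] @ \<Gamma>) t C" "var_headed s \<longrightarrow> A = Base"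
    by (auto elim!: wt_AppE wt_LamE)
  with red_beta wt_subst[of "[]" C \<Gamma> s A b s'] var_headed_subst[of s'] show ?case by auto
next
  case (red_lam s S' C)
  then show ?case by (auto elim!: wt_LamE intro!: wt_Lam)
next
  case (red_app_left s S' b)
  then show ?case by (fastforce simp: App_sum_def elim!: wt_AppE intro!: wt_App)
next
  case (red_app_right b B' s)
  from red_app_right.prems obtain C b'
      where *: "wt \<Gamma> s (Arr C A)" "\<forall>t\<in>#b. eta_long \<Gamma> t C" "s' = App s b'" "b' \<in># B'"
      by (auto simp: App_sum_def elim!: wt_AppE)
  with red_app_right.IH[OF this(4,2)] show ?case by (auto intro!: wt_App)
next
  case (red_bag_elem s S' b)
  then show ?case by (fastforce simp: cons_sum_def)
qed

section \<open>Arrows\<close>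

text \<open>
  A morphism does not determine its domain and codomain, so these are recorded.  Ill-typed
  composites and sums are \<open>Null\<close>, which makes associativity and distributivity of composition
  unconditional.  The interchange law stays conditional, since the tensor of objects need not be
  injective.
\<close>

datatype ('o, 'm) arrow = Null | Arrow (source: 'o) (mor: 'm) (target: 'o)

context additive_symmetric_monoidal_category
begin

definition arr :: "('o, 'm) arrow \<Rightarrow> bool" where
  "arr f \<longleftrightarrow> f \<noteq> Null \<and> mor f \<in> hom (source f) (target f)"

definition Hom :: "'o \<Rightarrow> 'o \<Rightarrow> ('o, 'm) arrow set" where
  "Hom A B = {f. arr f \<and> source f = A \<and> target f = B}"

definition comp :: "('o, 'm) arrow \<Rightarrow> ('o, 'm) arrow \<Rightarrow> ('o, 'm) arrow" (infixr "\<bullet>" 55) where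
  "g \<bullet> f = (if arr f \<and> arr g \<and> target f = source g
     then Arrow (source f) (mor g \<cdot> mor f) (target g) else Null)"

definition ten :: "('o, 'm) arrow \<Rightarrow> ('o, 'm) arrow \<Rightarrow> ('o, 'm) arrow" (infixl "\<odot>" 70) where
  "f \<odot> g = (if arr f \<and> arr g
     then Arrow (source f \<otimes> source g) (mor f \<boxtimes> mor g) (target f \<otimes> target g) else Null)"

definition plus :: "('o, 'm) arrow \<Rightarrow> ('o, 'm) arrow \<Rightarrow> ('o, 'm) arrow" (infixl "\<oplus>" 53) where
  "f \<oplus> g = (if arr f \<and> arr g \<and> source f = source g \<and> target f = target g
     then Arrow (source f) (add (source f) (target f) (mor f) (mor g)) (target f) else Null)"

definition "Zero A B = Arrow A (zero A B) B"
definition "Ident A = Arrow A (id A) A"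
definition "Assoc A B D = Arrow ((A \<otimes> B) \<otimes> D) (\<alpha> A B D) (A \<otimes> (B \<otimes> D))"
definition "Assoc' A B D = Arrow (A \<otimes> (B \<otimes> D)) (\<alpha>\<^sup>- A B D) ((A \<otimes> B) \<otimes> D)"
definition "Lunit A = Arrow (I \<otimes> A) (\<l> A) A"
definition "Lunit' A = Arrow A (\<l>\<^sup>- A) (I \<otimes> A)"
definition "Runit A = Arrow (A \<otimes> I) (\<r> A) A"
definition "Runit' A = Arrow A (\<r>\<^sup>- A) (A \<otimes> I)"
definition "Symm A B = Arrow (A \<otimes> B) (\<gamma> A B) (B \<otimes> A)"

lemma arr_Null [simp]: "\<not> arr Null"
  by (simp add: arr_def)

lemma arr_Arrow [simp]: "arr (Arrow A f B) \<longleftrightarrow> f \<in> hom A B"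
  by (simp add: arr_def)

lemma arrow_eqI:
  "\<lbrakk>arr f; arr g; source f = source g; target f = target g; mor f = mor g\<rbrakk> \<Longrightarrow> f = g"
  by (cases f; cases g) auto

lemma arr_comp [simp]: "arr (g \<bullet> f) \<longleftrightarrow> arr f \<and> arr g \<and> target f = source g"
  by (auto simp: comp_def arr_def)

lemma arr_ten [simp]: "arr (f \<odot> g) \<longleftrightarrow> arr f \<and> arr g"
  by (auto simp: ten_def arr_def)

lemma arr_plus [simp]:
  "arr (f \<oplus> g) \<longleftrightarrow> arr f \<and> arr g \<and> source f = source g \<and> target f = target g"
  by (auto simp: plus_def arr_def)

lemma comp_simps [simp]:
  assumes "arr f" "arr g" "target f = source g"
  shows "source (g \<bullet> f) = source f" "target (g \<bullet> f) = target g" "mor (g \<bullet> f) = mor g \<cdot> mor f"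
  using assms by (simp_all add: comp_def)

lemma ten_simps [simp]:
  assumes "arr f" "arr g"
  shows "source (f \<odot> g) = source f \<otimes> source g" "target (f \<odot> g) = target f \<otimes> target g"
    "mor (f \<odot> g) = mor f \<boxtimes> mor g"
  using assms by (simp_all add: ten_def)

lemma plus_simps [simp]:
  assumes "arr f" "arr g" "source f = source g" "target f = target g"
  shows "source (f \<oplus> g) = source g" "target (f \<oplus> g) = target g"
    "mor (f \<oplus> g) = add (source g) (target g) (mor f) (mor g)"
  using assms by (simp_all add: plus_def)

lemma const_simps [simp]:
  "arr (Zero A B)" "source (Zero A B) = A" "target (Zero A B) = B" "mor (Zero A B) = zero A B"
  "arr (Ident A)" "source (Ident A) = A" "target (Ident A) = A" "mor (Ident A) = id A"
  "arr (Assoc A B D)" "source (Assoc A B D) = (A \<otimes> B) \<otimes> D" "target (Assoc A B D) = A \<otimes> (B \<otimes> D)"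
    "mor (Assoc A B D) = \<alpha> A B D"
  "arr (Assoc' A B D)" "source (Assoc' A B D) = A \<otimes> (B \<otimes> D)" "target (Assoc' A B D) = (A \<otimes> B) \<otimes> D"
    "mor (Assoc' A B D) = \<alpha>\<^sup>- A B D"
  "arr (Lunit A)" "source (Lunit A) = I \<otimes> A" "target (Lunit A) = A" "mor (Lunit A) = \<l> A"
  "arr (Lunit' A)" "source (Lunit' A) = A" "target (Lunit' A) = I \<otimes> A" "mor (Lunit' A) = \<l>\<^sup>- A"
  "arr (Runit A)" "source (Runit A) = A \<otimes> I" "target (Runit A) = A" "mor (Runit A) = \<r> A"
  "arr (Runit' A)" "source (Runit' A) = A" "target (Runit' A) = A \<otimes> I" "mor (Runit' A) = \<r>\<^sup>- A"
  "arr (Symm A B)" "source (Symm A B) = A \<otimes> B" "target (Symm A B) = B \<otimes> A" "mor (Symm A B) = \<gamma> A B"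
  by (simp_all add: Zero_def Ident_def Assoc_def Assoc'_def Lunit_def Lunit'_def Runit_def
      Runit'_def Symm_def)

lemma arr_mor: "arr f \<Longrightarrow> mor f \<in> hom (source f) (target f)"
  by (simp add: arr_def)

lemma Hom_iff: "f \<in> Hom A B \<longleftrightarrow> arr f \<and> source f = A \<and> target f = B"
  by (simp add: Hom_def)

lemma comp_eq_Null: "\<not> (arr f \<and> arr g \<and> target f = source g) \<Longrightarrow> g \<bullet> f = Null"
  by (auto simp: comp_def)

lemma comp_assoc [simp]: "(h \<bullet> g) \<bullet> f = h \<bullet> (g \<bullet> f)"
proof (cases "arr f \<and> arr g \<and> arr h \<and> target f = source g \<and> target g = source h")
  case True
  then have "mor f \<in> hom (source f) (source g)" "mor g \<in> hom (source g) (source h)"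
    "mor h \<in> hom (source h) (target h)" using arr_mor by metis+
  then have "(mor h \<cdot> mor g) \<cdot> mor f = mor h \<cdot> (mor g \<cdot> mor f)" by (rule cmp_assoc)
  with True show ?thesis by (intro arrow_eqI) simp_all
next
  case False
  then have "\<not> arr ((h \<bullet> g) \<bullet> f)" "\<not> arr (h \<bullet> (g \<bullet> f))" by auto
  then show ?thesis by (metis arr_comp comp_eq_Null)
qed

lemma comp_Ident [simp]:
  "arr f \<Longrightarrow> target f = A \<Longrightarrow> Ident A \<bullet> f = f"
  "arr f \<Longrightarrow> source f = A \<Longrightarrow> f \<bullet> Ident A = f"
  by (intro arrow_eqI; use id_left id_right arr_mor in force)+

lemma Ident_ten [simp]: "Ident A \<odot> Ident B = Ident (A \<otimes> B)"
  by (intro arrow_eqI) (simp_all add: tensor_id)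

lemma ten_eq_Null: "\<not> (arr f \<and> arr g) \<Longrightarrow> f \<odot> g = Null"
  by (auto simp: ten_def)

lemma interchange [simp]:
  assumes "target f = source f'" "target g = source g'"
  shows "(f' \<odot> g') \<bullet> (f \<odot> g) = (f' \<bullet> f) \<odot> (g' \<bullet> g)"
proof (cases "arr f \<and> arr f' \<and> arr g \<and> arr g'")
  case True
  with assms have "mor f \<in> hom (source f) (source f')" "mor f' \<in> hom (source f') (target f')"
    "mor g \<in> hom (source g) (source g')" "mor g' \<in> hom (source g') (target g')" using arr_mor
        by metis+
  with True assms show ?thesis by (intro arrow_eqI) (simp_all add: tensor_cmp)
next
  case False
  then have "\<not> arr ((f' \<odot> g') \<bullet> (f \<odot> g))" "\<not> arr ((f' \<bullet> f) \<odot> (g' \<bullet> g))" by auto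
  then show ?thesis by (metis arr_ten arr_comp comp_eq_Null ten_eq_Null)
qed

text \<open>Composites are normalized by nesting to the right, so an equation about
  \<open>a \<bullet> b\<close> must also be usable in front of further factors.\<close>

lemma comp_reduce: "a \<bullet> b = c \<Longrightarrow> a \<bullet> (b \<bullet> x) = c \<bullet> x"
  by (metis comp_assoc)

lemma interchange_reduce [simp]:
  assumes "target f = source f'" "target g = source g'"
  shows "(f' \<odot> g') \<bullet> (f \<odot> g) \<bullet> h = ((f' \<bullet> f) \<odot> (g' \<bullet> g)) \<bullet> h"
  by (rule comp_reduce) (rule interchange[OF assms])

lemma struct_inverse [simp]:
  "Assoc' A B D \<bullet> Assoc A B D = Ident ((A \<otimes> B) \<otimes> D)"
  "Assoc A B D \<bullet> Assoc' A B D = Ident (A \<otimes> (B \<otimes> D))"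
  "Lunit' A \<bullet> Lunit A = Ident (I \<otimes> A)" "Lunit A \<bullet> Lunit' A = Ident A"
  "Runit' A \<bullet> Runit A = Ident (A \<otimes> I)" "Runit A \<bullet> Runit' A = Ident A"
  "Symm B A \<bullet> Symm A B = Ident (A \<otimes> B)"
  by (intro arrow_eqI; simp add: assoc_inverse lunit_inverse runit_inverse symm_inverse)+

lemmas struct_inverse_reduce [simp] = struct_inverse[THEN comp_reduce]

lemma Assoc_natural:
  assumes "arr f" "arr g" "arr h"
  shows "Assoc (target f) (target g) (target h) \<bullet> ((f \<odot> g) \<odot> h)
    = (f \<odot> (g \<odot> h)) \<bullet> Assoc (source f) (source g) (source h)"
  using assms assoc_natural[OF assms[THEN arr_mor]] by (intro arrow_eqI) simp_all

lemma Lunit_natural: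
  assumes "arr f" shows "Lunit (target f) \<bullet> (Ident I \<odot> f) = f \<bullet> Lunit (source f)"
  using assms lunit_natural[OF arr_mor] by (intro arrow_eqI) simp_all

lemma Runit_natural:
  assumes "arr f" shows "Runit (target f) \<bullet> (f \<odot> Ident I) = f \<bullet> Runit (source f)"
  using assms runit_natural[OF arr_mor] by (intro arrow_eqI) simp_all

lemma Symm_natural:
  assumes "arr f" "arr g"
  shows "Symm (target f) (target g) \<bullet> (f \<odot> g) = (g \<odot> f) \<bullet> Symm (source f) (source g)"
  using assms symm_natural[OF assms[THEN arr_mor]] by (intro arrow_eqI) simp_all

lemma Pentagon: "Assoc A B (D \<otimes> E) \<bullet> Assoc (A \<otimes> B) D E
      = (Ident A \<odot> Assoc B D E) \<bullet> Assoc A (B \<otimes> D) E \<bullet> (Assoc A B D \<odot> Ident E)"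
  by (intro arrow_eqI) (simp_all add: pentagon)

lemma Triangle: "(Ident A \<odot> Lunit B) \<bullet> Assoc A I B = Runit A \<odot> Ident B"
  by (intro arrow_eqI) (simp_all add: triangle)

lemma Hexagon: "Assoc B D A \<bullet> Symm A (B \<otimes> D) \<bullet> Assoc A B D
      = (Ident B \<odot> Symm A D) \<bullet> Assoc B A D \<bullet> (Symm A B \<odot> Ident D)"
  by (intro arrow_eqI) (simp_all add: hexagon)

section \<open>Coherence laws derived from pentagon, triangle and hexagon\<close>

lemma comp_cancel_right:
  assumes "f \<bullet> e = g \<bullet> e" "e \<bullet> e' = Ident A" "arr f" "arr g" "source f = A" "source g = A"
  shows "f = g"
  using assms by (metis comp_assoc comp_Ident(2))

lemma comp_cancel_left:
  assumes "e \<bullet> f = e \<bullet> g" "e' \<bullet> e = Ident A" "arr f" "arr g" "target f = A" "target g = A"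
  shows "f = g"
  using assms by (metis comp_assoc comp_Ident(1))

text \<open>Tensoring with the unit is faithful because \<open>Lunit\<close> is a natural
  isomorphism.\<close>

lemma Ident_ten_cancel:
  assumes "Ident I \<odot> f = Ident I \<odot> g" "arr f" "arr g" "source f = source g" "target f = target g"
  shows "f = g"
  using assms Lunit_natural[of f] Lunit_natural[of g]
  by (metis comp_cancel_right struct_inverse(4) const_simps(18))

lemma ten_Ident_cancel:
  assumes "f \<odot> Ident I = g \<odot> Ident I" "arr f" "arr g" "source f = source g" "target f = target g"
  shows "f = g"
  using assms Runit_natural[of f] Runit_natural[of g]
  by (metis comp_cancel_right struct_inverse(6))

text \<open>Kelly's classical argument: after tensoring with \<open>I\<close> on the left, pentagon
  and triangle identify the two sides up to invertible associators.\<close>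

lemma Lunit_ten: "Lunit (A \<otimes> B) \<bullet> Assoc I A B = Lunit A \<odot> Ident B"
proof (rule Ident_ten_cancel)
  have "(Ident I \<odot> (Lunit (A \<otimes> B) \<bullet> Assoc I A B)) \<bullet> (Assoc I (I \<otimes> A) B \<bullet> (Assoc I I A \<odot> Ident B))
     = (Ident I \<odot> Lunit (A \<otimes> B)) \<bullet> (Ident I \<odot> Assoc I A B) \<bullet> Assoc I (I \<otimes> A) B
         \<bullet> (Assoc I I A \<odot> Ident B)"
    by simp
  also have "\<dots> = ((Ident I \<odot> Lunit (A \<otimes> B)) \<bullet> Assoc I I (A \<otimes> B)) \<bullet> Assoc (I \<otimes> I) A B"
    by (simp only: Pentagon[symmetric] comp_assoc)
  also have "\<dots> = (Runit I \<odot> (Ident A \<odot> Ident B)) \<bullet> Assoc (I \<otimes> I) A B"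
    by (simp only: Triangle Ident_ten)
  also have "\<dots> = Assoc I A B \<bullet> ((Runit I \<odot> Ident A) \<odot> Ident B)"
    using Assoc_natural[of "Runit I" "Ident A" "Ident B"] by simp
  also have "\<dots> = Assoc I A B \<bullet> ((Ident I \<odot> Lunit A) \<odot> Ident B) \<bullet> (Assoc I I A \<odot> Ident B)"
    using Triangle[of I A] by simp
  also have "\<dots> = (Ident I \<odot> (Lunit A \<odot> Ident B)) \<bullet> (Assoc I (I \<otimes> A) B \<bullet> (Assoc I I A \<odot> Ident B))"
    using comp_reduce[OF Assoc_natural[of "Ident I" "Lunit A" "Ident B"]]
        by (simp del: interchange interchange_reduce)
  finally show "Ident I \<odot> (Lunit (A \<otimes> B) \<bullet> Assoc I A B) = Ident I \<odot> (Lunit A \<odot> Ident B)"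
    by (rule comp_cancel_right[where e' = "(Assoc' I I A \<odot> Ident B) \<bullet> Assoc' I (I \<otimes> A) B"]) simp_all
qed simp_all

text \<open>The mirror image of \<open>Lunit_ten\<close>, with the associator cancelled on the left
  instead of on the right.\<close>

lemma Runit_ten: "(Ident A \<odot> Runit B) \<bullet> Assoc A B I = Runit (A \<otimes> B)"
proof (rule ten_Ident_cancel)
  have "Assoc A B I \<bullet> (((Ident A \<odot> Runit B) \<bullet> Assoc A B I) \<odot> Ident I)
    = Assoc A B I \<bullet> ((Ident A \<odot> Runit B) \<odot> Ident I) \<bullet> (Assoc A B I \<odot> Ident I)"
    by simp
  also have "\<dots> = (Ident A \<odot> (Runit B \<odot> Ident I)) \<bullet> Assoc A (B \<otimes> I) I \<bullet> (Assoc A B I \<odot> Ident I)"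
    using comp_reduce[OF Assoc_natural[of "Ident A" "Runit B" "Ident I"]]
        by (simp del: interchange interchange_reduce)
  also have "\<dots> = (Ident A \<odot> (Ident B \<odot> Lunit I)) \<bullet> (Ident A \<odot> Assoc B I I) \<bullet> Assoc A (B \<otimes> I) I
      \<bullet> (Assoc A B I \<odot> Ident I)"
    using Triangle[of B I] by simp
  also have "\<dots> = (Ident A \<odot> (Ident B \<odot> Lunit I)) \<bullet> Assoc A B (I \<otimes> I) \<bullet> Assoc (A \<otimes> B) I I"
    by (simp only: Pentagon)
  also have "\<dots> = Assoc A B I \<bullet> (Ident (A \<otimes> B) \<odot> Lunit I) \<bullet> Assoc (A \<otimes> B) I I"
    using comp_reduce[OF Assoc_natural[of "Ident A" "Ident B" "Lunit I"]] by simp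
  also have "\<dots> = Assoc A B I \<bullet> (Runit (A \<otimes> B) \<odot> Ident I)"
    by (simp only: Triangle)
  finally show "((Ident A \<odot> Runit B) \<bullet> Assoc A B I) \<odot> Ident I = Runit (A \<otimes> B) \<odot> Ident I"
    by (rule comp_cancel_left[where e' = "Assoc' A B I"]) simp_all
qed simp_all

text \<open>Naturality of \<open>Lunit\<close> at \<open>Lunit I\<close> identifies
  \<open>Ident I \<odot> Lunit I\<close> with \<open>Lunit (I \<otimes> I)\<close>; the triangle and
  \<open>Lunit_ten\<close> then compare both unitors tensored with \<open>I\<close>.\<close>

lemma Lunit_I: "Lunit I = Runit I"
proof (rule Ident_ten_cancel)
  have "Lunit I \<bullet> (Ident I \<odot> Lunit I) = Lunit I \<bullet> Lunit (I \<otimes> I)"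
    using Lunit_natural[of "Lunit I"] by simp
  then have "Ident I \<odot> Lunit I = Lunit (I \<otimes> I)"
    by (rule comp_cancel_left[where e' = "Lunit' I"]) simp_all
  then have "Runit I \<odot> Ident I = Lunit I \<odot> Ident I"
    using Triangle[of I I] Lunit_ten[of I I] by simp
  then have "Runit I = Lunit I" by (rule ten_Ident_cancel) simp_all
  then show "Ident I \<odot> Lunit I = Ident I \<odot> Runit I" by simp
qed simp_all

text \<open>The hexagon for \<open>A\<close> and two units turns two swaps with \<open>I\<close>
  into one swap with \<open>I \<otimes> I\<close>, which naturality against \<open>Lunit I\<close>
  reduces to a single \<open>Symm A I\<close>. That one is invertible and cancels.\<close>

lemma Lunit_Symm: "Lunit A \<bullet> Symm A I = Runit A"
proof (rule ten_Ident_cancel)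
  have "Symm A I \<bullet> ((Lunit A \<bullet> Symm A I) \<odot> Ident I)
     = Symm A I \<bullet> (Lunit A \<odot> Ident I) \<bullet> (Symm A I \<odot> Ident I)"
    by simp
  also have "\<dots> = (Symm A I \<bullet> Lunit (A \<otimes> I)) \<bullet> Assoc I A I \<bullet> (Symm A I \<odot> Ident I)"
    using comp_reduce[OF Lunit_ten[of A I]] by simp
  also have "\<dots> = Lunit (I \<otimes> A) \<bullet> (Ident I \<odot> Symm A I) \<bullet> Assoc I A I \<bullet> (Symm A I \<odot> Ident I)"
    using comp_reduce[OF Lunit_natural[of "Symm A I"]] by (simp del: interchange interchange_reduce)
  also have "\<dots> = (Lunit (I \<otimes> A) \<bullet> Assoc I I A) \<bullet> Symm A (I \<otimes> I) \<bullet> Assoc A I I"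
    by (simp only: Hexagon comp_assoc)
  also have "\<dots> = ((Lunit I \<odot> Ident A) \<bullet> Symm A (I \<otimes> I)) \<bullet> Assoc A I I"
    by (simp only: Lunit_ten comp_assoc)
  also have "\<dots> = Symm A I \<bullet> (Ident A \<odot> Lunit I) \<bullet> Assoc A I I"
    using comp_reduce[OF Symm_natural[of "Ident A" "Lunit I", symmetric]] by simp
  also have "\<dots> = Symm A I \<bullet> (Runit A \<odot> Ident I)"
    by (simp only: Triangle)
  finally show "(Lunit A \<bullet> Symm A I) \<odot> Ident I = Runit A \<odot> Ident I"
    by (rule comp_cancel_left[where e' = "Symm I A"]) simp_all
qed simp_all

definition "Mid A B D E = Assoc' A D (B \<otimes> E)
     \<bullet> (Ident A \<odot> (Assoc D B E \<bullet> (Symm B D \<odot> Ident E) \<bullet> Assoc' B D E)) \<bullet> Assoc A B (D \<otimes> E)"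

lemma Mid_simps [simp]:
  "arr (Mid A B D E)" "source (Mid A B D E) = (A \<otimes> B) \<otimes> (D \<otimes> E)"
  "target (Mid A B D E) = (A \<otimes> D) \<otimes> (B \<otimes> E)" "mor (Mid A B D E) = mid A B D E"
  by (simp_all add: Mid_def mid_def)

lemma Assoc'_natural:
  assumes "arr f" "arr g" "arr h"
  shows "Assoc' (target f) (target g) (target h) \<bullet> (f \<odot> (g \<odot> h))
    = ((f \<odot> g) \<odot> h) \<bullet> Assoc' (source f) (source g) (source h)"
proof (rule comp_cancel_left[where e = "Assoc (target f) (target g) (target h)"
    and e' = "Assoc' (target f) (target g) (target h)"])
  show "Assoc (target f) (target g) (target h) \<bullet> Assoc' (target f) (target g) (target h)
      \<bullet> (f \<odot> (g \<odot> h))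
    = Assoc (target f) (target g) (target h) \<bullet> ((f \<odot> g) \<odot> h)
        \<bullet> Assoc' (source f) (source g) (source h)"
    using assms comp_reduce[OF Assoc_natural[OF assms]] by simp
qed (use assms in simp_all)

text \<open>Each factor of \<open>Mid\<close> is natural: \<open>1\<close> and \<open>3\<close>
  treat the outer associators, \<open>2\<close> the swap between them.\<close>

lemma Mid_natural:
  assumes "arr f" "arr g" "arr h" "arr k"
  shows "Mid (target f) (target g) (target h) (target k) \<bullet> ((f \<odot> g) \<odot> (h \<odot> k))
    = ((f \<odot> h) \<odot> (g \<odot> k)) \<bullet> Mid (source f) (source g) (source h) (source k)"
proof -
  have 1: "Assoc (target f) (target g) (target (h \<odot> k)) \<bullet> ((f \<odot> g) \<odot> (h \<odot> k))
    = (f \<odot> (g \<odot> (h \<odot> k))) \<bullet> Assoc (source f) (source g) (source (h \<odot> k))"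
    using assms by (intro Assoc_natural) simp_all
  have 2: "Assoc (target h) (target g) (target k) \<bullet> (Symm (target g) (target h) \<odot> Ident (target k))
     \<bullet> Assoc' (target g) (target h) (target k) \<bullet> (g \<odot> (h \<odot> k))
   = (h \<odot> (g \<odot> k)) \<bullet> Assoc (source h) (source g) (source k)
       \<bullet> (Symm (source g) (source h) \<odot> Ident (source k))
     \<bullet> Assoc' (source g) (source h) (source k)"
  proof -
    have a: "(Symm (target g) (target h) \<odot> Ident (target k)) \<bullet> ((g \<odot> h) \<odot> k)
       = ((h \<odot> g) \<odot> k) \<bullet> (Symm (source g) (source h) \<odot> Ident (source k))"
      using assms by (simp add: Symm_natural)
    show ?thesis
      using assms by (simp add: Assoc'_natural comp_reduce[OF a] comp_reduce[OF Assoc_natural]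
        del: interchange interchange_reduce)
  qed
  have 3: "Assoc' (target f) (target h) (target (g \<odot> k)) \<bullet> (f \<odot> (h \<odot> (g \<odot> k)))
    = ((f \<odot> h) \<odot> (g \<odot> k)) \<bullet> Assoc' (source f) (source h) (source (g \<odot> k))"
    using assms by (intro Assoc'_natural) simp_all
  let ?S = "Assoc (source h) (source g) (source k) \<bullet> (Symm (source g) (source h) \<odot> Ident (source k))
     \<bullet> Assoc' (source g) (source h) (source k)"
  have "Mid (target f) (target g) (target h) (target k) \<bullet> ((f \<odot> g) \<odot> (h \<odot> k))
     = Assoc' (target f) (target h) (target (g \<odot> k)) \<bullet> (f \<odot> ((h \<odot> (g \<odot> k)) \<bullet> ?S))
       \<bullet> Assoc (source f) (source g) (source (h \<odot> k))"
    using assms 1 2 by (simp add: Mid_def)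
  also have "\<dots> = Assoc' (target f) (target h) (target (g \<odot> k)) \<bullet> (f \<odot> (h \<odot> (g \<odot> k)))
       \<bullet> (Ident (source f) \<odot> ?S) \<bullet> Assoc (source f) (source g) (source (h \<odot> k))"
    using assms by simp
  also have "\<dots> = ((f \<odot> h) \<odot> (g \<odot> k)) \<bullet> Mid (source f) (source g) (source h) (source k)"
    unfolding comp_reduce[OF 3] Mid_def using assms by simp
  finally show ?thesis .
qed

end

section \<open>Sums of arrows\<close>

context additive_symmetric_monoidal_category
begin

lemma comp_Hom: "f \<in> Hom A B \<Longrightarrow> g \<in> Hom B D \<Longrightarrow> g \<bullet> f \<in> Hom A D"
  by (simp add: Hom_iff)

lemma plus_commute: "f \<oplus> g = g \<oplus> f"
proof (cases "arr (f \<oplus> g)")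
  case True
  then have *: "arr f" "arr g" "source f = source g" "target f = target g" by auto
  then have "mor f \<in> hom (source g) (target g)" "mor g \<in> hom (source g) (target g)"
    using arr_mor by metis+
  with * show ?thesis by (intro arrow_eqI) (simp_all add: add_commute)
next
  case False
  then have "\<not> arr (g \<oplus> f)" by auto
  with False show ?thesis by (metis arr_plus plus_def)
qed

lemma plus_assoc: "(f \<oplus> g) \<oplus> h = f \<oplus> (g \<oplus> h)"
proof (cases "arr ((f \<oplus> g) \<oplus> h)")
  case True
  then have *: "arr f" "arr g" "arr h" "source f = source g" "target f = target g"
    "source g = source h" "target g = target h" by auto
  then have "mor f \<in> hom (source h) (target h)" "mor g \<in> hom (source h) (target h)"
    "mor h \<in> hom (source h) (target h)"
    using arr_mor by metis+
  with * show ?thesis by (intro arrow_eqI) (simp_all add: add_assoc)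
next
  case False
  then have "\<not> arr (f \<oplus> (g \<oplus> h))" by auto
  with False show ?thesis by (metis arr_plus plus_def)
qed

lemma plus_left_commute: "f \<oplus> (g \<oplus> h) = g \<oplus> (f \<oplus> h)"
  by (metis plus_assoc plus_commute)

lemma Zero_plus [simp]: "arr f \<Longrightarrow> source f = A \<Longrightarrow> target f = B \<Longrightarrow> Zero A B \<oplus> f = f"
  by (intro arrow_eqI) (use add_zero arr_mor in force)+

lemma plus_Zero [simp]: "arr f \<Longrightarrow> source f = A \<Longrightarrow> target f = B \<Longrightarrow> f \<oplus> Zero A B = f"
  by (metis Zero_plus plus_commute)

lemma comp_plus: "g \<bullet> (f \<oplus> f') = g \<bullet> f \<oplus> g \<bullet> f'"
proof (cases "arr (g \<bullet> (f \<oplus> f'))")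
  case True
  then have *: "arr f" "arr f'" "arr g" "source f = source f'" "target f = source g"
    "target f' = source g"
    by auto
  then have "mor f \<in> hom (source f') (source g)" "mor f' \<in> hom (source f') (source g)"
    "mor g \<in> hom (source g) (target g)"
    using arr_mor by metis+
  with * show ?thesis by (intro arrow_eqI) (simp_all add: cmp_add_right)
next
  case False
  then have "\<not> arr (g \<bullet> f \<oplus> g \<bullet> f')" by auto
  with False show ?thesis by (metis arr_plus plus_def arr_comp comp_eq_Null)
qed

lemma plus_comp: "(g \<oplus> g') \<bullet> f = g \<bullet> f \<oplus> g' \<bullet> f"
proof (cases "arr ((g \<oplus> g') \<bullet> f)")
  case True
  then have *: "arr f" "arr g" "arr g'" "source g = source g'" "target g = target g'"
    "target f = source g'"
    by auto
  then have "mor g \<in> hom (source g') (target g')" "mor g' \<in> hom (source g') (target g')"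
    "mor f \<in> hom (source f) (source g')"
    using arr_mor by metis+
  with * show ?thesis by (intro arrow_eqI) (simp_all add: cmp_add_left)
next
  case False
  then have "\<not> arr (g \<bullet> f \<oplus> g' \<bullet> f)" by auto
  with False show ?thesis by (metis arr_plus plus_def arr_comp comp_eq_Null)
qed

lemma comp_Zero [simp]: "arr g \<Longrightarrow> source g = B \<Longrightarrow> g \<bullet> Zero A B = Zero A (target g)"
  using cmp_zero_right[OF arr_mor] by (intro arrow_eqI) auto

lemma Zero_comp [simp]: "arr f \<Longrightarrow> target f = A \<Longrightarrow> Zero A B \<bullet> f = Zero (source f) B"
  using cmp_zero_left[OF arr_mor] by (intro arrow_eqI) auto

text \<open>Typing is assumed here, in contrast to \<open>comp_plus\<close>: an ill-typed sum is
  \<open>Null\<close>, while tensors of arrows between different objects may still be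
  parallel.\<close>

lemma plus_ten:
  assumes "arr f" "arr f'" "arr g" "source f = source f'" "target f = target f'"
  shows "(f \<oplus> f') \<odot> g = f \<odot> g \<oplus> f' \<odot> g"
proof -
  have "mor f \<in> hom (source f') (target f')" "mor f' \<in> hom (source f') (target f')"
    "mor g \<in> hom (source g) (target g)"
    using assms arr_mor by metis+
  with assms show ?thesis by (intro arrow_eqI) (simp_all add: tensor_add_left)
qed

lemma ten_plus:
  assumes "arr f" "arr f'" "arr g" "source f = source f'" "target f = target f'"
  shows "g \<odot> (f \<oplus> f') = g \<odot> f \<oplus> g \<odot> f'"
proof -
  have "mor f \<in> hom (source f') (target f')" "mor f' \<in> hom (source f') (target f')"
    "mor g \<in> hom (source g) (target g)"
    using assms arr_mor by metis+
  with assms show ?thesis by (intro arrow_eqI) (simp_all add: tensor_add_right)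
qed

lemma Zero_ten [simp]: "arr g \<Longrightarrow> Zero A B \<odot> g = Zero (A \<otimes> source g) (B \<otimes> target g)"
  using tensor_zero_left[OF arr_mor] by (intro arrow_eqI) auto

lemma ten_Zero [simp]: "arr g \<Longrightarrow> g \<odot> Zero A B = Zero (source g \<otimes> A) (target g \<otimes> B)"
  using tensor_zero_right[OF arr_mor] by (intro arrow_eqI) auto

text \<open>Summands are given by an index family, so that sums over the same indices can be
  compared termwise; \<open>A\<close> and \<open>B\<close> fix the type of the empty sum. The fold
  is well behaved because \<open>\<oplus>\<close> is commutative and associative on all arrows,
  typed or not.\<close>

definition msum :: "'o \<Rightarrow> 'o \<Rightarrow> ('a \<Rightarrow> ('o, 'm) arrow) \<Rightarrow> 'a multiset \<Rightarrow> ('o, 'm) arrow" where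
  "msum A B f M = fold_mset (\<lambda>x. (\<oplus>) (f x)) (Zero A B) M"

lemma msum_empty [simp]: "msum A B f {#} = Zero A B"
  by (simp add: msum_def)

lemma msum_add_mset [simp]: "msum A B f (add_mset x M) = f x \<oplus> msum A B f M"
proof -
  interpret comp_fun_commute "\<lambda>x. (\<oplus>) (f x)"
    by standard (auto simp: fun_eq_iff plus_left_commute)
  show ?thesis by (simp add: msum_def)
qed

lemma msum_Hom: "(\<And>x. x \<in># M \<Longrightarrow> f x \<in> Hom A B) \<Longrightarrow> msum A B f M \<in> Hom A B"
  by (induction M) (auto simp: Hom_iff)

lemma msum_simps [simp]:
  assumes "\<And>x. x \<in># M \<Longrightarrow> f x \<in> Hom A B"
  shows "arr (msum A B f M)" "source (msum A B f M) = A" "target (msum A B f M) = B"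
  using msum_Hom[of M f A B] assms by (auto simp: Hom_iff)

lemma msum_single: "f x \<in> Hom A B \<Longrightarrow> msum A B f {#x#} = f x"
  by (simp add: Hom_iff)

lemma msum_cong: "M = N \<Longrightarrow> (\<And>x. x \<in># N \<Longrightarrow> f x = g x) \<Longrightarrow> msum A B f M = msum A B g N"
  by (induction M arbitrary: N) auto

lemma msum_image_mset: "msum A B f (image_mset g M) = msum A B (\<lambda>x. f (g x)) M"
  by (induction M) auto

lemma msum_union:
  "(\<And>x. x \<in># M + N \<Longrightarrow> f x \<in> Hom A B) \<Longrightarrow> msum A B f (M + N) = msum A B f M \<oplus> msum A B f N"
  by (induction M) (simp_all add: plus_assoc)

lemma msum_sum_mset:
  assumes "\<And>x y. x \<in># M \<Longrightarrow> y \<in># g x \<Longrightarrow> f y \<in> Hom A B"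
  shows "msum A B f (\<Sum>x\<in>#M. g x) = msum A B (\<lambda>x. msum A B f (g x)) M"
  using assms
proof (induction M)
  case (add x M)
  have "msum A B f (g x + (\<Sum>y\<in>#M. g y)) = msum A B f (g x) \<oplus> msum A B f (\<Sum>y\<in>#M. g y)"
    by (rule msum_union) (use add.prems in auto)
  moreover have "msum A B f (\<Sum>y\<in>#M. g y) = msum A B (\<lambda>y. msum A B f (g y)) M"
    using add.prems by (intro add.IH) auto
  ultimately show ?case by simp
qed simp

lemma comp_msum: "g \<in> Hom B D \<Longrightarrow> g \<bullet> msum A B f M = msum A D (\<lambda>x. g \<bullet> f x) M"
  by (induction M) (simp_all add: comp_plus Hom_iff)

lemma msum_comp: "g \<in> Hom A B \<Longrightarrow> msum B D f M \<bullet> g = msum A D (\<lambda>x. f x \<bullet> g) M"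
  by (induction M) (simp_all add: plus_comp Hom_iff)

lemma msum_ten:
  assumes "\<And>x. x \<in># M \<Longrightarrow> f x \<in> Hom A A'" "g \<in> Hom B B'"
  shows "msum A A' f M \<odot> g = msum (A \<otimes> B) (A' \<otimes> B') (\<lambda>x. f x \<odot> g) M"
  using assms by (induction M) (simp_all add: plus_ten Hom_iff)

lemma ten_msum:
  assumes "\<And>x. x \<in># M \<Longrightarrow> f x \<in> Hom A A'" "g \<in> Hom B B'"
  shows "g \<odot> msum A A' f M = msum (B \<otimes> A) (B' \<otimes> A') (\<lambda>x. g \<odot> f x) M"
  using assms by (induction M) (simp_all add: ten_plus Hom_iff)

lemma foldr_add_hom: "set ms \<subseteq> hom A B \<Longrightarrow> foldr (add A B) ms (zero A B) \<in> hom A B"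
  by (induction ms) auto

lemma msum_Arrow:
  assumes "set_mset Ms \<subseteq> hom A B"
  shows "msum A B (\<lambda>m. Arrow A m B) Ms = Arrow A (mor_sum C A B Ms) B"
proof -
  have "msum A B (\<lambda>m. Arrow A m B) (mset ms) = Arrow A (foldr (add A B) ms (zero A B)) B"
    if "set ms \<subseteq> hom A B" for ms
    using that
  proof (induction ms)
    case (Cons m ms)
    then show ?case using foldr_add_hom[of ms A B] by (intro arrow_eqI) auto
  qed (simp add: Zero_def)
  from this[of "enum Ms"] assms show ?thesis by (simp add: mor_sum_def)
qed

end

section \<open>Convolution products of pointed arrows\<close>

context resource_category
begin

definition "Mult A = Arrow (A \<otimes> A) (\<mu> A) A"
definition "Munit A = Arrow I (\<eta> A) A"
definition "Comult A = Arrow A (\<delta> A) (A \<otimes> A)"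
definition "Counit A = Arrow A (\<epsilon> A) I"
definition "Pid A = Arrow A (pid A) A"

lemma bialgebra_simps [simp]:
  "arr (Mult A)" "source (Mult A) = A \<otimes> A" "target (Mult A) = A" "mor (Mult A) = \<mu> A"
  "arr (Munit A)" "source (Munit A) = I" "target (Munit A) = A" "mor (Munit A) = \<eta> A"
  "arr (Comult A)" "source (Comult A) = A" "target (Comult A) = A \<otimes> A" "mor (Comult A) = \<delta> A"
  "arr (Counit A)" "source (Counit A) = A" "target (Counit A) = I" "mor (Counit A) = \<epsilon> A"
  "arr (Pid A)" "source (Pid A) = A" "target (Pid A) = A" "mor (Pid A) = pid A"
  by (simp_all add: Mult_def Munit_def Comult_def Counit_def Pid_def)

lemma Mult_assoc: "Mult A \<bullet> (Mult A \<odot> Ident A) = Mult A \<bullet> (Ident A \<odot> Mult A) \<bullet> Assoc A A A"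
  and Mult_Munit: "Mult A \<bullet> (Munit A \<odot> Ident A) = Lunit A"
  and Mult_Symm: "Mult A \<bullet> Symm A A = Mult A"
  and Comult_assoc: "Assoc A A A \<bullet> (Comult A \<odot> Ident A) \<bullet> Comult A
      = (Ident A \<odot> Comult A) \<bullet> Comult A"
  and Comult_Counit: "(Counit A \<odot> Ident A) \<bullet> Comult A = Lunit' A"
    "(Ident A \<odot> Counit A) \<bullet> Comult A = Runit' A"
  and Comult_Symm: "Symm A A \<bullet> Comult A = Comult A"
  and Comult_Mult: "Comult A \<bullet> Mult A = (Mult A \<odot> Mult A) \<bullet> Mid A A A A \<bullet> (Comult A \<odot> Comult A)"
  and Comult_Munit: "Comult A \<bullet> Munit A = (Munit A \<odot> Munit A) \<bullet> Lunit' I"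
  and Counit_Mult: "Counit A \<bullet> Mult A = Lunit I \<bullet> (Counit A \<odot> Counit A)"
  and Counit_Munit: "Counit A \<bullet> Munit A = Ident I"
  and Pid_idem: "Pid A \<bullet> Pid A = Pid A"
  and Comult_Pid: "Comult A \<bullet> Pid A = (Pid A \<odot> Munit A) \<bullet> Runit' A \<oplus> (Munit A \<odot> Pid A) \<bullet> Lunit' A"
  and Pid_Mult: "Pid A \<bullet> Mult A = Runit A \<bullet> (Pid A \<odot> Counit A) \<oplus> Lunit A \<bullet> (Counit A \<odot> Pid A)"
  and Counit_Pid: "Counit A \<bullet> Pid A = Zero A I"
  and Pid_Munit: "Pid A \<bullet> Munit A = Zero I A"
  and Comult_tensor: "Comult (A \<otimes> B) = Mid A A B B \<bullet> (Comult A \<odot> Comult B)"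
  and Counit_tensor: "Counit (A \<otimes> B) = Lunit I \<bullet> (Counit A \<odot> Counit B)"
  and Mult_tensor: "Mult (A \<otimes> B) = (Mult A \<odot> Mult B) \<bullet> Mid A B A B"
  by (intro arrow_eqI; simp add: mult_assoc mult_unit_left mult_commute comult_assoc counit_left
      counit_right comult_commute comult_mult comult_unit counit_mult counit_unit pid_idem
      comult_pid pid_mult counit_pid pid_unit comult_tensor counit_tensor mult_tensor)+

text \<open>Cocommutativity: the four copies of the input are interchangeable. Reassociated to the
  right, the two middle copies come from a single \<open>Comult A\<close>, where the swap disappears
  by \<open>Comult_Symm\<close>.\<close>

lemma Comult_Comult: "Mid A A A A \<bullet> (Comult A \<odot> Comult A) \<bullet> Comult A
    = (Comult A \<odot> Comult A) \<bullet> Comult A"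
proof -
  have 1: "Assoc A A (A \<otimes> A) \<bullet> (Comult A \<odot> Comult A) \<bullet> Comult A
     = (Ident A \<odot> ((Ident A \<odot> Comult A) \<bullet> Comult A)) \<bullet> Comult A"
  proof -
    have "Assoc A A (A \<otimes> A) \<bullet> (Comult A \<odot> Comult A) \<bullet> Comult A
      = (Assoc A A (A \<otimes> A) \<bullet> (Ident (A \<otimes> A) \<odot> Comult A)) \<bullet> (Comult A \<odot> Ident A) \<bullet> Comult A"
      by simp
    also have "\<dots> = (Ident A \<odot> (Ident A \<odot> Comult A))
        \<bullet> (Assoc A A A \<bullet> (Comult A \<odot> Ident A) \<bullet> Comult A)"
      using Assoc_natural[of "Ident A" "Ident A" "Comult A"]
          by (simp del: interchange interchange_reduce)
    also have "\<dots> = (Ident A \<odot> ((Ident A \<odot> Comult A) \<bullet> Comult A)) \<bullet> Comult A"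
      by (simp add: Comult_assoc)
    finally show ?thesis .
  qed
  have 2: "Assoc' A A A \<bullet> (Ident A \<odot> Comult A) \<bullet> Comult A = (Comult A \<odot> Ident A) \<bullet> Comult A"
    by (simp flip: Comult_assoc)
  have 3: "Assoc A A A \<bullet> (Symm A A \<odot> Ident A) \<bullet> Assoc' A A A \<bullet> (Ident A \<odot> Comult A) \<bullet> Comult A
      = (Ident A \<odot> Comult A) \<bullet> Comult A"
    unfolding 2 by (simp add: Comult_Symm Comult_assoc)
  have 4: "Assoc' A A (A \<otimes> A) \<bullet> (Ident A \<odot> ((Ident A \<odot> Comult A) \<bullet> Comult A)) \<bullet> Comult A
     = (Comult A \<odot> Comult A) \<bullet> Comult A"
    unfolding 1[symmetric] by simp
  show ?thesis
    unfolding Mid_def comp_assoc 1 using 3 4 by simp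
qed

definition "One A B = Munit B \<bullet> Counit A"

text \<open>The value \<open>Null\<close> outside \<open>Hom A B\<close> makes commutativity and
  associativity unconditional, as folding over a multiset requires.\<close>

definition Conv :: "'o \<Rightarrow> 'o \<Rightarrow> ('o, 'm) arrow \<Rightarrow> ('o, 'm) arrow \<Rightarrow> ('o, 'm) arrow" where
  "Conv A B f g = (if f \<in> Hom A B \<and> g \<in> Hom A B then Mult B \<bullet> (f \<odot> g) \<bullet> Comult A else Null)"

definition Pairing :: "'o \<Rightarrow> ('o, 'm) arrow \<Rightarrow> ('o, 'm) arrow \<Rightarrow> ('o, 'm) arrow" where
  "Pairing A f g = (f \<odot> g) \<bullet> Comult A"

lemma Pairing_simps [simp]:
  assumes "arr f" "arr g" "source f = A" "source g = A"
  shows "arr (Pairing A f g)" "source (Pairing A f g) = A"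
    "target (Pairing A f g) = target f \<otimes> target g"
    "mor (Pairing A f g) = pair A (mor f) (mor g)"
  using assms by (simp_all add: Pairing_def pair_def)

lemma One_simps [simp]: "arr (One A B)" "source (One A B) = A" "target (One A B) = B"
  "mor (One A B) = one A B"
  by (simp_all add: One_def one_def)

lemma One_Hom: "One A B \<in> Hom A B"
  by (simp add: Hom_iff)

lemma Conv_eq: "f \<in> Hom A B \<Longrightarrow> g \<in> Hom A B \<Longrightarrow> Conv A B f g = Mult B \<bullet> Pairing A f g"
  by (simp add: Conv_def Pairing_def)

lemma Conv_Hom_iff: "Conv A B f g \<in> Hom A B \<longleftrightarrow> f \<in> Hom A B \<and> g \<in> Hom A B"
  by (auto simp: Conv_def Hom_iff)

lemma Conv_eq_Null: "\<not> (f \<in> Hom A B \<and> g \<in> Hom A B) \<Longrightarrow> Conv A B f g = Null"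
  by (auto simp: Conv_def)

lemma Null_notin_Hom [simp]: "Null \<notin> Hom A B"
  by (simp add: Hom_iff)

lemma Pairing_assoc:
  assumes "arr f" "arr g" "arr h" "source f = A" "source g = A" "source h = A"
  shows "Assoc (target f) (target g) (target h) \<bullet> Pairing A (Pairing A f g) h
      = Pairing A f (Pairing A g h)"
proof -
  have "Pairing A (Pairing A f g) h = ((f \<odot> g) \<odot> h) \<bullet> (Comult A \<odot> Ident A) \<bullet> Comult A"
    using assms by (simp add: Pairing_def)
  then have "Assoc (target f) (target g) (target h) \<bullet> Pairing A (Pairing A f g) h
    = (f \<odot> (g \<odot> h)) \<bullet> Assoc A A A \<bullet> (Comult A \<odot> Ident A) \<bullet> Comult A"
    using comp_reduce[OF Assoc_natural[OF assms(1-3)]] assms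
        by (simp del: interchange interchange_reduce)
  also have "\<dots> = Pairing A f (Pairing A g h)"
    unfolding Comult_assoc using assms by (simp add: Pairing_def)
  finally show ?thesis .
qed

lemma Symm_Pairing:
  assumes "arr f" "arr g" "source f = A" "source g = A"
  shows "Symm (target f) (target g) \<bullet> Pairing A f g = Pairing A g f"
  using assms comp_reduce[OF Symm_natural[OF assms(1,2)]] by (simp add: Pairing_def Comult_Symm)

lemma Conv_commute: "Conv A B f g = Conv A B g f"
proof (cases "f \<in> Hom A B \<and> g \<in> Hom A B")
  case True
  then have "Mult B \<bullet> Pairing A f g = Mult B \<bullet> Symm B B \<bullet> Pairing A f g"
    using comp_reduce[OF Mult_Symm] by simp
  also have "\<dots> = Mult B \<bullet> Pairing A g f"
    using True Symm_Pairing[of f g A] by (simp add: Hom_iff)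
  finally show ?thesis using True by (simp add: Conv_eq)
qed (auto simp: Conv_def)

lemma Conv_assoc: "Conv A B (Conv A B f g) h = Conv A B f (Conv A B g h)"
proof (cases "f \<in> Hom A B \<and> g \<in> Hom A B \<and> h \<in> Hom A B")
  case True
  then have *: "f \<in> Hom A B" "g \<in> Hom A B" "h \<in> Hom A B"
   "arr f" "arr g" "arr h" "source f = A" "source g = A" "source h = A"
    "target f = B" "target g = B" "target h = B" by (auto simp: Hom_iff)
  have "Conv A B (Conv A B f g) h = Mult B \<bullet> Pairing A (Mult B \<bullet> Pairing A f g) h"
    unfolding Conv_eq[OF *(1,2), symmetric]
        by (rule Conv_eq) (use * in \<open>simp_all add: Conv_Hom_iff\<close>)
  also have "\<dots> = (Mult B \<bullet> (Mult B \<odot> Ident B)) \<bullet> Pairing A (Pairing A f g) h"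
    using * by (simp add: Pairing_def)
  also have "\<dots> = Mult B \<bullet> (Ident B \<odot> Mult B) \<bullet> Pairing A f (Pairing A g h)"
    unfolding Mult_assoc comp_assoc using Pairing_assoc[of f g h A] * by simp
  also have "\<dots> = Mult B \<bullet> Pairing A f (Mult B \<bullet> Pairing A g h)"
    using * by (simp add: Pairing_def)
  also have "\<dots> = Conv A B f (Conv A B g h)"
    unfolding Conv_eq[OF *(2,3), symmetric]
        by (rule Conv_eq[symmetric]) (use * in \<open>simp_all add: Conv_Hom_iff\<close>)
  finally show ?thesis .
next
  case False
  then have "\<not> (Conv A B f g \<in> Hom A B \<and> h \<in> Hom A B)"
    "\<not> (f \<in> Hom A B \<and> Conv A B g h \<in> Hom A B)" by (auto simp: Conv_Hom_iff)
  then show ?thesis by (metis Conv_eq_Null)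
qed

lemma Conv_left_commute: "Conv A B f (Conv A B g h) = Conv A B g (Conv A B f h)"
  by (metis Conv_assoc Conv_commute)

lemma One_conv: "f \<in> Hom A B \<Longrightarrow> Conv A B (One A B) f = f"
proof -
  assume f: "f \<in> Hom A B"
  have "Mult B \<bullet> (One A B \<odot> f) \<bullet> Comult A
     = (Mult B \<bullet> (Munit B \<odot> Ident B)) \<bullet> (Ident I \<odot> f) \<bullet> (Counit A \<odot> Ident A) \<bullet> Comult A"
    using f by (simp add: One_def Hom_iff)
  also have "\<dots> = f"
    unfolding Mult_Munit Comult_Counit using f comp_reduce[OF Lunit_natural[of f]]
    by (simp add: Hom_iff)
  finally show ?thesis using f One_Hom by (simp add: Conv_def)
qed

definition Bag_prod :: "'o \<Rightarrow> 'o \<Rightarrow> ('o, 'm) arrow multiset \<Rightarrow> ('o, 'm) arrow" where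
  "Bag_prod A B F = fold_mset (Conv A B) (One A B) F"

lemma Bag_prod_empty [simp]: "Bag_prod A B {#} = One A B"
  by (simp add: Bag_prod_def)

lemma Bag_prod_add_mset [simp]: "Bag_prod A B (add_mset f F) = Conv A B f (Bag_prod A B F)"
proof -
  interpret comp_fun_commute "Conv A B"
    by standard (auto simp: fun_eq_iff Conv_left_commute)
  show ?thesis by (simp add: Bag_prod_def)
qed

lemma Bag_prod_Hom: "(\<And>f. f \<in># F \<Longrightarrow> f \<in> Hom A B) \<Longrightarrow> Bag_prod A B F \<in> Hom A B"
  by (induction F) (auto simp: One_Hom Conv_Hom_iff)

lemma Conv_Arrow:
  assumes "m \<in> hom A B" "n \<in> hom A B"
  shows "Conv A B (Arrow A m B) (Arrow A n B) = Arrow A (conv A B m n) B" "conv A B m n \<in> hom A B"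
proof -
  let ?f = "Mult B \<bullet> (Arrow A m B \<odot> Arrow A n B) \<bullet> Comult A"
  have f: "arr ?f" "source ?f = A" "target ?f = B" "mor ?f = conv A B m n"
    using assms by (simp_all add: conv_def)
  from arr_mor[OF f(1)] show "conv A B m n \<in> hom A B" unfolding f(2-4) .
  have "?f = Arrow (source ?f) (mor ?f) (target ?f)"
    using f(1) by (metis arr_Null arrow.exhaust_sel)
  then have "?f = Arrow A (conv A B m n) B" unfolding f(2-4) .
  then show "Conv A B (Arrow A m B) (Arrow A n B) = Arrow A (conv A B m n) B"
    using assms by (simp add: Conv_def Hom_iff)
qed

lemma One_Arrow: "One A B = Arrow A (one A B) B" "one A B \<in> hom A B"
  using arr_mor[of "One A B"] by (auto intro: arrow_eqI)

lemma foldr_conv_hom: "set ms \<subseteq> hom A B \<Longrightarrow> foldr (conv A B) ms (one A B) \<in> hom A B"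
  by (induction ms) (auto simp: One_Arrow Conv_Arrow)

text \<open>This connects the fold over the multiset with \<open>\<Pi>\<close>, which multiplies
  along the chosen enumeration.\<close>

lemma Bag_prod_Arrow:
  assumes "set_mset Ms \<subseteq> hom A B"
  shows "Bag_prod A B {#Arrow A m B. m \<in># Ms#} = Arrow A (\<Pi> A B Ms) B"
proof -
  have "Bag_prod A B {#Arrow A m B. m \<in># mset ms#} = Arrow A (foldr (conv A B) ms (one A B)) B"
    if "set ms \<subseteq> hom A B" for ms
    using that by (induction ms) (auto simp: One_Arrow Conv_Arrow foldr_conv_hom)
  from this[of "enum Ms"] assms show ?thesis by (simp add: bag_prod_def)
qed

section \<open>Linearity of convolution; coproduct, counit and pointed part of a product\<close>

lemma Conv_plus:
  assumes "f \<in> Hom A B" "f' \<in> Hom A B" "g \<in> Hom A B"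
  shows "Conv A B (f \<oplus> f') g = Conv A B f g \<oplus> Conv A B f' g"
  using assms by (simp add: Conv_def Hom_iff plus_ten comp_plus plus_comp)

lemma Conv_msum:
  assumes "f \<in> Hom A B" "\<And>x. x \<in># M \<Longrightarrow> g x \<in> Hom A B"
  shows "Conv A B f (msum A B g M) = msum A B (\<lambda>x. Conv A B f (g x)) M"
proof -
  have "Conv A B f (msum A B g M) = Mult B \<bullet> (f \<odot> msum A B g M) \<bullet> Comult A"
    using assms msum_Hom[of M g A B] by (simp add: Conv_def)
  also have "\<dots> = msum A B (\<lambda>x. Mult B \<bullet> (f \<odot> g x) \<bullet> Comult A) M"
    using assms
    by (simp add: ten_msum[of M g A B f A B] msum_comp[of _ A "A \<otimes> A"] comp_msum[of _ "B \<otimes> B" B]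
        Hom_iff)
  also have "\<dots> = msum A B (\<lambda>x. Conv A B f (g x)) M"
    by (rule msum_cong) (use assms in \<open>simp_all add: Conv_def\<close>)
  finally show ?thesis .
qed

text \<open>By \<open>Mult_tensor\<close> the bialgebra law says that \<open>Comult B\<close> is a
  morphism of monoids from \<open>B\<close> to \<open>B \<otimes> B\<close>, and such morphisms
  preserve convolution.\<close>

lemma Comult_conv:
  assumes "f \<in> Hom A B" "g \<in> Hom A B"
  shows "Comult B \<bullet> Conv A B f g = Conv A (B \<otimes> B) (Comult B \<bullet> f) (Comult B \<bullet> g)"
  using assms comp_reduce[OF Comult_Mult[of B]]
  by (simp add: Conv_def Hom_iff Mult_tensor)

text \<open>Multiplication on \<open>B \<otimes> B'\<close> is componentwise after a middle
  exchange. Naturality moves the exchange to four copies of \<open>A\<close>, where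
  \<open>Comult_Comult\<close> absorbs it.\<close>

lemma Conv_Pairing:
  assumes "f \<in> Hom A B" "g \<in> Hom A B" "f' \<in> Hom A B'" "g' \<in> Hom A B'"
  shows "Conv A (B \<otimes> B') (Pairing A f f') (Pairing A g g')
    = Pairing A (Conv A B f g) (Conv A B' f' g')"
proof -
  have *: "Mid B B' B B' \<bullet> ((f \<odot> f') \<odot> (g \<odot> g')) = ((f \<odot> g) \<odot> (f' \<odot> g')) \<bullet> Mid A A A A"
    using assms Mid_natural[of f f' g g'] by (simp add: Hom_iff)
  have "Conv A (B \<otimes> B') (Pairing A f f') (Pairing A g g')
    = (Mult B \<odot> Mult B') \<bullet> (Mid B B' B B' \<bullet> ((f \<odot> f') \<odot> (g \<odot> g'))) \<bullet> (Comult A \<odot> Comult A)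
        \<bullet> Comult A"
    using assms by (simp add: Conv_def Hom_iff Mult_tensor Pairing_def)
  also have "\<dots> = (Mult B \<odot> Mult B') \<bullet> ((f \<odot> g) \<odot> (f' \<odot> g')) \<bullet> (Comult A \<odot> Comult A) \<bullet> Comult A"
    unfolding * by (simp only: comp_assoc Comult_Comult)
  also have "\<dots> = Pairing A (Conv A B f g) (Conv A B' f' g')"
    using assms by (simp add: Conv_def Hom_iff Pairing_def)
  finally show ?thesis .
qed

lemma Comult_One: "Comult B \<bullet> One A B = Pairing A (One A B) (One A B)"
proof -
  have "Pairing A (One A B) (One A B) = (Munit B \<odot> Munit B) \<bullet> (Ident I \<odot> Counit A)
      \<bullet> (Counit A \<odot> Ident A) \<bullet> Comult A"
    by (simp add: Pairing_def One_def)
  also have "\<dots> = (Munit B \<odot> Munit B) \<bullet> Lunit' I \<bullet> Lunit I \<bullet> (Ident I \<odot> Counit A) \<bullet> Lunit' A"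
    unfolding Comult_Counit by simp
  also have "\<dots> = (Munit B \<odot> Munit B) \<bullet> Lunit' I \<bullet> Counit A"
    using comp_reduce[OF Lunit_natural[of "Counit A"]] by simp
  finally show ?thesis by (simp add: One_def comp_reduce[OF Comult_Munit])
qed

text \<open>Pointed arrows are primitive elements. The axiom for
  \<open>Comult B \<bullet> Pid B\<close> gives the two summands, and \<open>r\<close> and
  \<open>l\<close> rewrite the inserted units as discarded copies of the input.\<close>

lemma Comult_pointed:
  assumes "f \<in> Hom A B" "Pid B \<bullet> f = f"
  shows "Comult B \<bullet> f = Pairing A f (One A B) \<oplus> Pairing A (One A B) f"
proof -
  have r: "Runit' B \<bullet> f = (f \<odot> Counit A) \<bullet> Comult A"
  proof -
    have "(f \<odot> Counit A) \<bullet> Comult A = Runit' B \<bullet> Runit B \<bullet> (f \<odot> Ident I) \<bullet> (Ident A \<odot> Counit A)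
        \<bullet> Comult A"
      using assms by (simp add: Hom_iff)
    also have "\<dots> = Runit' B \<bullet> f"
      unfolding Comult_Counit using assms(1) comp_reduce[OF Runit_natural[of f]]
          by (simp add: Hom_iff)
    finally show ?thesis ..
  qed
  have l: "Lunit' B \<bullet> f = (Counit A \<odot> f) \<bullet> Comult A"
  proof -
    have "(Counit A \<odot> f) \<bullet> Comult A = Lunit' B \<bullet> Lunit B \<bullet> (Ident I \<odot> f) \<bullet> (Counit A \<odot> Ident A)
        \<bullet> Comult A"
      using assms by (simp add: Hom_iff)
    also have "\<dots> = Lunit' B \<bullet> f"
      unfolding Comult_Counit using assms(1) comp_reduce[OF Lunit_natural[of f]]
          by (simp add: Hom_iff)
    finally show ?thesis ..
  qed
  have "Comult B \<bullet> f = (Comult B \<bullet> Pid B) \<bullet> f" using assms by simp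
  also have "\<dots> = (Pid B \<odot> Munit B) \<bullet> Runit' B \<bullet> f \<oplus> (Munit B \<odot> Pid B) \<bullet> Lunit' B \<bullet> f"
    unfolding Comult_Pid by (simp add: plus_comp)
  also have "\<dots> = Pairing A f (One A B) \<oplus> Pairing A (One A B) f"
    unfolding r l using assms by (simp add: Hom_iff Pairing_def One_def)
  finally show ?thesis .
qed

lemma Pairing_Hom: "f \<in> Hom A B \<Longrightarrow> g \<in> Hom A B' \<Longrightarrow> Pairing A f g \<in> Hom A (B \<otimes> B')"
  by (simp add: Hom_iff)

definition "pointed_in A B f \<longleftrightarrow> f \<in> Hom A B \<and> Pid B \<bullet> f = f"

text \<open>The coproduct is multiplicative and every factor is primitive, so the product expands
  into a sum over all ways to send each factor left or right.\<close>

lemma Comult_Bag_prod: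
  assumes "\<And>t. t \<in># b \<Longrightarrow> pointed_in A B (f t)"
  shows "Comult B \<bullet> Bag_prod A B {#f t. t \<in># b#} = msum A (B \<otimes> B)
    (\<lambda>(x, y). Pairing A (Bag_prod A B {#f t. t \<in># x#}) (Bag_prod A B {#f t. t \<in># y#})) (split2 b)"
  using assms
proof (induction b)
  case empty
  then show ?case by (simp add: Comult_One Hom_iff)
next
  case (add a b)
  let ?P = "\<lambda>x. Bag_prod A B {#f t. t \<in># x#}"
  have f: "f a \<in> Hom A B" "Pid B \<bullet> f a = f a" using add.prems by (auto simp: pointed_in_def)
  have P: "?P x \<in> Hom A B" if "set_mset x \<subseteq> set_mset b" for x
  proof (rule Bag_prod_Hom)
    fix g assume "g \<in># {#f t. t \<in># x#}"
    with that add.prems show "g \<in> Hom A B" unfolding pointed_in_def by auto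
  qed
  have sub: "set_mset x \<subseteq> set_mset b" "set_mset y \<subseteq> set_mset b" if "(x, y) \<in># split2 b" for x y
    using split2_union[OF that] by auto
  have PH: "Pairing A (?P x) (?P y) \<in> Hom A (B \<otimes> B)" if "(x, y) \<in># split2 b" for x y
    using sub[OF that] P Pairing_Hom by blast
  let ?S = "msum A (B \<otimes> B) (\<lambda>(x, y). Pairing A (?P x) (?P y)) (split2 b)"
  have S: "?S \<in> Hom A (B \<otimes> B)" using PH by (auto intro!: msum_Hom)
  have P1: "Pairing A (f a) (One A B) \<in> Hom A (B \<otimes> B)" "Pairing A (One A B) (f a) \<in> Hom A (B \<otimes> B)"
    using f by (auto intro: Pairing_Hom One_Hom)
  \<comment> \<open>Multiplication of pairs is componentwise, so the new factor enters exactly one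
    component, the other being multiplied by \<open>One A B\<close>.\<close>
  have "Conv A (B \<otimes> B) (Pairing A (f a) (One A B)) (Pairing A (?P x) (?P y))
      = Pairing A (?P (add_mset a x)) (?P y)"
    "Conv A (B \<otimes> B) (Pairing A (One A B) (f a)) (Pairing A (?P x) (?P y))
        = Pairing A (?P x) (?P (add_mset a y))"
    if "(x, y) \<in># split2 b" for x y
    using P[OF sub(1)[OF that]] P[OF sub(2)[OF that]] f(1) One_Hom
        by (simp_all add: Conv_Pairing One_conv)
  note pw = this
  have l: "Conv A (B \<otimes> B) (Pairing A (f a) (One A B)) ?S
       = msum A (B \<otimes> B) (\<lambda>(x, y). Pairing A (?P (add_mset a x)) (?P y)) (split2 b)"
    by (subst Conv_msum[OF P1(1)]) (use PH pw(1) in \<open>auto intro!: msum_cong\<close>)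
  have r: "Conv A (B \<otimes> B) (Pairing A (One A B) (f a)) ?S
       = msum A (B \<otimes> B) (\<lambda>(x, y). Pairing A (?P x) (?P (add_mset a y))) (split2 b)"
    by (subst Conv_msum[OF P1(2)]) (use PH pw(2) in \<open>auto intro!: msum_cong\<close>)
  have "Comult B \<bullet> ?P (add_mset a b) = Conv A (B \<otimes> B) (Comult B \<bullet> f a) ?S"
    using Comult_conv[OF f(1) P[of b]] add by simp
  also have "\<dots> = Conv A (B \<otimes> B) (Pairing A (f a) (One A B)) ?S
      \<oplus> Conv A (B \<otimes> B) (Pairing A (One A B) (f a)) ?S"
    using Comult_pointed[OF f] Conv_plus[OF P1 S] by simp
  also have "\<dots> = msum A (B \<otimes> B) (\<lambda>(x, y). Pairing A (?P x) (?P y)) (split2 (add_mset a b))"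
    unfolding l r split2_add_mset
    by (subst msum_union)
      (use sub P f in \<open>auto simp: msum_image_mset case_prod_unfold Conv_Hom_iff
          intro!: Pairing_Hom\<close>)
  finally show ?case .
qed

lemma Lunit_Pairing:
  assumes "f \<in> Hom A B"
  shows "Lunit B \<bullet> (Counit A \<odot> f) \<bullet> Comult A = f"
proof -
  have "Lunit B \<bullet> (Counit A \<odot> f) \<bullet> Comult A = Lunit B \<bullet> (Ident I \<odot> f) \<bullet> (Counit A \<odot> Ident A)
      \<bullet> Comult A"
    using assms by (simp add: Hom_iff)
  also have "\<dots> = f"
    unfolding Comult_Counit using assms comp_reduce[OF Lunit_natural[of f]] by (simp add: Hom_iff)
  finally show ?thesis .
qed

lemma Runit_Pairing:
  assumes "f \<in> Hom A B"
  shows "Runit B \<bullet> (f \<odot> Counit A) \<bullet> Comult A = f"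
proof -
  have "Runit B \<bullet> (f \<odot> Counit A) \<bullet> Comult A = Runit B \<bullet> (f \<odot> Ident I) \<bullet> (Ident A \<odot> Counit A)
      \<bullet> Comult A"
    using assms by (simp add: Hom_iff)
  also have "\<dots> = f"
    unfolding Comult_Counit using assms comp_reduce[OF Runit_natural[of f]] by (simp add: Hom_iff)
  finally show ?thesis .
qed

lemma Counit_pointed: "pointed_in A B f \<Longrightarrow> Counit B \<bullet> f = Zero A I"
  unfolding pointed_in_def by (metis Counit_Pid Hom_iff Zero_comp comp_assoc)

text \<open>The counit is multiplicative and vanishes on pointed arrows, so one factor is enough to
  make it zero.\<close>

lemma Counit_Bag_prod:
  assumes "\<And>t. t \<in># b \<Longrightarrow> pointed_in A B (f t)"
  shows "Counit B \<bullet> Bag_prod A B {#f t. t \<in># b#} = (if b = {#} then Counit A else Zero A I)"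
proof (cases b)
  case empty
  then show ?thesis by (simp add: One_def comp_reduce[OF Counit_Munit])
next
  case (add a b')
  then have "f a \<in> Hom A B" "Bag_prod A B {#f t. t \<in># b'#} \<in> Hom A B" "Counit B \<bullet> f a = Zero A I"
    using assms by (auto simp: Counit_pointed intro!: Bag_prod_Hom) (auto simp: pointed_in_def)
  then show ?thesis
    using add by (simp add: Conv_def Hom_iff comp_reduce[OF Counit_Mult])
qed

text \<open>\<open>Pid\<close> extracts the part of degree one: by \<open>Pid_Mult\<close> it acts
  on one factor and takes the counit of the other. This produces the case distinction of
  substitution in a variable.\<close>

lemma Pid_Bag_prod:
  assumes "\<And>t. t \<in># b \<Longrightarrow> pointed_in A B (f t)"
  shows "Pid B \<bullet> Bag_prod A B {#f t. t \<in># b#} = msum A B f (if size b = 1 then b else {#})"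
proof (cases b)
  case empty
  then show ?thesis by (simp add: One_def comp_reduce[OF Pid_Munit])
next
  case (add a c)
  let ?P = "Bag_prod A B {#f t. t \<in># c#}"
  have *: "f a \<in> Hom A B" "?P \<in> Hom A B" "Counit B \<bullet> f a = Zero A I" "Pid B \<bullet> f a = f a"
    using assms add by (auto simp: Counit_pointed intro!: Bag_prod_Hom) (auto simp: pointed_in_def)
  have c: "Counit B \<bullet> ?P = (if c = {#} then Counit A else Zero A I)"
    using assms add by (intro Counit_Bag_prod) simp
  \<comment> \<open>The other summand of \<open>Pid_Mult\<close> contains
    \<open>Counit B \<bullet> f a\<close>, which is zero.\<close>
  have "Pid B \<bullet> Bag_prod A B {#f t. t \<in># b#} = Runit B \<bullet> (f a \<odot> (Counit B \<bullet> ?P)) \<bullet> Comult A"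
    using * add by (simp add: Conv_def Hom_iff comp_reduce[OF Pid_Mult] plus_comp)
  also have "\<dots> = (if c = {#} then f a else Zero A B)"
    using * by (simp add: c Runit_Pairing) (simp add: Hom_iff)
  finally show ?thesis using * add by (simp add: Hom_iff)
qed

lemma Pairing_msum_left:
  assumes "\<And>x. x \<in># M \<Longrightarrow> f x \<in> Hom A B" "g \<in> Hom A B'"
  shows "Pairing A (msum A B f M) g = msum A (B \<otimes> B') (\<lambda>x. Pairing A (f x) g) M"
  using assms by (simp add: Pairing_def msum_ten[of M f A B g A B'] msum_comp[of _ A "A \<otimes> A"]
      Hom_iff)

lemma Pairing_msum_right:
  assumes "\<And>x. x \<in># M \<Longrightarrow> f x \<in> Hom A B" "g \<in> Hom A B'"
  shows "Pairing A g (msum A B f M) = msum A (B' \<otimes> B) (\<lambda>x. Pairing A g (f x)) M"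
  using assms by (simp add: Pairing_def ten_msum[of M f A B g A B'] msum_comp[of _ A "A \<otimes> A"]
      Hom_iff)

lemma ten_Pairing:
  assumes "f \<in> Hom A B" "g \<in> Hom A B'" "h \<in> Hom B D" "k \<in> Hom B' D'"
  shows "(h \<odot> k) \<bullet> Pairing A f g = Pairing A (h \<bullet> f) (k \<bullet> g)"
  using assms by (simp add: Pairing_def Hom_iff)

text \<open>The assumptions make \<open>W\<close> a morphism of comonoids; precomposition with it
  preserves convolution and its unit.\<close>

lemma Bag_prod_comp:
  assumes W: "W \<in> Hom A' A" "Comult A \<bullet> W = Pairing A' W W" "Counit A \<bullet> W = Counit A'"
    and F: "\<And>t. t \<in># b \<Longrightarrow> f t \<in> Hom A B"
  shows "Bag_prod A B {#f t. t \<in># b#} \<bullet> W = Bag_prod A' B {#f t \<bullet> W. t \<in># b#}"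
  using F
proof (induction b)
  case empty
  then show ?case by (simp add: One_def W)
next
  case (add a b)
  then have *: "f a \<in> Hom A B" "Bag_prod A B {#f t. t \<in># b#} \<in> Hom A B"
    by (auto intro!: Bag_prod_Hom)
  then have "Conv A B (f a) (Bag_prod A B {#f t. t \<in># b#}) \<bullet> W
    = Conv A' B (f a \<bullet> W) (Bag_prod A B {#f t. t \<in># b#} \<bullet> W)"
    using W comp_Hom[OF W(1)] by (simp add: Conv_eq Conv_def[of A] ten_Pairing[of W A' A W A])
  with add show ?case by simp
qed

end

section \<open>Closed structure and denotations\<close>

context closed_resource_category
begin

definition Curry :: "'o \<Rightarrow> 'o \<Rightarrow> 'o \<Rightarrow> ('o, 'm) arrow \<Rightarrow> ('o, 'm) arrow" where
  "Curry G A B f = Arrow G (\<Lambda> G A B (mor f)) (A \<Rrightarrow> B)"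

definition "Ev A B = Arrow ((A \<Rrightarrow> B) \<otimes> A) (ev A B) B"

lemma curry_hom: "f \<in> hom (G \<otimes> A) B \<Longrightarrow> \<Lambda> G A B f \<in> hom G (A \<Rrightarrow> B)"
  using curry_bij[of G A B] by (auto simp: bij_betw_def)

lemma curry_ev: "ev A B \<in> hom ((A \<Rrightarrow> B) \<otimes> A) B" "\<Lambda> (A \<Rrightarrow> B) A B (ev A B) = id (A \<Rrightarrow> B)"
proof -
  have "id (A \<Rrightarrow> B) \<in> \<Lambda> (A \<Rrightarrow> B) A B ` hom ((A \<Rrightarrow> B) \<otimes> A) B"
    using curry_bij[of "A \<Rrightarrow> B" A B] by (simp add: bij_betw_def)
  then show "ev A B \<in> hom ((A \<Rrightarrow> B) \<otimes> A) B" "\<Lambda> (A \<Rrightarrow> B) A B (ev A B) = id (A \<Rrightarrow> B)"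
    unfolding ev_def uncurry_mor_def by (rule inv_into_into, rule f_inv_into_f)
qed

lemma Ev_simps [simp]:
  "arr (Ev A B)" "source (Ev A B) = (A \<Rrightarrow> B) \<otimes> A" "target (Ev A B) = B" "mor (Ev A B) = ev A B"
  by (simp_all add: Ev_def curry_ev)

lemma Curry_simps [simp]:
  "source (Curry G A B f) = G" "target (Curry G A B f) = A \<Rrightarrow> B"
  "mor (Curry G A B f) = \<Lambda> G A B (mor f)"
  by (simp_all add: Curry_def)

lemma arr_Curry [simp]: "arr f \<Longrightarrow> source f = G \<otimes> A \<Longrightarrow> target f = B \<Longrightarrow> arr (Curry G A B f)"
  using curry_hom[of "mor f" G A B] arr_mor[of f] by (simp add: Curry_def)

lemma Curry_Hom: "f \<in> Hom (G \<otimes> A) B \<Longrightarrow> Curry G A B f \<in> Hom G (A \<Rrightarrow> B)"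
  by (simp add: Hom_iff)

lemma Curry_comp:
  assumes "g \<in> Hom G' G" "f \<in> Hom (G \<otimes> A) B"
  shows "Curry G' A B (f \<bullet> (g \<odot> Ident A)) = Curry G A B f \<bullet> g"
  using assms curry_natural[of "mor g" G' G "mor f" A B] arr_mor[of f] arr_mor[of g]
  by (intro arrow_eqI) (simp_all add: Hom_iff)

lemma Curry_Ev:
  assumes "g \<in> Hom G (A \<Rrightarrow> B)"
  shows "Curry G A B (Ev A B \<bullet> (g \<odot> Ident A)) = g"
proof -
  have "Curry (A \<Rrightarrow> B) A B (Ev A B) = Ident (A \<Rrightarrow> B)"
    by (intro arrow_eqI) (simp_all add: curry_ev)
  moreover have "Curry G A B (Ev A B \<bullet> (g \<odot> Ident A)) = Curry (A \<Rrightarrow> B) A B (Ev A B) \<bullet> g"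
    by (rule Curry_comp) (use assms in \<open>simp_all add: Hom_iff\<close>)
  ultimately show ?thesis using assms by (simp add: Hom_iff)
qed

lemma Ev_Curry:
  assumes "f \<in> Hom (G \<otimes> A) B"
  shows "Ev A B \<bullet> (Curry G A B f \<odot> Ident A) = f"
proof (rule arrow_eqI)
  let ?g = "Ev A B \<bullet> (Curry G A B f \<odot> Ident A)"
  show *: "arr ?g" "arr f" "source ?g = source f" "target ?g = target f"
    using assms by (simp_all add: Hom_iff)
  have "Curry G A B ?g = Curry G A B f"
    using assms by (intro Curry_Ev Curry_Hom)
  then have "\<Lambda> G A B (mor ?g) = \<Lambda> G A B (mor f)" by (metis Curry_simps(3))
  moreover have "mor ?g \<in> hom (G \<otimes> A) B" "mor f \<in> hom (G \<otimes> A) B"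
    using arr_mor[OF *(1)] arr_mor[OF *(2)] assms * by (simp_all add: Hom_iff)
  ultimately show "mor ?g = mor f"
    using curry_bij[of G A B] by (auto simp: bij_betw_def dest: inj_onD)
qed

lemma Curry_eqI:
  assumes "g \<in> Hom G (A \<Rrightarrow> B)" "h \<in> Hom G (A \<Rrightarrow> B)" "Ev A B \<bullet> (g \<odot> Ident A) = Ev A B \<bullet> (h \<odot> Ident A)"
  shows "g = h"
  using Curry_Ev[OF assms(1)] Curry_Ev[OF assms(2)] assms(3) by metis

text \<open>No axiom says that currying is additive. Uncurrying is, being built from tensor and
  composition, and it is injective by \<open>Curry_eqI\<close>.\<close>

lemma Curry_msum:
  assumes "\<And>x. x \<in># M \<Longrightarrow> f x \<in> Hom (G \<otimes> A) B"
  shows "Curry G A B (msum (G \<otimes> A) B f M) = msum G (A \<Rrightarrow> B) (\<lambda>x. Curry G A B (f x)) M"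
proof (rule Curry_eqI)
  show "Curry G A B (msum (G \<otimes> A) B f M) \<in> Hom G (A \<Rrightarrow> B)"
    "msum G (A \<Rrightarrow> B) (\<lambda>x. Curry G A B (f x)) M \<in> Hom G (A \<Rrightarrow> B)"
    using assms by (auto intro!: Curry_Hom msum_Hom)
  have "Ev A B \<bullet> (msum G (A \<Rrightarrow> B) (\<lambda>x. Curry G A B (f x)) M \<odot> Ident A)
    = msum (G \<otimes> A) B (\<lambda>x. Ev A B \<bullet> (Curry G A B (f x) \<odot> Ident A)) M"
  proof -
    have "msum G (A \<Rrightarrow> B) (\<lambda>x. Curry G A B (f x)) M \<odot> Ident A
      = msum (G \<otimes> A) ((A \<Rrightarrow> B) \<otimes> A) (\<lambda>x. Curry G A B (f x) \<odot> Ident A) M"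
      by (rule msum_ten) (use assms Curry_Hom in \<open>auto simp: Hom_iff\<close>)
    moreover have "Ev A B \<in> Hom ((A \<Rrightarrow> B) \<otimes> A) B" by (simp add: Hom_iff)
    ultimately show ?thesis by (simp add: comp_msum)
  qed
  also have "\<dots> = msum (G \<otimes> A) B f M"
    using assms by (auto intro!: msum_cong simp: Ev_Curry)
  finally show "Ev A B \<bullet> (Curry G A B (msum (G \<otimes> A) B f M) \<odot> Ident A)
    = Ev A B \<bullet> (msum G (A \<Rrightarrow> B) (\<lambda>x. Curry G A B (f x)) M \<odot> Ident A)"
    using assms by (simp add: Ev_Curry msum_Hom)
qed

definition Apply :: "'o \<Rightarrow> 'o \<Rightarrow> 'o \<Rightarrow> ('o, 'm) arrow \<Rightarrow> ('o, 'm) arrow \<Rightarrow> ('o, 'm) arrow" where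
  "Apply G A B f g = Ev A B \<bullet> Pairing G f g"

lemma Apply_Hom: "f \<in> Hom G (A \<Rrightarrow> B) \<Longrightarrow> g \<in> Hom G A \<Longrightarrow> Apply G A B f g \<in> Hom G B"
  by (simp add: Apply_def Hom_iff)

text \<open>With a general \<open>h\<close> one law covers both the beta redex, for \<open>h\<close>
  an identity, and \<open>Zeta\<close> composed with the denotation of a term.\<close>

lemma Apply_Curry:
  assumes "f \<in> Hom (D \<otimes> A) B" "h \<in> Hom G D" "g \<in> Hom G A"
  shows "Apply G A B (Curry D A B f \<bullet> h) g = f \<bullet> Pairing G h g"
proof -
  have "Apply G A B (Curry D A B f \<bullet> h) g = (Ev A B \<bullet> (Curry D A B f \<odot> Ident A)) \<bullet> (h \<odot> g)
      \<bullet> Comult G"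
    using assms by (simp add: Apply_def Pairing_def Hom_iff)
  then show ?thesis unfolding Ev_Curry[OF assms(1)] by (simp add: Pairing_def)
qed

lemma Apply_msum:
  assumes "\<And>x. x \<in># M \<Longrightarrow> f x \<in> Hom G (A \<Rrightarrow> B)" "\<And>y. y \<in># N \<Longrightarrow> g y \<in> Hom G A"
  shows "Apply G A B (msum G (A \<Rrightarrow> B) f M) (msum G A g N)
     = msum G B (\<lambda>x. msum G B (\<lambda>y. Apply G A B (f x) (g y)) N) M"
proof -
  have E: "Ev A B \<in> Hom ((A \<Rrightarrow> B) \<otimes> A) B" by (simp add: Hom_iff)
  have "Apply G A B (msum G (A \<Rrightarrow> B) f M) (msum G A g N)
     = msum G B (\<lambda>x. Ev A B \<bullet> Pairing G (f x) (msum G A g N)) M"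
    unfolding Apply_def by (subst Pairing_msum_left)
        (use assms E in \<open>auto intro!: msum_Hom simp: comp_msum\<close>)
  also have "\<dots> = msum G B (\<lambda>x. msum G B (\<lambda>y. Apply G A B (f x) (g y)) N) M"
    by (rule msum_cong) (use assms in \<open>simp_all add: Pairing_msum_right[of N g G A _ "A \<Rrightarrow> B"]
        comp_msum[OF E] Apply_def\<close>)
  finally show ?thesis .
qed

end

section \<open>Pointed identities of exponentials, and the denotation of partial
  applications\<close>

locale resource_model = closed_resource_category C
    for C :: "('o, 'm) resource_structure" (structure) +
  fixes ob :: 'o
  assumes curry_pid: "f \<in> hom (G \<otimes> A) B \<Longrightarrow> \<Lambda> G A B (pid B \<cdot> f) = pid (A \<Rrightarrow> B) \<cdot> \<Lambda> G A B f"
begin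

lemma Pid_Curry:
  assumes "f \<in> Hom (G \<otimes> A) B"
  shows "Pid (A \<Rrightarrow> B) \<bullet> Curry G A B f = Curry G A B (Pid B \<bullet> f)"
  using assms curry_pid[of "mor f" G A B] arr_mor[of f] by (intro arrow_eqI) (simp_all add: Hom_iff)

text \<open>Since \<open>Ev\<close> curries to the identity, this is \<open>Pid_Curry\<close>
  uncurried: the pointed part of a function is computed on its values.\<close>

lemma Pid_Ev: "Pid B \<bullet> Ev A B = Ev A B \<bullet> (Pid (A \<Rrightarrow> B) \<odot> Ident A)"
proof -
  have E: "Ev A B \<in> Hom ((A \<Rrightarrow> B) \<otimes> A) B" by (simp add: Hom_iff)
  have "Curry (A \<Rrightarrow> B) A B (Ev A B) = Ident (A \<Rrightarrow> B)"
    using Curry_Ev[of "Ident (A \<Rrightarrow> B)" "A \<Rrightarrow> B" A B] by (simp add: Hom_iff)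
  then have "Curry (A \<Rrightarrow> B) A B (Pid B \<bullet> Ev A B) = Pid (A \<Rrightarrow> B)"
    using Pid_Curry[OF E] by simp
  then show ?thesis using Ev_Curry[of "Pid B \<bullet> Ev A B" "A \<Rrightarrow> B" A B] by (simp add: Hom_iff)
qed

lemma Pid_Apply:
  assumes "f \<in> Hom G (A \<Rrightarrow> B)" "g \<in> Hom G A"
  shows "Pid B \<bullet> Apply G A B f g = Apply G A B (Pid (A \<Rrightarrow> B) \<bullet> f) g"
  using assms comp_reduce[OF Pid_Ev[of B A]] by (simp add: Apply_def Pairing_def Hom_iff)

text \<open>Pointedness is inherited from the function alone. The argument will be a product over a
  bag, which is in general not pointed.\<close>

lemma pointed_Apply:
  assumes "pointed_in G (A \<Rrightarrow> B) f" "g \<in> Hom G A"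
  shows "pointed_in G B (Apply G A B f g)"
  using assms Pid_Apply[of f G A B g] Apply_Hom by (auto simp: pointed_in_def)

abbreviation ty :: "ty \<Rightarrow> 'o" where "ty \<equiv> ty_obj C ob"
abbreviation sq :: "ty list \<Rightarrow> 'o" where "sq \<equiv> seq_obj C ob"
abbreviation ctx :: "ty list \<Rightarrow> 'o" where "ctx \<equiv> ctx_obj C ob"

fun Proj :: "ty list \<Rightarrow> nat \<Rightarrow> ('o, 'm) arrow" where
  "Proj (A # \<Gamma>) 0 = Lunit (ty A) \<bullet> (Counit (ctx \<Gamma>) \<odot> Ident (ty A))"
| "Proj (A # \<Gamma>) (Suc x) = Proj \<Gamma> x \<bullet> Runit (ctx \<Gamma>) \<bullet> (Ident (ctx \<Gamma>) \<odot> Counit (ty A))"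
| "Proj [] x = Null"

lemma Proj_simps [simp]:
  "x < length \<Gamma> \<Longrightarrow> arr (Proj \<Gamma> x) \<and> source (Proj \<Gamma> x) = ctx \<Gamma> \<and> target (Proj \<Gamma> x) = ty (\<Gamma> ! x)
    \<and> mor (Proj \<Gamma> x) = proj C ob \<Gamma> x"
  by (induction \<Gamma> x rule: Proj.induct) simp_all

primrec Zeta :: "ty \<Rightarrow> ('o, 'm) arrow" where
  "Zeta Base = Curry ob I ob (Runit ob)"
| "Zeta (Arr A B) = Curry (ty A \<Rrightarrow> ty B) (ty A \<otimes> sq (args B)) ob
    (Ev (sq (args B)) ob \<bullet> ((Zeta B \<bullet> Ev (ty A) (ty B)) \<odot> Ident (sq (args B)))
      \<bullet> Assoc' (ty A \<Rrightarrow> ty B) (ty A) (sq (args B)))"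

lemma Zeta_simps [simp]:
  "arr (Zeta A) \<and> source (Zeta A) = ty A \<and> target (Zeta A) = sq (args A) \<Rrightarrow> ob \<and> mor (Zeta A)
      = zeta C ob A"
  by (induction A) (simp_all add: Let_def)

text \<open>\<open>Zeta\<close> is built from currying, evaluation and structural isomorphisms, and
  \<open>Pid_Curry\<close>, \<open>Pid_Ev\<close> and naturality move the pointed identity through
  each of these.\<close>

lemma Pid_Zeta: "Pid (sq (args A) \<Rrightarrow> ob) \<bullet> Zeta A = Zeta A \<bullet> Pid (ty A)"
proof (induction A)
  case Base
  have "Curry ob I ob (Pid ob \<bullet> Runit ob) = Curry ob I ob (Runit ob \<bullet> (Pid ob \<odot> Ident I))"
    using Runit_natural[of "Pid ob"] by simp
  also have "\<dots> = Curry ob I ob (Runit ob) \<bullet> Pid ob"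
    by (rule Curry_comp) (simp_all add: Hom_iff)
  finally show ?case using Pid_Curry[of "Runit ob" ob I ob] by (simp add: Hom_iff)
next
  case (Arr A B)
  let ?a = "ty A" and ?b = "ty B" and ?d = "sq (args B)"
  let ?X = "Ev ?d ob \<bullet> ((Zeta B \<bullet> Ev ?a ?b) \<odot> Ident ?d) \<bullet> Assoc' (?a \<Rrightarrow> ?b) ?a ?d"
  have X: "?X \<in> Hom ((?a \<Rrightarrow> ?b) \<otimes> (?a \<otimes> ?d)) ob" by (simp add: Hom_iff)
  have "Pid ob \<bullet> ?X = Ev ?d ob \<bullet> ((Pid (?d \<Rrightarrow> ob) \<bullet> Zeta B \<bullet> Ev ?a ?b) \<odot> Ident ?d)
      \<bullet> Assoc' (?a \<Rrightarrow> ?b) ?a ?d"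
    using comp_reduce[OF Pid_Ev[of ob ?d]] by simp
  also have "Pid (?d \<Rrightarrow> ob) \<bullet> Zeta B \<bullet> Ev ?a ?b = Zeta B \<bullet> Ev ?a ?b \<bullet> (Pid (?a \<Rrightarrow> ?b) \<odot> Ident ?a)"
    using comp_reduce[OF Arr(2)] Pid_Ev[of ?b ?a] by simp
  also have "Ev ?d ob \<bullet> ((Zeta B \<bullet> Ev ?a ?b \<bullet> (Pid (?a \<Rrightarrow> ?b) \<odot> Ident ?a)) \<odot> Ident ?d)
      \<bullet> Assoc' (?a \<Rrightarrow> ?b) ?a ?d
    = Ev ?d ob \<bullet> ((Zeta B \<bullet> Ev ?a ?b) \<odot> Ident ?d) \<bullet> ((Pid (?a \<Rrightarrow> ?b) \<odot> Ident ?a) \<odot> Ident ?d)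
        \<bullet> Assoc' (?a \<Rrightarrow> ?b) ?a ?d"
    by simp
  also have "\<dots> = ?X \<bullet> (Pid (?a \<Rrightarrow> ?b) \<odot> Ident (?a \<otimes> ?d))"
    using Assoc'_natural[of "Pid (?a \<Rrightarrow> ?b)" "Ident ?a" "Ident ?d"]
        by (simp del: interchange interchange_reduce)
  finally show ?case using Pid_Curry[OF X] Curry_comp[OF _ X, of "Pid (?a \<Rrightarrow> ?b)" "?a \<Rrightarrow> ?b"]
    by (simp add: Hom_iff)
qed

definition "Tuple G fs = foldr (Pairing G) fs (Counit G)"

primrec den :: "ty list \<Rightarrow> tm \<Rightarrow> ('o, 'm) arrow" where
  "den \<Gamma> (Var x) = Pid (ty (\<Gamma> ! x)) \<bullet> Proj \<Gamma> x"
| "den \<Gamma> (Lam A s) = Curry (ctx \<Gamma>) (ty A) (ty (type_of (A # \<Gamma>) s)) (den (A # \<Gamma>) s)"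
| "den \<Gamma> (App s b) = Apply (ctx \<Gamma>) (ty (src (type_of \<Gamma> s))) (ty (tgt (type_of \<Gamma> s))) (den \<Gamma> s)
    (Bag_prod (ctx \<Gamma>) (ty (src (type_of \<Gamma> s))) (image_mset (den \<Gamma>) b))"

abbreviation den_bag :: "ty list \<Rightarrow> ty \<Rightarrow> bag \<Rightarrow> ('o, 'm) arrow" where
  "den_bag \<Gamma> A b \<equiv> Bag_prod (ctx \<Gamma>) (ty A) {#den \<Gamma> t. t \<in># b#}"

abbreviation eta_long_bag :: "ty list \<Rightarrow> bag \<Rightarrow> ty \<Rightarrow> bool" where
  "eta_long_bag \<Gamma> b A \<equiv> \<forall>t\<in>#b. eta_long \<Gamma> t A"

lemma den_Lam: "wt (A # \<Gamma>) s B \<Longrightarrow> den \<Gamma> (Lam A s) = Curry (ctx \<Gamma>) (ty A) (ty B) (den (A # \<Gamma>) s)"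
  by (simp add: wt_type_of)

lemma den_App:
  "wt \<Gamma> s (Arr A B) \<Longrightarrow> den \<Gamma> (App s b) = Apply (ctx \<Gamma>) (ty A) (ty B) (den \<Gamma> s) (den_bag \<Gamma> A b)"
  by (simp add: wt_type_of)

text \<open>Variables are pointed by idempotence of \<open>Pid\<close>, abstractions by
  \<open>Pid_Curry\<close>, applications through their function part. This provides the assumption
  of \<open>Comult_Bag_prod\<close> for a substituted bag.\<close>

lemma den_pointed: "wt \<Gamma> s A \<Longrightarrow> pointed_in (ctx \<Gamma>) (ty A) (den \<Gamma> s)"
proof (induction rule: wt.induct)
  case (wt_Var x \<Gamma>)
  then show ?case using comp_reduce[OF Pid_idem] by (simp add: pointed_in_def Hom_iff)
next
  case (wt_Lam A \<Gamma> s B)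
  then show ?case
    unfolding den_Lam[OF wt_Lam(1)] using Pid_Curry[of "den (A # \<Gamma>) s" "ctx \<Gamma>" "ty A" "ty B"]
    by (auto simp: pointed_in_def Hom_iff)
next
  case (wt_App \<Gamma> s A B b)
  have "den_bag \<Gamma> A b \<in> Hom (ctx \<Gamma>) (ty A)"
    using wt_App(3) by (auto intro!: Bag_prod_Hom simp: pointed_in_def)
  then show ?case unfolding den_App[OF wt_App(1)] using wt_App(2) by (simp add: pointed_Apply)
qed

lemma den_Hom: "wt \<Gamma> s A \<Longrightarrow> den \<Gamma> s \<in> Hom (ctx \<Gamma>) (ty A)"
  using den_pointed by (simp add: pointed_in_def)

lemma den_bag_Hom: "eta_long_bag \<Gamma> b A \<Longrightarrow> den_bag \<Gamma> A b \<in> Hom (ctx \<Gamma>) (ty A)"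
  by (auto intro!: Bag_prod_Hom den_Hom)

lemma Tuple_simps [simp]: "Tuple G [] = Counit G" "Tuple G (f # fs) = Pairing G f (Tuple G fs)"
  by (simp_all add: Tuple_def)

lemma Tuple_Hom:
  "list_all2 (\<lambda>b A. eta_long_bag \<Gamma> b A) bs As \<Longrightarrow>
    Tuple (ctx \<Gamma>) (map (\<lambda>(A, b). den_bag \<Gamma> A b) (zip As bs)) \<in> Hom (ctx \<Gamma>) (sq As)"
  by (induction rule: list_all2_induct) (auto simp: Hom_iff dest: den_bag_Hom)

text \<open>Stated for every \<open>s\<close> rather than for variables, because the induction on
  the type absorbs the first argument and continues with \<open>App s c\<close>.
  \<open>Pairing_assoc\<close> cancels the associator in \<open>Zeta\<close>; at the base type the
  empty tuple is a counit, removed by the right unitor.\<close>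

lemma Apply_Zeta:
  "\<lbrakk>wt \<Gamma> s A; list_all2 (\<lambda>b A. eta_long_bag \<Gamma> b A) bs (args A)\<rbrakk> \<Longrightarrow>
    Apply (ctx \<Gamma>) (sq (args A)) ob (Zeta A \<bullet> den \<Gamma> s)
        (Tuple (ctx \<Gamma>) (map (\<lambda>(A, b). den_bag \<Gamma> A b) (zip (args A) bs)))
    = den \<Gamma> (apps s bs)"
proof (induction A arbitrary: s bs)
  case Base
  then have s: "den \<Gamma> s \<in> Hom (ctx \<Gamma>) ob" using den_Hom[of \<Gamma> s Base] by simp
  have "Apply (ctx \<Gamma>) I ob (Curry ob I ob (Runit ob) \<bullet> den \<Gamma> s) (Counit (ctx \<Gamma>))
    = Runit ob \<bullet> Pairing (ctx \<Gamma>) (den \<Gamma> s) (Counit (ctx \<Gamma>))"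
    by (rule Apply_Curry) (use s in \<open>auto simp: Hom_iff\<close>)
  with Base s show ?case by (simp add: Pairing_def Runit_Pairing)
next
  case (Arr A B)
  let ?a = "ty A" and ?b = "ty B" and ?d = "sq (args B)" and ?G = "ctx \<Gamma>"
  let ?X = "Ev ?d ob \<bullet> ((Zeta B \<bullet> Ev ?a ?b) \<odot> Ident ?d) \<bullet> Assoc' (?a \<Rrightarrow> ?b) ?a ?d"
  from Arr.prems obtain c cs where bs: "bs = c # cs" "eta_long_bag \<Gamma> c A"
    "list_all2 (\<lambda>b A. eta_long_bag \<Gamma> b A) cs (args B)"
    by (auto simp: list_all2_Cons2)
  let ?T = "Tuple ?G (map (\<lambda>(A, b). den_bag \<Gamma> A b) (zip (args B) cs))"
  let ?f = "den \<Gamma> s" and ?g = "den_bag \<Gamma> A c"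
  have h: "?f \<in> Hom ?G (?a \<Rrightarrow> ?b)" "?g \<in> Hom ?G ?a" "?T \<in> Hom ?G ?d"
    using den_Hom[OF Arr.prems(1)] den_bag_Hom[OF bs(2)] Tuple_Hom[OF bs(3)] by simp_all
  have w: "wt \<Gamma> (App s c) B" using Arr.prems(1) bs(2) by (rule wt_App)
  have "Apply ?G (?a \<otimes> ?d) ob (Zeta (Arr A B) \<bullet> ?f) (Pairing ?G ?g ?T)
      = ?X \<bullet> Pairing ?G ?f (Pairing ?G ?g ?T)"
    unfolding Zeta.simps by (rule Apply_Curry) (use h in \<open>auto simp: Hom_iff\<close>)
  also have "\<dots> = Ev ?d ob \<bullet> ((Zeta B \<bullet> Ev ?a ?b) \<odot> Ident ?d) \<bullet> Pairing ?G (Pairing ?G ?f ?g) ?T"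
    using h Pairing_assoc[of ?f ?g ?T ?G, symmetric] by (simp add: Hom_iff)
  also have "\<dots> = Apply ?G ?d ob (Zeta B \<bullet> den \<Gamma> (App s c)) ?T"
    unfolding den_App[OF Arr.prems(1)] using h by (simp add: Apply_def Hom_iff Pairing_def)
  also have "\<dots> = den \<Gamma> (apps (App s c) cs)"
    by (rule Arr.IH(2)[OF w bs(3)])
  finally show ?case using bs by (simp add: apps_def)
qed

lemma wt_apps_Var:
  "wt \<Gamma> (apps (Var x) bs) B \<Longrightarrow> \<exists>As. x < length \<Gamma> \<and> \<Gamma> ! x = arrs As B
      \<and> list_all2 (\<lambda>b A. eta_long_bag \<Gamma> b A) bs As"
proof (induction bs arbitrary: B rule: rev_induct)
  case Nil
  then show ?case by (auto elim!: wt_VarE simp: arrs_def)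
next
  case (snoc b bs)
  then obtain A where "wt \<Gamma> (apps (Var x) bs) (Arr A B)" "eta_long_bag \<Gamma> b A"
    by (auto simp: apps_snoc elim!: wt_AppE)
  with snoc.IH obtain As
      where "x < length \<Gamma>" "\<Gamma> ! x = arrs As (Arr A B)" "list_all2 (\<lambda>b A. eta_long_bag \<Gamma> b A) bs As"
    by blast
  with \<open>eta_long_bag \<Gamma> b A\<close> show ?case
    by (intro exI[of _ "As @ [A]"]) (auto simp: arrs_def intro: list_all2_appendI)
qed

lemma den_bag_sem:
  assumes "\<And>t. t \<in># b \<Longrightarrow> den \<Gamma> t = Arrow (ctx \<Gamma>) (sem C ob \<Gamma> t) (ty A)" "eta_long_bag \<Gamma> b A"
  shows "den_bag \<Gamma> A b = Arrow (ctx \<Gamma>) (\<Pi> (ctx \<Gamma>) (ty A) {#sem C ob \<Gamma> t. t \<in># b#}) (ty A)"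
proof -
  have "sem C ob \<Gamma> t \<in> hom (ctx \<Gamma>) (ty A)" if "t \<in># b" for t
    using den_Hom[of \<Gamma> t A] assms that by (simp add: Hom_iff)
  then have "Bag_prod (ctx \<Gamma>) (ty A) {#Arrow (ctx \<Gamma>) m (ty A). m \<in># {#sem C ob \<Gamma> t. t \<in># b#}#}
    = Arrow (ctx \<Gamma>) (\<Pi> (ctx \<Gamma>) (ty A) {#sem C ob \<Gamma> t. t \<in># b#}) (ty A)"
    by (intro Bag_prod_Arrow) auto
  moreover have "{#den \<Gamma> t. t \<in># b#} = {#Arrow (ctx \<Gamma>) (sem C ob \<Gamma> t) (ty A). t \<in># b#}"
    using assms(1) by (intro image_mset_cong) auto
  ultimately show ?thesis by (simp add: multiset.map_comp o_def)
qed

lemma Tuple_pack: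
  assumes "list_all2 (\<lambda>b A. eta_long_bag \<Gamma> b A) bs As"
    "\<And>b t A. b \<in> set bs \<Longrightarrow> t \<in># b \<Longrightarrow> eta_long \<Gamma> t A \<Longrightarrow> den \<Gamma> t = Arrow (ctx \<Gamma>) (sem C ob \<Gamma> t) (ty A)"
  shows "mor (Tuple (ctx \<Gamma>) (map (\<lambda>(A, b). den_bag \<Gamma> A b) (zip As bs)))
    = pack C ob \<Gamma> As (map (\<lambda>b. {#sem C ob \<Gamma> t. t \<in># b#}) bs)"
  using assms
proof (induction rule: list_all2_induct)
  case Nil
  then show ?case by (simp add: pack_def tuple_def)
next
  case (Cons b bs A As)
  have "den_bag \<Gamma> A b = Arrow (ctx \<Gamma>) (\<Pi> (ctx \<Gamma>) (ty A) {#sem C ob \<Gamma> t. t \<in># b#}) (ty A)"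
    by (rule den_bag_sem) (use Cons.hyps(1) Cons.prems[of b] in auto)
  moreover have "den_bag \<Gamma> A b \<in> Hom (ctx \<Gamma>) (ty A)" using Cons by (intro den_bag_Hom) auto
  moreover note Tuple_Hom[OF Cons(2)]
  moreover have "mor (Tuple (ctx \<Gamma>) (map (\<lambda>(A, b). den_bag \<Gamma> A b) (zip As bs)))
    = pack C ob \<Gamma> As (map (\<lambda>b. {#sem C ob \<Gamma> t. t \<in># b#}) bs)"
    by (rule Cons.IH, rule Cons.prems) auto
  ultimately show ?case by (simp add: pack_def tuple_def Hom_iff)
qed

text \<open>The induction is on size because the clause of \<open>sem\<close> for a head variable
  reaches into all bags of the spine at once.\<close>

lemma den_sem: "eta_long \<Gamma> s A \<Longrightarrow> den \<Gamma> s = Arrow (ctx \<Gamma>) (sem C ob \<Gamma> s) (ty A)"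
proof (induction "size s" arbitrary: \<Gamma> s A rule: less_induct)
  case less
  from less.prems have w: "wt \<Gamma> s A" by simp
  have d: "arr (den \<Gamma> s)" "source (den \<Gamma> s) = ctx \<Gamma>" "target (den \<Gamma> s) = ty A"
    using den_Hom[OF w] by (simp_all add: Hom_iff)
  have "mor (den \<Gamma> s) = sem C ob \<Gamma> s"
  proof (cases "var_headed s")
    case True
    with less.prems var_headed_ex obtain x bs where s: "s = apps (Var x) bs" "A = Base" by blast
    with wt_apps_Var w obtain As where As: "x < length \<Gamma>" "\<Gamma> ! x = arrs As Base"
      and bs: "list_all2 (\<lambda>b A. eta_long_bag \<Gamma> b A) bs As" by blast
    let ?T = "Tuple (ctx \<Gamma>) (map (\<lambda>(A, b). den_bag \<Gamma> A b) (zip As bs))"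
    have T: "mor ?T = pack C ob \<Gamma> As (map (\<lambda>b. {#sem C ob \<Gamma> t. t \<in># b#}) bs)"
      by (rule Tuple_pack[OF bs]) (use less.hyps s size_apps in blast)
    have "den \<Gamma> s = Apply (ctx \<Gamma>) (sq As) ob (Zeta (\<Gamma> ! x) \<bullet> Pid (ty (\<Gamma> ! x)) \<bullet> Proj \<Gamma> x) ?T"
      using Apply_Zeta[OF wt_Var[OF As(1)], of bs] As bs s by simp
    \<comment> \<open>\<open>den\<close> has the pointed identity at the variable, before
      \<open>Zeta\<close>; \<open>sem\<close> has it after. \<open>Pid_Zeta\<close> exchanges the
      two.\<close>
    also have "\<dots> = Ev (sq As) ob \<bullet> Pairing (ctx \<Gamma>) (Pid (sq As \<Rrightarrow> ob) \<bullet> Zeta (\<Gamma> ! x) \<bullet> Proj \<Gamma> x) ?T"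
      using comp_reduce[OF Pid_Zeta[of "\<Gamma> ! x"]] As by (simp add: Apply_def)
    also have "mor \<dots> = sem C ob \<Gamma> s"
      using As T Tuple_Hom[OF bs] by (simp add: s Let_def var_mor_def Hom_iff)
    finally show ?thesis .
  next
    case False
    show ?thesis
    proof (cases s)
      case (Lam B t)
      with w obtain D where D: "A = Arr B D" "eta_long (B # \<Gamma>) t D" by (auto elim: wt_LamE)
      with less.hyps[of t "B # \<Gamma>" D] Lam show ?thesis by (simp add: wt_type_of)
    next
      case (App t b)
      with w obtain B where B: "wt \<Gamma> t (Arr B A)" "eta_long_bag \<Gamma> b B" by (auto elim: wt_AppE)
      \<comment> \<open>Although \<open>t\<close> has an arrow type it is eta-long, as no variable
        heads it, so the induction hypothesis applies to it.\<close>
      from App False have t: "\<not> var_headed t" by simp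
      have "den \<Gamma> t = Arrow (ctx \<Gamma>) (sem C ob \<Gamma> t) (ty (Arr B A))"
        using less.hyps[of t] App B t by simp
      moreover have "den_bag \<Gamma> B b
          = Arrow (ctx \<Gamma>) (\<Pi> (ctx \<Gamma>) (ty B) {#sem C ob \<Gamma> t. t \<in># b#}) (ty B)"
        by (intro den_bag_sem less.hyps) (use B App in \<open>auto dest: size_mem_bag\<close>)
      moreover note den_Hom[OF B(1)] den_bag_Hom[OF B(2)]
      ultimately show ?thesis using App t wt_type_of[OF B(1)]
        by (simp add: Apply_def Hom_iff Let_def)
    qed (use False in simp)
  qed
  with d show ?case by (metis arrow.exhaust_sel arr_Null)
qed

end

section \<open>Weakening and substitution\<close>

context resource_category
begin

text \<open>The coproduct of \<open>H \<otimes> A\<close> is that of the factors followed by a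
  middle exchange, and \<open>Mid_natural\<close> gives each component one copy of \<open>A\<close>.
  The index family \<open>M\<close> stands for the splittings of a bag, or for a single pair in the
  case of a comonoid morphism.\<close>

lemma Comult_ten_natural:
  assumes "W \<in> Hom G H" "Comult H \<bullet> W = msum G (H \<otimes> H) (\<lambda>(x, y). Pairing G (f x) (g y)) M"
    "\<And>x y. (x, y) \<in># M \<Longrightarrow> f x \<in> Hom G H \<and> g y \<in> Hom G H"
  shows "Comult (H \<otimes> A) \<bullet> (W \<odot> Ident A) = msum (G \<otimes> A) ((H \<otimes> A) \<otimes> (H \<otimes> A))
    (\<lambda>(x, y). Pairing (G \<otimes> A) (f x \<odot> Ident A) (g y \<odot> Ident A)) M"
proof -
  have pt: "Mid H H A A \<bullet> (Pairing G (f x) (g y) \<odot> Comult A)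
      = Pairing (G \<otimes> A) (f x \<odot> Ident A) (g y \<odot> Ident A)"
    if "(x, y) \<in># M" for x y
  proof -
    have 1: "Pairing G (f x) (g y) \<odot> Comult A
        = ((f x \<odot> g y) \<odot> (Ident A \<odot> Ident A)) \<bullet> (Comult G \<odot> Comult A)"
      using assms(3)[OF that] by (simp add: Pairing_def Hom_iff)
    have 2: "Mid H H A A \<bullet> ((f x \<odot> g y) \<odot> (Ident A \<odot> Ident A))
        = ((f x \<odot> Ident A) \<odot> (g y \<odot> Ident A)) \<bullet> Mid G G A A"
      using Mid_natural[of "f x" "g y" "Ident A" "Ident A"] assms(3)[OF that] by (simp add: Hom_iff)
    show ?thesis unfolding 1 comp_reduce[OF 2] by (simp add: Pairing_def Comult_tensor)
  qed
  have "Comult (H \<otimes> A) \<bullet> (W \<odot> Ident A) = Mid H H A A \<bullet> ((Comult H \<bullet> W) \<odot> Comult A)"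
    using assms(1) by (simp add: Comult_tensor Hom_iff)
  also have "\<dots> = msum (G \<otimes> A) ((H \<otimes> A) \<otimes> (H \<otimes> A))
     (\<lambda>p. Mid H H A A \<bullet> ((case p of (x, y) \<Rightarrow> Pairing G (f x) (g y)) \<odot> Comult A)) M"
    unfolding assms(2)
    by (subst msum_ten) (use assms(3) in \<open>auto simp: Hom_iff comp_msum[of _ "(H \<otimes> H) \<otimes> (A \<otimes> A)"]\<close>)
  also have "\<dots> = msum (G \<otimes> A) ((H \<otimes> A) \<otimes> (H \<otimes> A))
    (\<lambda>(x, y). Pairing (G \<otimes> A) (f x \<odot> Ident A) (g y \<odot> Ident A)) M"
    by (rule msum_cong) (use pt in auto)
  finally show ?thesis .
qed

lemma Comult_ten_comonoid:
  assumes "W \<in> Hom G H" "Comult H \<bullet> W = Pairing G W W"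
  shows "Comult (H \<otimes> A) \<bullet> (W \<odot> Ident A) = Pairing (G \<otimes> A) (W \<odot> Ident A) (W \<odot> Ident A)"
  using Comult_ten_natural[of W G H "\<lambda>_. W" "\<lambda>_. W" "{#((), ())#}" A] assms
  by (simp add: Hom_iff)

definition "Wk G A = Runit G \<bullet> (Ident G \<odot> Counit A)"

lemma Wk_simps [simp]: "arr (Wk G A)" "source (Wk G A) = G \<otimes> A" "target (Wk G A) = G"
  by (simp_all add: Wk_def)

lemma Counit_Wk: "Counit G \<bullet> Wk G A = Counit (G \<otimes> A)"
  using comp_reduce[OF Runit_natural[of "Counit G", symmetric]]
  by (simp add: Wk_def Counit_tensor Lunit_I)

text \<open>The exchange moves a unit past \<open>B\<close>; there \<open>Lunit_Symm\<close> removes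
  the swap, and triangle and \<open>Runit_ten\<close> remove the associators.\<close>

lemma Runit_Mid: "(Runit A \<odot> Runit B) \<bullet> Mid A B I I = Runit (A \<otimes> B) \<bullet> (Ident (A \<otimes> B) \<odot> Lunit I)"
proof -
  have 1: "(Runit A \<odot> Ident B) \<bullet> Assoc' A I B = Ident A \<odot> Lunit B" for A B
    unfolding Triangle[symmetric] by simp
  have 2: "Lunit (B \<otimes> I) \<bullet> Assoc I B I \<bullet> (Symm B I \<odot> Ident I) \<bullet> Assoc' B I I = Ident B \<odot> Lunit I"
    using comp_reduce[OF Lunit_ten[of B I]] by (simp add: Lunit_Symm 1)
  have "(Runit A \<odot> Runit B) \<bullet> Mid A B I I
     = (Ident A \<odot> Runit B) \<bullet> ((Runit A \<odot> Ident (B \<otimes> I)) \<bullet> Assoc' A I (B \<otimes> I))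
       \<bullet> (Ident A \<odot> (Assoc I B I \<bullet> (Symm B I \<odot> Ident I) \<bullet> Assoc' B I I)) \<bullet> Assoc A B (I \<otimes> I)"
    by (simp add: Mid_def)
  also have "\<dots> = (Ident A \<odot> Runit B) \<bullet> (Ident A \<odot> (Ident B \<odot> Lunit I)) \<bullet> Assoc A B (I \<otimes> I)"
    unfolding 1 using 2 by simp
  also have "\<dots> = ((Ident A \<odot> Runit B) \<bullet> Assoc A B I) \<bullet> (Ident (A \<otimes> B) \<odot> Lunit I)"
    using Assoc_natural[of "Ident A" "Ident B" "Lunit I"]
        by (simp del: interchange interchange_reduce)
  finally show ?thesis unfolding Runit_ten .
qed

text \<open>Discarding both copies of \<open>A\<close> amounts to discarding \<open>A\<close> once
  (\<open>e\<close>), and \<open>Runit_Mid\<close> removes the units left behind by the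
  exchange.\<close>

lemma Comult_Wk: "Comult G \<bullet> Wk G A = Pairing (G \<otimes> A) (Wk G A) (Wk G A)"
proof -
  have e: "Lunit I \<bullet> (Counit A \<odot> Counit A) \<bullet> Comult A = Counit A"
    by (rule Lunit_Pairing) (simp add: Hom_iff)
  have "Pairing (G \<otimes> A) (Wk G A) (Wk G A)
     = (Runit G \<odot> Runit G) \<bullet> ((Ident G \<odot> Counit A) \<odot> (Ident G \<odot> Counit A)) \<bullet> Mid G G A A
         \<bullet> (Comult G \<odot> Comult A)"
    by (simp add: Pairing_def Wk_def Comult_tensor)
  also have "\<dots> = (Runit G \<odot> Runit G) \<bullet> Mid G G I I \<bullet> ((Ident G \<odot> Ident G) \<odot> (Counit A \<odot> Counit A))
      \<bullet> (Comult G \<odot> Comult A)"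
    using comp_reduce[OF Mid_natural[of "Ident G" "Ident G" "Counit A" "Counit A"]]
        by (simp del: interchange interchange_reduce)
  also have "\<dots> = Runit (G \<otimes> G) \<bullet> (Comult G \<odot> Counit A)"
    using comp_reduce[OF Runit_Mid[of G G]] e by simp
  also have "\<dots> = Runit (G \<otimes> G) \<bullet> (Comult G \<odot> Ident I) \<bullet> (Ident G \<odot> Counit A)"
    by simp
  also have "\<dots> = Comult G \<bullet> Wk G A"
    using comp_reduce[OF Runit_natural[of "Comult G"]]
        by (simp add: Wk_def del: interchange interchange_reduce)
  finally show ?thesis ..
qed

lemma Wk_natural: "W \<in> Hom G H \<Longrightarrow> Wk H A \<bullet> (W \<odot> Ident A) = W \<bullet> Wk G A"
proof -
  assume W: "W \<in> Hom G H"
  then have "Wk H A \<bullet> (W \<odot> Ident A) = Runit H \<bullet> (W \<odot> Ident I) \<bullet> (Ident G \<odot> Counit A)"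
    by (simp add: Wk_def Hom_iff)
  with W comp_reduce[OF Runit_natural[of W]] show ?thesis
    by (simp add: Wk_def Hom_iff del: interchange interchange_reduce)
qed

end

context closed_resource_category
begin

lemma Apply_comp:
  assumes "f \<in> Hom H (A \<Rrightarrow> B)" "g \<in> Hom H A" "W \<in> Hom G H" "Comult H \<bullet> W = Pairing G U V"
    "U \<in> Hom G H" "V \<in> Hom G H"
  shows "Apply H A B f g \<bullet> W = Apply G A B (f \<bullet> U) (g \<bullet> V)"
  using assms by (simp add: Apply_def Pairing_def[of H] ten_Pairing)

end

section \<open>Weakening of denotations\<close>

context resource_model
begin

text \<open>Specified by properties instead of a formula, so that crossing a binder is just
  tensoring with an identity.\<close>

definition weakening :: "ty list \<Rightarrow> ty list \<Rightarrow> ty \<Rightarrow> ('o, 'm) arrow \<Rightarrow> bool" where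
  "weakening \<Delta> \<Gamma> A W \<longleftrightarrow> W \<in> Hom (ctx (\<Delta> @ A # \<Gamma>)) (ctx (\<Delta> @ \<Gamma>))
    \<and> Comult (ctx (\<Delta> @ \<Gamma>)) \<bullet> W = Pairing (ctx (\<Delta> @ A # \<Gamma>)) W W
    \<and> Counit (ctx (\<Delta> @ \<Gamma>)) \<bullet> W = Counit (ctx (\<Delta> @ A # \<Gamma>))
    \<and> (\<forall>x<length (\<Delta> @ \<Gamma>). Proj (\<Delta> @ \<Gamma>) x \<bullet> W
        = Proj (\<Delta> @ A # \<Gamma>) (if x < length \<Delta> then x else Suc x))"

lemma Proj_Suc: "Proj (A # \<Gamma>) (Suc x) = Proj \<Gamma> x \<bullet> Wk (ctx \<Gamma>) (ty A)"
  by (simp add: Wk_def)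

lemma weakening_Wk: "weakening [] \<Gamma> A (Wk (ctx \<Gamma>) (ty A))"
  by (simp add: weakening_def Hom_iff Comult_Wk Counit_Wk Proj_Suc del: Proj.simps)

lemma Proj_0_ten:
  assumes "W \<in> Hom G (ctx \<Gamma>)"
  shows "Proj (A # \<Gamma>) 0 \<bullet> (W \<odot> Ident (ty A)) = Lunit (ty A) \<bullet> ((Counit (ctx \<Gamma>) \<bullet> W) \<odot> Ident (ty A))"
  using assms by (simp add: Hom_iff)

lemma weakening_Cons:
  assumes "weakening \<Delta> \<Gamma> A W"
  shows "weakening (B # \<Delta>) \<Gamma> A (W \<odot> Ident (ty B))"
proof -
  let ?G = "ctx (\<Delta> @ A # \<Gamma>)" and ?H = "ctx (\<Delta> @ \<Gamma>)"
  have W: "W \<in> Hom ?G ?H" "Comult ?H \<bullet> W = Pairing ?G W W" "Counit ?H \<bullet> W = Counit ?G"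
    and p: "\<And>x. x < length (\<Delta> @ \<Gamma>) \<Longrightarrow> Proj (\<Delta> @ \<Gamma>) x \<bullet> W
        = Proj (\<Delta> @ A # \<Gamma>) (if x < length \<Delta> then x else Suc x)"
    using assms by (auto simp: weakening_def)
  have "Proj (B # \<Delta> @ \<Gamma>) x \<bullet> (W \<odot> Ident (ty B))
      = Proj (B # \<Delta> @ A # \<Gamma>) (if x < Suc (length \<Delta>) then x else Suc x)"
    if "x < Suc (length (\<Delta> @ \<Gamma>))" for x
  proof (cases x)
    case 0
    show ?thesis unfolding 0 Proj_0_ten[OF W(1)] W(3) by simp
  next
    case (Suc y)
    have "Proj (B # \<Delta> @ \<Gamma>) x \<bullet> (W \<odot> Ident (ty B)) = (Proj (\<Delta> @ \<Gamma>) y \<bullet> W) \<bullet> Wk ?G (ty B)"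
      unfolding Suc Proj_Suc using Wk_natural[OF W(1)] by simp
    with p[of y] Suc that show ?thesis by (simp add: Proj_Suc del: Proj.simps)
  qed
  moreover have "Counit (?H \<otimes> ty B) \<bullet> (W \<odot> Ident (ty B)) = Counit (?G \<otimes> ty B)"
    using W by (simp add: Counit_tensor Hom_iff)
  moreover note Comult_ten_comonoid[OF W(1,2), of "ty B"]
  ultimately show ?thesis
    using W(1) by (simp add: weakening_def Hom_iff del: Proj.simps)
qed

text \<open>A weakening is a morphism of comonoids, so in contrast to a substitution it is copied
  unsplit into the parts of an application or bag.\<close>

lemma den_lift:
  "wt (\<Delta> @ \<Gamma>) s B \<Longrightarrow> weakening \<Delta> \<Gamma> A W \<Longrightarrow> den (\<Delta> @ A # \<Gamma>) (lift (length \<Delta>) s) = den (\<Delta> @ \<Gamma>) s \<bullet> W"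
proof (induction "\<Delta> @ \<Gamma>" s B arbitrary: \<Delta> W rule: wt.induct)
  case (wt_Var x)
  then have "Proj (\<Delta> @ \<Gamma>) x \<bullet> W = Proj (\<Delta> @ A # \<Gamma>) (if x < length \<Delta> then x else Suc x)"
    by (simp add: weakening_def)
  then show ?case using wt_Var(1) by (auto simp: nth_append Suc_diff_le)
next
  case (wt_Lam D s B)
  have W: "W \<in> Hom (ctx (\<Delta> @ A # \<Gamma>)) (ctx (\<Delta> @ \<Gamma>))" using wt_Lam.prems by (simp add: weakening_def)
  have t: "wt (D # \<Delta> @ A # \<Gamma>) (lift (Suc (length \<Delta>)) s) B"
    using wt_lift[of "D # \<Delta>" \<Gamma> s B A] wt_Lam(1) by simp
  have "den (D # \<Delta> @ A # \<Gamma>) (lift (Suc (length \<Delta>)) s) = den (D # \<Delta> @ \<Gamma>) s \<bullet> (W \<odot> Ident (ty D))"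
    using wt_Lam(2)[of "D # \<Delta>"] weakening_Cons[OF wt_Lam.prems] by simp
  then show ?case
    using Curry_comp[OF W, of "den (D # \<Delta> @ \<Gamma>) s" "ty D" "ty B"] den_Hom[OF wt_Lam(1)]
    by (simp add: den_Lam[OF wt_Lam(1)] den_Lam[OF t] del: den.simps)
next
  case (wt_App s D B b)
  let ?G = "ctx (\<Delta> @ A # \<Gamma>)" and ?H = "ctx (\<Delta> @ \<Gamma>)"
  have W: "W \<in> Hom ?G ?H" "Comult ?H \<bullet> W = Pairing ?G W W" "Counit ?H \<bullet> W = Counit ?G"
    using wt_App.prems by (auto simp: weakening_def)
  have b: "\<forall>t\<in>#b. eta_long (\<Delta> @ \<Gamma>) t D" using wt_App(3) by auto
  have "den_bag (\<Delta> @ \<Gamma>) D b \<bullet> W = Bag_prod ?G (ty D) {#den (\<Delta> @ \<Gamma>) t \<bullet> W. t \<in># b#}"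
    by (rule Bag_prod_comp[OF W]) (use b in \<open>auto intro: den_Hom\<close>)
  also have "{#den (\<Delta> @ \<Gamma>) t \<bullet> W. t \<in># b#}
      = {#den (\<Delta> @ A # \<Gamma>) t. t \<in># {#lift (length \<Delta>) t. t \<in># b#}#}"
    unfolding multiset.map_comp by (rule image_mset_cong) (use wt_App in auto)
  finally have "den_bag (\<Delta> @ \<Gamma>) D b \<bullet> W = den_bag (\<Delta> @ A # \<Gamma>) D {#lift (length \<Delta>) t. t \<in># b#}" .
  moreover have "wt (\<Delta> @ A # \<Gamma>) (lift (length \<Delta>) s) (Arr D B)" using wt_App(1) by (rule wt_lift)
  ultimately show ?case
    using Apply_comp[OF _ _ W(1,2) W(1) W(1), of "den (\<Delta> @ \<Gamma>) s" "ty D" "ty B"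
        "den_bag (\<Delta> @ \<Gamma>) D b"]
      den_Hom[OF wt_App(1)] den_bag_Hom[OF b] wt_App(2)[OF wt_App.prems]
    by (simp add: den_App[OF wt_App(1)] den_App[of "\<Delta> @ A # \<Gamma>"] del: den.simps)
qed

section \<open>Multilinearity and the substitution lemma\<close>

abbreviation den_sum :: "ty list \<Rightarrow> ty \<Rightarrow> tm_sum \<Rightarrow> ('o, 'm) arrow" where
  "den_sum \<Gamma> A S \<equiv> msum (ctx \<Gamma>) (ty A) (den \<Gamma>) S"

abbreviation den_bag_sum :: "ty list \<Rightarrow> ty \<Rightarrow> bag_sum \<Rightarrow> ('o, 'm) arrow" where
  "den_bag_sum \<Gamma> A B \<equiv> msum (ctx \<Gamma>) (ty A) (den_bag \<Gamma> A) B"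

lemma den_App_sum:
  assumes "\<forall>s\<in>#S. wt \<Gamma> s (Arr A D)" "\<forall>b\<in>#B. eta_long_bag \<Gamma> b A"
  shows "den_sum \<Gamma> D (App_sum S B)
      = Apply (ctx \<Gamma>) (ty A) (ty D) (den_sum \<Gamma> (Arr A D) S) (den_bag_sum \<Gamma> A B)"
proof -
  have "den_sum \<Gamma> D (App_sum S B)
      = msum (ctx \<Gamma>) (ty D) (\<lambda>s. msum (ctx \<Gamma>) (ty D) (\<lambda>b. den \<Gamma> (App s b)) B) S"
    unfolding App_sum_def
    by (subst msum_sum_mset) (use assms in \<open>auto simp: msum_image_mset intro!: den_Hom wt_App\<close>)
  also have "\<dots> = msum (ctx \<Gamma>) (ty D) (\<lambda>s. msum (ctx \<Gamma>) (ty D)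
      (\<lambda>b. Apply (ctx \<Gamma>) (ty A) (ty D) (den \<Gamma> s) (den_bag \<Gamma> A b)) B) S"
    by (intro msum_cong refl den_App) (use assms in auto)
  also have "\<dots> = Apply (ctx \<Gamma>) (ty A) (ty D) (den_sum \<Gamma> (Arr A D) S) (den_bag_sum \<Gamma> A B)"
    unfolding ty_obj.simps
    by (rule Apply_msum[symmetric]) (use assms den_Hom[of \<Gamma> _ "Arr A D"] den_bag_Hom in auto)
  finally show ?thesis .
qed

lemma den_cons_sum:
  assumes "\<forall>s\<in>#S. eta_long \<Gamma> s A" "\<forall>b\<in>#B. eta_long_bag \<Gamma> b A"
  shows "den_bag_sum \<Gamma> A (cons_sum S B) = Conv (ctx \<Gamma>) (ty A) (den_sum \<Gamma> A S) (den_bag_sum \<Gamma> A B)"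
proof -
  have h: "den_sum \<Gamma> A S \<in> Hom (ctx \<Gamma>) (ty A)" "den_bag_sum \<Gamma> A B \<in> Hom (ctx \<Gamma>) (ty A)"
    using assms by (auto intro!: msum_Hom den_Hom den_bag_Hom)
  have "den_bag_sum \<Gamma> A (cons_sum S B)
      = msum (ctx \<Gamma>) (ty A) (\<lambda>s. den_bag_sum \<Gamma> A {#add_mset s b. b \<in># B#}) S"
    unfolding cons_sum_def
        by (subst msum_sum_mset)
        (use assms in \<open>auto intro!: den_bag_Hom[unfolded image_mset_add_mset]\<close>)
  also have "\<dots> = msum (ctx \<Gamma>) (ty A) (\<lambda>s. Conv (ctx \<Gamma>) (ty A) (den \<Gamma> s) (den_bag_sum \<Gamma> A B)) S"
  proof (rule msum_cong[OF refl])
    fix s assume "s \<in># S"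
    then have "den \<Gamma> s \<in> Hom (ctx \<Gamma>) (ty A)" using assms den_Hom by blast
    then show "den_bag_sum \<Gamma> A {#add_mset s b. b \<in># B#}
        = Conv (ctx \<Gamma>) (ty A) (den \<Gamma> s) (den_bag_sum \<Gamma> A B)"
      using assms den_bag_Hom by (simp add: msum_image_mset Conv_msum)
  qed
  also have "\<dots> = Conv (ctx \<Gamma>) (ty A) (den_sum \<Gamma> A S) (den_bag_sum \<Gamma> A B)"
    \<comment> \<open>\<open>Conv_msum\<close> is linearity in the second argument; commutativity
      transfers it to the first.\<close>
    unfolding Conv_commute[of _ _ _ "den_bag_sum \<Gamma> A B"]
    by (rule Conv_msum[symmetric]) (use h assms den_Hom in auto)
  finally show ?thesis .
qed

text \<open>
  \<open>\<sigma> b\<close> interprets the substitution of the bag \<open>{#t i. i \<in># b#}\<close>.  The indices \<open>i\<close> stay fixed when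
  a binder is crossed: there \<open>t\<close> becomes \<open>lift 0 \<circ> t\<close>, and \<open>\<sigma> b\<close> becomes \<open>\<sigma> b \<otimes> id\<close>.
\<close>

definition substitution ::
  "ty list \<Rightarrow> ty list \<Rightarrow> ty \<Rightarrow> 'i set \<Rightarrow> ('i \<Rightarrow> tm) \<Rightarrow> ('i multiset \<Rightarrow> ('o, 'm) arrow) \<Rightarrow> bool" where
  "substitution \<Delta> \<Gamma> A Q t \<sigma> \<longleftrightarrow>
    (\<forall>i\<in>Q. eta_long (\<Delta> @ \<Gamma>) (t i) A) \<and>
    (\<forall>b. set_mset b \<subseteq> Q \<longrightarrow>
      \<sigma> b \<in> Hom (ctx (\<Delta> @ \<Gamma>)) (ctx (\<Delta> @ A # \<Gamma>)) \<and>
      Comult (ctx (\<Delta> @ A # \<Gamma>)) \<bullet> \<sigma> b = msum (ctx (\<Delta> @ \<Gamma>)) (ctx (\<Delta> @ A # \<Gamma>) \<otimes> ctx (\<Delta> @ A # \<Gamma>))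
        (\<lambda>(x, y). Pairing (ctx (\<Delta> @ \<Gamma>)) (\<sigma> x) (\<sigma> y)) (split2 b) \<and>
      Counit (ctx (\<Delta> @ A # \<Gamma>)) \<bullet> \<sigma> b
        = (if b = {#} then Counit (ctx (\<Delta> @ \<Gamma>)) else Zero (ctx (\<Delta> @ \<Gamma>)) I) \<and>
      (\<forall>x<length (\<Delta> @ A # \<Gamma>). den (\<Delta> @ A # \<Gamma>) (Var x) \<bullet> \<sigma> b
        = den_sum (\<Delta> @ \<Gamma>) ((\<Delta> @ A # \<Gamma>) ! x) (subst (Var x) (length \<Delta>) {#t i. i \<in># b#})))"

lemma substitutionD:
  assumes "substitution \<Delta> \<Gamma> A Q t \<sigma>"
  shows "i \<in> Q \<Longrightarrow> eta_long (\<Delta> @ \<Gamma>) (t i) A"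
    "set_mset b \<subseteq> Q \<Longrightarrow> \<sigma> b \<in> Hom (ctx (\<Delta> @ \<Gamma>)) (ctx (\<Delta> @ A # \<Gamma>))"
    "set_mset b \<subseteq> Q \<Longrightarrow> Comult (ctx (\<Delta> @ A # \<Gamma>)) \<bullet> \<sigma> b
        = msum (ctx (\<Delta> @ \<Gamma>)) (ctx (\<Delta> @ A # \<Gamma>) \<otimes> ctx (\<Delta> @ A # \<Gamma>))
        (\<lambda>(x, y). Pairing (ctx (\<Delta> @ \<Gamma>)) (\<sigma> x) (\<sigma> y)) (split2 b)"
    "set_mset b \<subseteq> Q \<Longrightarrow> Counit (ctx (\<Delta> @ A # \<Gamma>)) \<bullet> \<sigma> b
        = (if b = {#} then Counit (ctx (\<Delta> @ \<Gamma>)) else Zero (ctx (\<Delta> @ \<Gamma>)) I)"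
    "set_mset b \<subseteq> Q \<Longrightarrow> x < length (\<Delta> @ A # \<Gamma>) \<Longrightarrow> den (\<Delta> @ A # \<Gamma>) (Var x) \<bullet> \<sigma> b
        = den_sum (\<Delta> @ \<Gamma>) ((\<Delta> @ A # \<Gamma>) ! x) (subst (Var x) (length \<Delta>) {#t i. i \<in># b#})"
  using assms unfolding substitution_def by blast+

lemma split2_subset:
  assumes "(x, y) \<in># split2 b" "set_mset b \<subseteq> Q"
  shows "set_mset x \<subseteq> Q" "set_mset y \<subseteq> Q"
  using split2_union[OF assms(1)] assms(2) by auto

lemma substitution_Cons:
  assumes s: "substitution \<Delta> \<Gamma> A Q t \<sigma>"
  shows "substitution (B # \<Delta>) \<Gamma> A Q (\<lambda>i. lift 0 (t i)) (\<lambda>b. \<sigma> b \<odot> Ident (ty B))"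
  unfolding substitution_def
proof (intro conjI ballI allI impI)
  let ?G = "ctx (\<Delta> @ \<Gamma>)" and ?H = "ctx (\<Delta> @ A # \<Gamma>)" and ?B = "ty B"
  note sD = substitutionD[OF s]
  fix i assume "i \<in> Q"
  with sD(1)[of i] wt_lift[of "[]" "\<Delta> @ \<Gamma>" "t i" A B] show "wt ((B # \<Delta>) @ \<Gamma>) (lift 0 (t i)) A"
    and "var_headed (lift 0 (t i)) \<Longrightarrow> A = Base" by auto
next
  let ?G = "ctx (\<Delta> @ \<Gamma>)" and ?H = "ctx (\<Delta> @ A # \<Gamma>)" and ?B = "ty B"
  note sD = substitutionD[OF s]
  fix b assume b: "set_mset b \<subseteq> Q"
  show "\<sigma> b \<odot> Ident ?B \<in> Hom (ctx ((B # \<Delta>) @ \<Gamma>)) (ctx ((B # \<Delta>) @ A # \<Gamma>))"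
    using sD(2)[OF b] by (simp add: Hom_iff)
  show "Comult (ctx ((B # \<Delta>) @ A # \<Gamma>)) \<bullet> (\<sigma> b \<odot> Ident ?B)
    = msum (ctx ((B # \<Delta>) @ \<Gamma>)) (ctx ((B # \<Delta>) @ A # \<Gamma>) \<otimes> ctx ((B # \<Delta>) @ A # \<Gamma>))
        (\<lambda>(x, y). Pairing (ctx ((B # \<Delta>) @ \<Gamma>)) (\<sigma> x \<odot> Ident ?B) (\<sigma> y \<odot> Ident ?B)) (split2 b)"
    using Comult_ten_natural[OF sD(2)[OF b] sD(3)[OF b], of ?B] sD(2) split2_subset[OF _ b] by simp
  show "Counit (ctx ((B # \<Delta>) @ A # \<Gamma>)) \<bullet> (\<sigma> b \<odot> Ident ?B)
        = (if b = {#} then Counit (ctx ((B # \<Delta>) @ \<Gamma>)) else Zero (ctx ((B # \<Delta>) @ \<Gamma>)) I)"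
    using sD(2)[OF b] sD(4)[OF b] by (simp add: Counit_tensor Hom_iff)
  fix x assume x: "x < length ((B # \<Delta>) @ A # \<Gamma>)"
  show "den ((B # \<Delta>) @ A # \<Gamma>) (Var x) \<bullet> (\<sigma> b \<odot> Ident ?B)
      = den_sum ((B # \<Delta>) @ \<Gamma>) (((B # \<Delta>) @ A # \<Gamma>) ! x)
        (subst (Var x) (length (B # \<Delta>)) {#lift 0 (t i). i \<in># b#})"
  proof (cases x)
    case 0
    \<comment> \<open>The fresh variable sees \<open>\<sigma> b\<close> only through its counit, so
      its denotation survives exactly for the empty bag.\<close>
    have "Proj (B # \<Delta> @ A # \<Gamma>) 0 \<bullet> (\<sigma> b \<odot> Ident ?B)
      = (if b = {#} then Proj (B # \<Delta> @ \<Gamma>) 0 else Zero (?G \<otimes> ?B) ?B)"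
      unfolding Proj_0_ten[OF sD(2)[OF b]] sD(4)[OF b] by simp
    then show ?thesis unfolding 0 using wt_Var[of 0 "B # \<Delta> @ \<Gamma>"] den_Hom[of "B # \<Delta> @ \<Gamma>" "Var 0" B]
      by (simp add: msum_single Hom_iff del: Proj.simps)
  next
    case (Suc y)
    let ?C = "(\<Delta> @ A # \<Gamma>) ! y" and ?S = "subst (Var y) (length \<Delta>) {#t i. i \<in># b#}"
    from x Suc have y: "y < length (\<Delta> @ A # \<Gamma>)" by simp
    have w: "wt (\<Delta> @ \<Gamma>) u ?C" if "u \<in># ?S" for u
      by (rule wt_subst[OF wt_Var[OF y] _ that]) (use sD(1) b in auto)
    \<comment> \<open>Syntactically the result for \<open>y\<close> is lifted. Semantically
      \<open>Wk_natural\<close> moves the weakening to the right of \<open>\<sigma> b\<close>, and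
      \<open>den_lift\<close> identifies the two.\<close>
    have S: "subst (Var (Suc y)) (Suc (length \<Delta>)) {#lift 0 (t i). i \<in># b#} = {#lift 0 u. u \<in># ?S#}"
      by (auto simp: multiset.map_comp o_def)
    have "den (B # \<Delta> @ A # \<Gamma>) (Var x) \<bullet> (\<sigma> b \<odot> Ident ?B)
        = (den (\<Delta> @ A # \<Gamma>) (Var y) \<bullet> \<sigma> b) \<bullet> Wk ?G ?B"
      using Wk_natural[OF sD(2)[OF b], of ?B] by (simp add: Suc Proj_Suc del: Proj.simps)
    also have "\<dots> = msum (ctx (B # \<Delta> @ \<Gamma>)) (ty ?C) (\<lambda>u. den (\<Delta> @ \<Gamma>) u \<bullet> Wk ?G ?B) ?S"
      unfolding sD(5)[OF b y] by (subst msum_comp[where A = "?G \<otimes> ?B"]) (simp_all add: Hom_iff)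
    also have "\<dots> = msum (ctx (B # \<Delta> @ \<Gamma>)) (ty ?C) (\<lambda>u. den (B # \<Delta> @ \<Gamma>) (lift 0 u)) ?S"
      by (rule msum_cong[OF refl], rule den_lift[of "[]" "\<Delta> @ \<Gamma>", simplified, symmetric])
        (use w weakening_Wk[of "\<Delta> @ \<Gamma>" B] in auto)
    finally show ?thesis using S by (simp add: Suc msum_image_mset del: den.simps subst.simps)
  qed
qed

text \<open>Stated for lists because \<open>subst_bag\<close> follows an enumeration. The claim for
  single elements is an assumption, since the lemma is used inside the induction for
  \<open>den_subst\<close>.\<close>

lemma den_bag_subst:
  assumes s: "substitution \<Delta> \<Gamma> A Q t \<sigma>"
    and w: "\<forall>c\<in>set cs. eta_long (\<Delta> @ A # \<Gamma>) c D"
    and IH: "\<And>c b. c \<in> set cs \<Longrightarrow> set_mset b \<subseteq> Q \<Longrightarrow>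
      den (\<Delta> @ A # \<Gamma>) c \<bullet> \<sigma> b = den_sum (\<Delta> @ \<Gamma>) D (subst c (length \<Delta>) {#t i. i \<in># b#})"
    and b: "set_mset b \<subseteq> Q"
  shows "den_bag (\<Delta> @ A # \<Gamma>) D (mset cs) \<bullet> \<sigma> b = den_bag_sum (\<Delta> @ \<Gamma>) D
    (\<Sum>bs\<in>#splits (length cs) {#t i. i \<in># b#}. bag_of_sums
        (map (\<lambda>(s, d). subst s (length \<Delta>) d) (zip cs bs)))"
  using w IH b
proof (induction cs arbitrary: b)
  case Nil
  let ?G = "ctx (\<Delta> @ \<Gamma>)"
  \<comment> \<open>The empty product only discards its input, so the counit of
    \<open>\<sigma> b\<close> decides. A nonempty bag has nowhere to go, in agreement with
    \<open>splits_0\<close>.\<close>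
  show ?case using substitutionD(4)[OF s Nil(3)]
    by (auto simp: One_def splits_0 bag_of_sums_def)
next
  case (Cons c cs)
  let ?G = "ctx (\<Delta> @ \<Gamma>)" and ?H = "ctx (\<Delta> @ A # \<Gamma>)" and ?D = "ty D" and ?k = "length \<Delta>"
  let ?t = "image_mset t"
  let ?B = "\<lambda>bs. bag_of_sums (map (\<lambda>(s, d). subst s ?k d) (zip cs bs))"
  let ?f = "den (\<Delta> @ A # \<Gamma>) c" and ?P = "den_bag (\<Delta> @ A # \<Gamma>) D (mset cs)"
  note sD = substitutionD[OF s]
  have h: "?f \<in> Hom ?H ?D" "?P \<in> Hom ?H ?D"
    using Cons.prems(1) by (auto intro!: den_Hom den_bag_Hom)
  have wS: "eta_long (\<Delta> @ \<Gamma>) u D" if "u \<in># subst c' ?k x" "c' \<in> set (c # cs)" "set_mset x \<subseteq> t ` Q"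
      for u c' x
  proof -
    have "\<forall>t\<in>#x. eta_long (\<Delta> @ \<Gamma>) t A" using that(3) sD(1) by auto
    then show ?thesis using wt_subst[of \<Delta> A \<Gamma> c' D x u] var_headed_subst[OF that(1)] that
        Cons.prems(1) by blast
  qed
  have wB: "eta_long_bag (\<Delta> @ \<Gamma>) c' D" if "bs \<in># splits n (?t y)" "c' \<in># ?B bs" "set_mset y \<subseteq> Q"
      for c' bs y n
  proof
    fix u assume "u \<in># c'"
    from in_bag_of_sums[OF that(2) this] obtain s d
        where sd: "(s, d) \<in> set (zip cs bs)" "u \<in># subst s ?k d" by auto
    then have "s \<in> set cs" "d \<in> set bs" by (auto dest: set_zip_leftD set_zip_rightD)
    with splits_subset[OF that(1)] that(3) have "set_mset d \<subseteq> t ` Q" by fastforce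
    with wS[of u s d] sd \<open>s \<in> set cs\<close> show "eta_long (\<Delta> @ \<Gamma>) u D" by simp
  qed
  \<comment> \<open>The head \<open>c\<close> receives the part \<open>x\<close>, and the elements
    of \<open>cs\<close> share the part \<open>y\<close>.\<close>
  have pt: "Mult ?D \<bullet> (?f \<odot> ?P) \<bullet> Pairing ?G (\<sigma> x) (\<sigma> y) = den_bag_sum (\<Delta> @ \<Gamma>) D
      (\<Sum>bs\<in>#splits (length cs) (?t y). cons_sum (subst c ?k (?t x)) (?B bs))"
    if xy: "(x, y) \<in># split2 b" for x y
  proof -
    note Q = split2_subset[OF xy Cons.prems(3)]
    let ?S = "subst c ?k (?t x)" and ?M = "splits (length cs) (?t y)"
    have S: "\<forall>u\<in>#?S. eta_long (\<Delta> @ \<Gamma>) u D" using wS[of _ c "?t x"] Q(1) by auto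
    then have Sh: "den_sum (\<Delta> @ \<Gamma>) D ?S \<in> Hom ?G ?D" by (auto intro!: msum_Hom den_Hom)
    have "Mult ?D \<bullet> (?f \<odot> ?P) \<bullet> Pairing ?G (\<sigma> x) (\<sigma> y) = Conv ?G ?D (?f \<bullet> \<sigma> x) (?P \<bullet> \<sigma> y)"
      using h sD(2)[OF Q(1)] sD(2)[OF Q(2)] by (simp add: ten_Pairing Conv_eq comp_Hom)
    also have "?f \<bullet> \<sigma> x = den_sum (\<Delta> @ \<Gamma>) D ?S" using Cons.prems(2)[of c x] Q by simp
    also have "?P \<bullet> \<sigma> y = den_bag_sum (\<Delta> @ \<Gamma>) D (\<Sum>bs\<in>#?M. ?B bs)"
      using Q Cons.prems by (intro Cons.IH) auto
    also have "\<dots> = msum ?G ?D (\<lambda>bs. den_bag_sum (\<Delta> @ \<Gamma>) D (?B bs)) ?M"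
      using wB[OF _ _ Q(2)] den_bag_Hom by (intro msum_sum_mset) blast
    also have "Conv ?G ?D (den_sum (\<Delta> @ \<Gamma>) D ?S) \<dots>
      = msum ?G ?D (\<lambda>bs. Conv ?G ?D (den_sum (\<Delta> @ \<Gamma>) D ?S) (den_bag_sum (\<Delta> @ \<Gamma>) D (?B bs))) ?M"
      using wB[OF _ _ Q(2)] den_bag_Hom by (intro Conv_msum[OF Sh] msum_Hom) blast
    also have "\<dots> = msum ?G ?D (\<lambda>bs. den_bag_sum (\<Delta> @ \<Gamma>) D (cons_sum ?S (?B bs))) ?M"
      using S wB[OF _ _ Q(2)] by (intro msum_cong refl den_cons_sum[symmetric]) blast+
    also have "\<dots> = den_bag_sum (\<Delta> @ \<Gamma>) D (\<Sum>bs\<in>#?M. cons_sum ?S (?B bs))"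
    proof (rule msum_sum_mset[symmetric])
      fix bs c' assume bs: "bs \<in># ?M" "c' \<in># cons_sum ?S (?B bs)"
      then obtain u d where "c' = add_mset u d" "u \<in># ?S" "d \<in># ?B bs" by (auto simp: cons_sum_def)
      with S wB[OF bs(1) _ Q(2), of d] have "eta_long_bag (\<Delta> @ \<Gamma>) c' D" by auto
      then show "den_bag (\<Delta> @ \<Gamma>) D c' \<in> Hom ?G ?D" by (rule den_bag_Hom)
    qed
    finally show ?thesis .
  qed
  have "den_bag (\<Delta> @ A # \<Gamma>) D (mset (c # cs)) \<bullet> \<sigma> b = Mult ?D \<bullet> (?f \<odot> ?P) \<bullet> Comult ?H \<bullet> \<sigma> b"
    using h by (simp add: Conv_def)
  also have "\<dots> = msum ?G ?D
      (\<lambda>p. Mult ?D \<bullet> (?f \<odot> ?P) \<bullet> (case p of (x, y) \<Rightarrow> Pairing ?G (\<sigma> x) (\<sigma> y))) (split2 b)"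
    unfolding sD(3)[OF Cons.prems(3)] using h
    by (simp add: comp_msum[of _ "?H \<otimes> ?H" "?D \<otimes> ?D"] comp_msum[of _ "?D \<otimes> ?D" ?D] Hom_iff)
  also have "\<dots> = msum ?G ?D (\<lambda>(x, y). den_bag_sum (\<Delta> @ \<Gamma>) D
      (\<Sum>bs\<in>#splits (length cs) (?t y). cons_sum (subst c ?k (?t x)) (?B bs))) (split2 b)"
    by (rule msum_cong) (use pt in auto)
  also have "\<dots> = den_bag_sum (\<Delta> @ \<Gamma>) D (\<Sum>(x, y)\<in>#split2 b.
      (\<Sum>bs\<in>#splits (length cs) (?t y). cons_sum (subst c ?k (?t x)) (?B bs)))"
  proof (rule trans[OF _ msum_sum_mset[symmetric]])
    fix p c' assume p: "p \<in># split2 b" and c': "c' \<in># (case p of (x, y) \<Rightarrow>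
      (\<Sum>bs\<in>#splits (length cs) (?t y). cons_sum (subst c ?k (?t x)) (?B bs)))"
    obtain x y where xy: "p = (x, y)" by (cases p)
    note Q = split2_subset[OF p[unfolded xy] Cons.prems(3)]
    from c' xy obtain bs u d where "bs \<in># splits (length cs) (?t y)" "c' = add_mset u d"
      "u \<in># subst c ?k (?t x)" "d \<in># ?B bs"
      by (auto simp: cons_sum_def)
    with wB[OF _ _ Q(2), of bs "length cs" d] wS[of u c "?t x"] Q(1) have
        "eta_long_bag (\<Delta> @ \<Gamma>) c' D" by auto
    then show "den_bag (\<Delta> @ \<Gamma>) D c' \<in> Hom ?G ?D" by (rule den_bag_Hom)
  qed (simp add: case_prod_unfold)
  \<comment> \<open>\<open>split2_image_mset\<close> passes from labels to terms, and
    \<open>splits_Suc\<close> merges the binary splitting with that of the second part.\<close>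
  finally show ?case
    by (simp add: splits_Suc split2_image_mset sum_mset_sum_mset multiset.map_comp o_def
        case_prod_unfold
        bag_of_sums_def)
qed

text \<open>\<open>t\<close> and \<open>\<sigma>\<close> vary in the induction, because an
  abstraction replaces them by the data of \<open>substitution_Cons\<close>; the label set
  \<open>Q\<close> stays fixed.\<close>

lemma den_subst:
  "wt (\<Delta> @ A # \<Gamma>) s B \<Longrightarrow> substitution \<Delta> \<Gamma> A Q t \<sigma> \<Longrightarrow> set_mset b \<subseteq> Q \<Longrightarrow>
    den (\<Delta> @ A # \<Gamma>) s \<bullet> \<sigma> b = den_sum (\<Delta> @ \<Gamma>) B (subst s (length \<Delta>) {#t i. i \<in># b#})"
proof (induction "\<Delta> @ A # \<Gamma>" s B arbitrary: \<Delta> t \<sigma> b rule: wt.induct)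
  case (wt_Var x)
  then show ?case using substitutionD(5) by blast
next
  case (wt_Lam D s B)
  let ?G = "ctx (\<Delta> @ \<Gamma>)" and ?H = "ctx (\<Delta> @ A # \<Gamma>)"
  let ?S = "subst s (Suc (length \<Delta>)) {#lift 0 (t i). i \<in># b#}"
  note s = wt_Lam.prems(1)
  have w: "wt (D # \<Delta> @ \<Gamma>) u B" if "u \<in># ?S" for u
    using wt_subst[of "D # \<Delta>" A \<Gamma> s B "{#lift 0 (t i). i \<in># b#}" u] that wt_Lam(1)
      substitutionD(1)[OF substitution_Cons[OF s, of D]] wt_Lam.prems(2) by auto
  have "den (\<Delta> @ A # \<Gamma>) (Lam D s) \<bullet> \<sigma> b
      = Curry ?G (ty D) (ty B) (den (D # \<Delta> @ A # \<Gamma>) s \<bullet> (\<sigma> b \<odot> Ident (ty D)))"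
    unfolding den_Lam[OF wt_Lam(1)]
    using Curry_comp[OF substitutionD(2)[OF s wt_Lam.prems(2)]] den_Hom[OF wt_Lam(1)] by simp
  also have "den (D # \<Delta> @ A # \<Gamma>) s \<bullet> (\<sigma> b \<odot> Ident (ty D)) = den_sum (D # \<Delta> @ \<Gamma>) B ?S"
    using wt_Lam(2)[of "D # \<Delta>", OF _ substitution_Cons[OF s] wt_Lam.prems(2)] by simp
  also have "Curry ?G (ty D) (ty B) \<dots>
      = msum ?G (ty (Arr D B)) (\<lambda>u. Curry ?G (ty D) (ty B) (den (D # \<Delta> @ \<Gamma>) u)) ?S"
    using Curry_msum[of ?S "den (D # \<Delta> @ \<Gamma>)" ?G "ty D" "ty B"] w den_Hom[of "D # \<Delta> @ \<Gamma>"] by simp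
  also have "\<dots> = msum ?G (ty (Arr D B)) (\<lambda>u. den (\<Delta> @ \<Gamma>) (Lam D u)) ?S"
    by (intro msum_cong refl den_Lam[symmetric] w)
  finally show ?case by (simp add: msum_image_mset multiset.map_comp o_def del: den.simps)
next
  case (wt_App s D B c)
  let ?G = "ctx (\<Delta> @ \<Gamma>)" and ?H = "ctx (\<Delta> @ A # \<Gamma>)" and ?k = "length \<Delta>" and ?t = "image_mset t"
  let ?f = "den (\<Delta> @ A # \<Gamma>) s" and ?P = "den_bag (\<Delta> @ A # \<Gamma>) D c"
  note s = wt_App.prems(1)
  note sD = substitutionD[OF s]
  have c: "eta_long_bag (\<Delta> @ A # \<Gamma>) c D" using wt_App(3) by auto
  have h: "?f \<in> Hom ?H (ty D \<Rrightarrow> ty B)" "?P \<in> Hom ?H (ty D)"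
    using den_Hom[OF wt_App(1)] den_bag_Hom[OF c] by simp_all
  have wS: "wt (\<Delta> @ \<Gamma>) u (Arr D B)" if "u \<in># subst s ?k (?t x)" "set_mset x \<subseteq> Q" for u x
    by (rule wt_subst[OF wt_App(1) _ that(1)]) (use that(2) sD(1) in auto)
  have wB: "eta_long_bag (\<Delta> @ \<Gamma>) c' D" if c': "c' \<in># subst_bag c ?k (?t y)"
      and y: "set_mset y \<subseteq> Q" for c' y
  proof
    fix u assume "u \<in># c'"
    with in_subst_bag[OF c'] obtain v d
        where v: "v \<in># c" "set_mset d \<subseteq> set_mset (?t y)" "u \<in># subst v ?k d"
      by blast
    from v(2) y have "set_mset d \<subseteq> t ` Q" by auto
    with sD(1) have "\<forall>t\<in>#d. eta_long (\<Delta> @ \<Gamma>) t A" by auto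
    with wt_subst[of \<Delta> A \<Gamma> v D d u] v c var_headed_subst[OF v(3)] show "eta_long (\<Delta> @ \<Gamma>) u D"
        by blast
  qed
  have pt: "Ev (ty D) (ty B) \<bullet> (?f \<odot> ?P) \<bullet> Pairing ?G (\<sigma> x) (\<sigma> y)
      = den_sum (\<Delta> @ \<Gamma>) B (App_sum (subst s ?k (?t x)) (subst_bag c ?k (?t y)))"
    if xy: "(x, y) \<in># split2 b" for x y
  proof -
    note Q = split2_subset[OF xy wt_App.prems(2)]
    have "Ev (ty D) (ty B) \<bullet> (?f \<odot> ?P) \<bullet> Pairing ?G (\<sigma> x) (\<sigma> y)
        = Apply ?G (ty D) (ty B) (?f \<bullet> \<sigma> x) (?P \<bullet> \<sigma> y)"
      using h sD(2)[OF Q(1)] sD(2)[OF Q(2)] by (simp add: ten_Pairing Apply_def)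
    also have "?f \<bullet> \<sigma> x = den_sum (\<Delta> @ \<Gamma>) (Arr D B) (subst s ?k (?t x))"
      using wt_App(2)[OF s Q(1)] .
    \<comment> \<open>\<open>subst_bag\<close> substitutes along \<open>enum c\<close>, so
      \<open>den_bag_subst\<close> is applied to this list.\<close>
    also have "?P \<bullet> \<sigma> y = den_bag_sum (\<Delta> @ \<Gamma>) D (subst_bag c ?k (?t y))"
      using den_bag_subst[OF s, of "enum c" D y] c Q(2) wt_App(3) s
          by (auto simp: size_mset[symmetric] simp del: size_mset)
    also have "Apply ?G (ty D) (ty B) (den_sum (\<Delta> @ \<Gamma>) (Arr D B) (subst s ?k (?t x))) \<dots>
      = den_sum (\<Delta> @ \<Gamma>) B (App_sum (subst s ?k (?t x)) (subst_bag c ?k (?t y)))"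
      by (rule den_App_sum[symmetric]) (use wS wB Q in blast)+
    finally show ?thesis .
  qed
  have "den (\<Delta> @ A # \<Gamma>) (App s c) \<bullet> \<sigma> b = Ev (ty D) (ty B) \<bullet> (?f \<odot> ?P) \<bullet> Comult ?H \<bullet> \<sigma> b"
    unfolding den_App[OF wt_App(1)] by (simp add: Apply_def Pairing_def)
  also have "\<dots> = msum ?G (ty B) (\<lambda>p. Ev (ty D) (ty B) \<bullet> (?f \<odot> ?P)
      \<bullet> (case p of (x, y) \<Rightarrow> Pairing ?G (\<sigma> x) (\<sigma> y))) (split2 b)"
    unfolding sD(3)[OF wt_App.prems(2)] using h
    by (simp add: comp_msum[of _ "?H \<otimes> ?H" "(ty D \<Rrightarrow> ty B) \<otimes> ty D"]
        comp_msum[of _ "(ty D \<Rrightarrow> ty B) \<otimes> ty D" "ty B"] Hom_iff)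
  also have "\<dots> = msum ?G (ty B) (\<lambda>(x, y). den_sum (\<Delta> @ \<Gamma>) B
      (App_sum (subst s ?k (?t x)) (subst_bag c ?k (?t y)))) (split2 b)"
    by (rule msum_cong) (use pt in auto)
  also have "\<dots> = den_sum (\<Delta> @ \<Gamma>) B
      (\<Sum>(x, y)\<in>#split2 b. App_sum (subst s ?k (?t x)) (subst_bag c ?k (?t y)))"
  proof (subst msum_sum_mset)
    fix p u assume p: "p \<in># split2 b"
      and u: "u \<in># (case p of (x, y) \<Rightarrow> App_sum (subst s ?k (?t x)) (subst_bag c ?k (?t y)))"
    obtain x y where xy: "p = (x, y)" by (cases p)
    note Q = split2_subset[OF p[unfolded xy] wt_App.prems(2)]
    from u xy obtain v d where "u = App v d" "v \<in># subst s ?k (?t x)" "d \<in># subst_bag c ?k (?t y)"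
      by (auto simp: App_sum_def simp del: subst_bag.simps)
    with wt.wt_App[OF wS[OF _ Q(1)] wB[OF _ Q(2)], of v d] show "den (\<Delta> @ \<Gamma>) u \<in> Hom ?G (ty B)"
      by (simp add: den_Hom del: den.simps subst_bag.simps)
  qed (simp add: case_prod_unfold)
  finally show ?case
    by (simp add: subst_App split2_image_mset multiset.map_comp o_def case_prod_unfold del:
        den.simps subst.simps subst_bag.simps)
qed

section \<open>Beta steps and closure under reduction\<close>

lemma Pairing_Ident_simps:
  assumes "g \<in> Hom G A"
  shows "Pairing G (Ident G) g \<in> Hom G (G \<otimes> A)"
    "Wk G A \<bullet> Pairing G (Ident G) g = Runit G \<bullet> (Ident G \<odot> (Counit A \<bullet> g)) \<bullet> Comult G"
    "Counit (G \<otimes> A) \<bullet> Pairing G (Ident G) g = Lunit I \<bullet> (Counit G \<odot> (Counit A \<bullet> g)) \<bullet> Comult G"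
  using assms by (simp_all add: Pairing_def Hom_iff Wk_def Counit_tensor)

text \<open>Outside all binders the terms serve as their own labels. The required properties reduce
  to the coproduct, counit and pointed part of a product of pointed arrows.\<close>

lemma substitution_Pairing:
  "substitution [] \<Gamma> A {t. eta_long \<Gamma> t A} (\<lambda>t. t)
      (\<lambda>b. Pairing (ctx \<Gamma>) (Ident (ctx \<Gamma>)) (den_bag \<Gamma> A b))"
  unfolding substitution_def append_Nil
proof (intro conjI ballI allI impI)
  let ?G = "ctx \<Gamma>" and ?A = "ty A"
  let ?s = "\<lambda>b. Pairing ?G (Ident ?G) (den_bag \<Gamma> A b)"
  fix b :: bag assume "set_mset b \<subseteq> {t. eta_long \<Gamma> t A}"
  then have b: "eta_long_bag \<Gamma> b A" by auto
  note h = den_bag_Hom[OF b]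
  have pt: "\<And>t. t \<in># b \<Longrightarrow> pointed_in ?G ?A (den \<Gamma> t)" using b den_pointed by blast
  show "?s b \<in> Hom ?G (ctx (A # \<Gamma>))" using Pairing_Ident_simps(1)[OF h] by simp
  show c: "Counit (ctx (A # \<Gamma>)) \<bullet> ?s b = (if b = {#} then Counit ?G else Zero ?G I)"
    using Pairing_Ident_simps(3)[OF h] Lunit_Pairing[of "Counit ?G" ?G I]
        Counit_Bag_prod[of b ?G ?A "den \<Gamma>", OF pt]
    by (simp add: Hom_iff)
  have xy: "den_bag \<Gamma> A x \<in> Hom ?G ?A \<and> den_bag \<Gamma> A y \<in> Hom ?G ?A" if "(x, y) \<in># split2 b" for x y
    using split2_union[OF that] b by (auto intro!: den_bag_Hom)
  show "Comult (ctx (A # \<Gamma>)) \<bullet> ?s b = msum ?G (ctx (A # \<Gamma>) \<otimes> ctx (A # \<Gamma>))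
      (\<lambda>(x, y). Pairing ?G (?s x) (?s y)) (split2 b)"
  proof -
    \<comment> \<open>The exchange regroups two copies of the context and two products into two
      pairs; the resulting permutation of inputs is absorbed by
      \<open>Comult_Comult\<close>.\<close>
    have p: "Mid ?G ?G ?A ?A \<bullet> (Comult ?G \<odot> Pairing ?G f g) \<bullet> Comult ?G
      = Pairing ?G (Pairing ?G (Ident ?G) f) (Pairing ?G (Ident ?G) g)"
      if "f \<in> Hom ?G ?A" "g \<in> Hom ?G ?A" for f g
    proof -
      have "Mid ?G ?G ?A ?A \<bullet> (Comult ?G \<odot> Pairing ?G f g) \<bullet> Comult ?G
         = (Mid ?G ?G ?A ?A \<bullet> ((Ident ?G \<odot> Ident ?G) \<odot> (f \<odot> g))) \<bullet> (Comult ?G \<odot> Comult ?G)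
             \<bullet> Comult ?G"
        using that by (simp add: Pairing_def Hom_iff)
      also have "\<dots> = ((Ident ?G \<odot> f) \<odot> (Ident ?G \<odot> g)) \<bullet> Mid ?G ?G ?G ?G \<bullet> (Comult ?G \<odot> Comult ?G)
          \<bullet> Comult ?G"
        using that Mid_natural[of "Ident ?G" "Ident ?G" f g] by (simp add: Hom_iff)
      also have "\<dots> = Pairing ?G (Pairing ?G (Ident ?G) f) (Pairing ?G (Ident ?G) g)"
        unfolding Comult_Comult using that by (simp add: Pairing_def Hom_iff)
      finally show ?thesis .
    qed
    have "Comult (ctx (A # \<Gamma>)) \<bullet> ?s b
        = Mid ?G ?G ?A ?A \<bullet> (Comult ?G \<odot> (Comult ?A \<bullet> den_bag \<Gamma> A b)) \<bullet> Comult ?G"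
      using h by (simp add: Pairing_def Hom_iff Comult_tensor)
    also have "\<dots> = msum ?G ((?G \<otimes> ?A) \<otimes> (?G \<otimes> ?A)) (\<lambda>p. Mid ?G ?G ?A ?A
       \<bullet> (Comult ?G \<odot> (case p of (x, y) \<Rightarrow> Pairing ?G (den_bag \<Gamma> A x) (den_bag \<Gamma> A y)))
           \<bullet> Comult ?G) (split2 b)"
    proof -
      let ?g = "\<lambda>p. case p of (x, y) \<Rightarrow> Pairing ?G (den_bag \<Gamma> A x) (den_bag \<Gamma> A y)"
      have g: "?g p \<in> Hom ?G (?A \<otimes> ?A)" if "p \<in># split2 b" for p
        using xy that by (cases p) (auto intro: Pairing_Hom)
      have "Comult ?A \<bullet> den_bag \<Gamma> A b = msum ?G (?A \<otimes> ?A) ?g (split2 b)"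
        by (rule Comult_Bag_prod) (rule pt)
      then have "Comult ?G \<odot> (Comult ?A \<bullet> den_bag \<Gamma> A b)
        = msum (?G \<otimes> ?G) ((?G \<otimes> ?G) \<otimes> (?A \<otimes> ?A)) (\<lambda>p. Comult ?G \<odot> ?g p) (split2 b)"
        using ten_msum[of "split2 b" ?g ?G "?A \<otimes> ?A" "Comult ?G" ?G "?G \<otimes> ?G"] g
            by (simp add: Hom_iff)
      then show ?thesis
        by (simp add: Hom_iff msum_comp[of _ ?G "?G \<otimes> ?G"] comp_msum[of _ "(?G \<otimes> ?G) \<otimes> (?A \<otimes> ?A)"])
    qed
    also have "\<dots> = msum ?G (ctx (A # \<Gamma>) \<otimes> ctx (A # \<Gamma>)) (\<lambda>(x, y). Pairing ?G (?s x) (?s y))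
        (split2 b)"
      unfolding ctx_obj.simps by (rule msum_cong) (use xy p in auto)
    finally show ?thesis .
  qed
  fix x assume x: "x < length (A # \<Gamma>)"
  show "den (A # \<Gamma>) (Var x) \<bullet> ?s b
      = den_sum \<Gamma> ((A # \<Gamma>) ! x) (subst (Var x) (length []) {#t. t \<in># b#})"
  proof (cases x)
    case 0
    \<comment> \<open>Index 0 selects the product, of which \<open>Pid\<close> leaves something only
      when the bag is a single term.\<close>
    have "Proj (A # \<Gamma>) 0 \<bullet> ?s b = den_bag \<Gamma> A b"
      using h Lunit_Pairing[OF h] by (simp add: Pairing_def Hom_iff)
    then have "den (A # \<Gamma>) (Var 0) \<bullet> ?s b = Pid ?A \<bullet> den_bag \<Gamma> A b" by simp
    then show ?thesis using Pid_Bag_prod[of b ?G ?A "den \<Gamma>", OF pt] 0 by simp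
  next
    case (Suc y)
    have "Runit ?G \<bullet> (Ident ?G \<odot> Counit ?G) \<bullet> Comult ?G = Ident ?G"
      by (rule Runit_Pairing) (simp add: Hom_iff)
    \<comment> \<open>Any other variable discards the product, and the counit vanishes on a nonempty
      bag.\<close>
    then have "Wk ?G ?A \<bullet> ?s b = (if b = {#} then Ident ?G else Zero ?G ?G)"
      using Pairing_Ident_simps(2)[OF h] Counit_Bag_prod[of b ?G ?A "den \<Gamma>", OF pt] by simp
    then have "den (A # \<Gamma>) (Var x) \<bullet> ?s b
        = (if b = {#} then den \<Gamma> (Var y) else Zero ?G (ty (\<Gamma> ! y)))"
      using Suc x by (simp add: Proj_Suc del: Proj.simps)
    then show ?thesis using Suc x den_Hom[OF wt_Var[of y \<Gamma>]] by (simp add: Hom_iff del: den.simps)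
  qed
qed auto

lemma den_beta:
  assumes "wt (A # \<Gamma>) s B" "eta_long_bag \<Gamma> b A"
  shows "den \<Gamma> (App (Lam A s) b) = den_sum \<Gamma> B (subst s 0 b)"
proof -
  let ?G = "ctx \<Gamma>"
  have h: "den (A # \<Gamma>) s \<in> Hom (?G \<otimes> ty A) (ty B)" using den_Hom[OF assms(1)] by simp
  have "den \<Gamma> (App (Lam A s) b)
      = Apply ?G (ty A) (ty B) (Curry ?G (ty A) (ty B) (den (A # \<Gamma>) s) \<bullet> Ident ?G) (den_bag \<Gamma> A b)"
    using assms(1) h by (simp add: wt_type_of Hom_iff)
  also have "\<dots> = den (A # \<Gamma>) s \<bullet> Pairing ?G (Ident ?G) (den_bag \<Gamma> A b)"
    by (rule Apply_Curry[OF h]) (use den_bag_Hom[OF assms(2)] in \<open>auto simp: Hom_iff\<close>)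
  also have "\<dots> = den_sum \<Gamma> B (subst s 0 b)"
    using den_subst[of "[]" A \<Gamma> s B, OF _ substitution_Pairing, of b] assms by auto
  finally show ?thesis .
qed

text \<open>Contextual steps hold by multilinearity of currying, application and convolution;
  \<open>red_eta_long\<close> supplies the typing of the reducts that these laws require.\<close>

lemma den_red:
  "red s S' \<Longrightarrow> wt \<Gamma> s A \<Longrightarrow> den \<Gamma> s = den_sum \<Gamma> A S'"
  "red_bag b B' \<Longrightarrow> eta_long_bag \<Gamma> b A \<Longrightarrow> den_bag \<Gamma> A b = den_bag_sum \<Gamma> A B'"
proof (induction arbitrary: \<Gamma> A and \<Gamma> A rule: red_red_bag.inducts)
  case (red_beta D s b)
  then show ?case by (auto elim!: wt_AppE wt_LamE intro!: den_beta simp del: den.simps)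
next
  case (red_lam s S' D)
  from red_lam.prems obtain B where B: "A = Arr D B" "wt (D # \<Gamma>) s B" by (auto elim: wt_LamE)
  have w: "wt (D # \<Gamma>) u B" if "u \<in># S'" for u using red_eta_long(1)[OF red_lam(1) that B(2)] by simp
  have "den \<Gamma> (Lam D s) = Curry (ctx \<Gamma>) (ty D) (ty B) (den_sum (D # \<Gamma>) B S')"
    using den_Lam[OF B(2)] red_lam.IH[OF B(2)] by simp
  also have "\<dots> = msum (ctx \<Gamma>) (ty A) (\<lambda>u. Curry (ctx \<Gamma>) (ty D) (ty B) (den (D # \<Gamma>) u)) S'"
    using Curry_msum[of S' "den (D # \<Gamma>)" "ctx \<Gamma>" "ty D" "ty B"] w den_Hom[of "D # \<Gamma>"] B by simp
  also have "\<dots> = msum (ctx \<Gamma>) (ty A) (\<lambda>u. den \<Gamma> (Lam D u)) S'"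
    by (intro msum_cong refl den_Lam[symmetric] w)
  finally show ?case by (simp add: msum_image_mset del: den.simps)
next
  case (red_app_left s S' b)
  from red_app_left.prems obtain D where D: "wt \<Gamma> s (Arr D A)" "eta_long_bag \<Gamma> b D"
      by (auto elim: wt_AppE)
  have "\<forall>u\<in>#S'. wt \<Gamma> u (Arr D A)" using red_eta_long(1)[OF red_app_left(1) _ D(1)] by simp
  then have "den_sum \<Gamma> A (App_sum S' {#b#})
      = Apply (ctx \<Gamma>) (ty D) (ty A) (den_sum \<Gamma> (Arr D A) S') (den_bag_sum \<Gamma> D {#b#})"
    by (rule den_App_sum) (use D in simp)
  then show ?case using den_App[OF D(1)] red_app_left.IH[OF D(1)] den_bag_Hom[OF D(2)]
    by (simp add: Hom_iff del: den.simps)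
next
  case (red_app_right b B' s)
  from red_app_right.prems obtain D where D: "wt \<Gamma> s (Arr D A)" "eta_long_bag \<Gamma> b D"
      by (auto elim: wt_AppE)
  have "\<forall>c\<in>#B'. eta_long_bag \<Gamma> c D" using red_eta_long(2)[OF red_app_right(1) _ D(2)] by blast
  then have "den_sum \<Gamma> A (App_sum {#s#} B')
      = Apply (ctx \<Gamma>) (ty D) (ty A) (den_sum \<Gamma> (Arr D A) {#s#}) (den_bag_sum \<Gamma> D B')"
    by (intro den_App_sum) (use D in auto)
  then show ?case using den_App[OF D(1)] red_app_right.IH[OF D(2)] den_Hom[OF D(1)]
    by (simp add: Hom_iff del: den.simps)
next
  case (red_bag_elem s S' b)
  then have s: "eta_long \<Gamma> s A" "eta_long_bag \<Gamma> b A" by auto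
  have "\<forall>u\<in>#S'. eta_long \<Gamma> u A" using red_eta_long(1)[OF red_bag_elem(1)] s by blast
  then have "den_bag_sum \<Gamma> A (cons_sum S' {#b#})
      = Conv (ctx \<Gamma>) (ty A) (den_sum \<Gamma> A S') (den_bag_sum \<Gamma> A {#b#})"
    by (rule den_cons_sum) (use s in simp)
  then show ?case using red_bag_elem.IH[of \<Gamma> A] s den_bag_Hom[OF s(2)] by (simp add: Hom_iff)
qed

lemma den_sum_sem:
  assumes "\<forall>s\<in>#S. eta_long \<Gamma> s A"
  shows "den_sum \<Gamma> A S = Arrow (ctx \<Gamma>) (sem_sum C ob \<Gamma> A S) (ty A)"
proof -
  have "sem C ob \<Gamma> s \<in> hom (ctx \<Gamma>) (ty A)" if "s \<in># S" for s
    using den_Hom[of \<Gamma> s A] den_sem[of \<Gamma> s A] assms that by (simp add: Hom_iff)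
  then have "msum (ctx \<Gamma>) (ty A) (\<lambda>m. Arrow (ctx \<Gamma>) m (ty A)) {#sem C ob \<Gamma> s. s \<in># S#}
    = Arrow (ctx \<Gamma>) (sem_sum C ob \<Gamma> A S) (ty A)"
    unfolding sem_sum_def by (intro msum_Arrow) auto
  moreover have "den_sum \<Gamma> A S = msum (ctx \<Gamma>) (ty A) (\<lambda>s. Arrow (ctx \<Gamma>) (sem C ob \<Gamma> s) (ty A)) S"
    using assms den_sem by (intro msum_cong) auto
  ultimately show ?thesis by (simp add: msum_image_mset)
qed

lemma sem_sum_red_sum:
  assumes "\<And>s. s \<in># S \<Longrightarrow> Tm \<Gamma> s A" "red_sum S S'"
  shows "sem_sum C ob \<Gamma> A S = sem_sum C ob \<Gamma> A S'"
  using assms(2)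
proof cases
  case (1 t T' T)
  have S: "\<forall>s\<in>#S. eta_long \<Gamma> s A" using assms(1) Tm_eta_long(1) by blast
  with 1 have t: "eta_long \<Gamma> t A" "\<forall>s\<in>#T. eta_long \<Gamma> s A" by auto
  have T': "\<forall>s\<in>#T'. eta_long \<Gamma> s A" using red_eta_long(1)[OF 1(3)] t by blast
  have "den_sum \<Gamma> A S' = den_sum \<Gamma> A T' \<oplus> den_sum \<Gamma> A T"
    unfolding 1 by (rule msum_union, rule den_Hom) (use T' t in auto)
  also have "\<dots> = den_sum \<Gamma> A S" unfolding 1 using den_red(1)[OF 1(3), of \<Gamma> A] t by simp
  finally show ?thesis
    using den_sum_sem[OF S] den_sum_sem[of S' \<Gamma> A] T' t 1 by auto
qed

end

theorem theorem6p8: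
  fixes C :: "('o, 'm) resource_structure"
    and ob :: 'o
    and \<Gamma> :: "ty list" and A :: ty
    and S S' :: tm_sum
  assumes closed: "closed_resource_category C"
    and pid_curry: "\<And>G X Y f. f \<in> hom\<^bsub>C\<^esub> (G \<otimes>\<^bsub>C\<^esub> X) Y \<Longrightarrow>
           \<Lambda>\<^bsub>C\<^esub> G X Y (pid\<^bsub>C\<^esub> Y \<cdot>\<^bsub>C\<^esub> f) = pid\<^bsub>C\<^esub> (X \<Rrightarrow>\<^bsub>C\<^esub> Y) \<cdot>\<^bsub>C\<^esub> \<Lambda>\<^bsub>C\<^esub> G X Y f"
    and typed: "\<And>s. s \<in># S \<Longrightarrow> Tm \<Gamma> s A"
    and red: "red_sum S S'"
  shows "sem_sum C ob \<Gamma> A S = sem_sum C ob \<Gamma> A S'"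
proof -
  interpret closed_resource_category C by (rule closed)
  interpret resource_model C ob by standard (rule pid_curry)
  show ?thesis using typed red by (rule sem_sum_red_sum)
qed

end
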